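(* Let $n\ge3$, $h\ne0$, and set $k=|h|>0$. Let $\gamma$ be a maximal connected regular $C^2$ curve in $\{(z,b)\in\mathbb S^2:b>0\}$ generating a Delaunay hypersurface of constant mean curvature $h$ in $\mathbb S^n$ with respect to some unit normal vector field. Then, up to reparametrization and a rotation $(z,b)\mapsto(e^{i\phi}z,b)$, $\gamma$ is one of the following: (1) the circle $s\equiv s_k$ (static type for $k$); (2) the complete curve extending the local $k$-curve with parameter some $C\in(0,C_k)$ (unduloid type); (3) the open arc extending the local $k$-curve with parameter $C=0$, generating (after adding its endpoints) a round hypersphere of mean curvature $k$ (a component of the union of spheres type); (4) the complete curve extending the local $k$-curve with parameter some $C\in(-\frac{k}{n-1},0)$ (nodoid type); (5) the complete curve extending the local $(-k)$-curve with parameter $C=\frac{k}{n-1}$ (flower type); (6) the complete curve extending the local $(-k)$-curve with parameter some $C\in(\frac{k}{n-1},C_{-k})$ (unduloid type); (7) the circle $s\equiv s_{-k}$ (static type for $-k$).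
   Context: $\mathbb S^n$ is the unit sphere of $\mathbb C\oplus\mathbb R^{n-1}$, $\mathbb S^2$ the unit sphere of $\mathbb C\oplus\mathbb R$, $S^{n-2}$ the unit sphere of $\mathbb R^{n-1}$, $p=(0,1)\in\mathbb S^2$. A regular $C^2$ curve $\gamma=(z,b):I\to\mathbb S^2$ with $b>0$ generates $G_\gamma:I\times S^{n-2}\to\mathbb S^n$, $G_\gamma(t,x)=(z(t),b(t)x)$; when this has constant mean curvature it is called a Delaunay hypersurface. Maximal means not extendable to a larger such curve. Mean curvature is unnormalized (trace of the second fundamental form); small geodesic spheres have positive mean curvature with respect to the normal pointing into the ball. Points of $\mathbb S^2$ with $b\ge 0$ are written $(\cos s\,e^{is_1},\sin s)$, $s\in[0,\frac{\pi}{2}]$. For $\kappa,C\in\mathbb R$ put $L(s)=\cos s\,\sin^{n-2}s$, $R(s,C,\kappa)=C+\frac{\kappa}{n-1}\sin^{n-1}s$, and $J(C,\kappa)=\{s\in(0,\frac{\pi}{2}):|R(s,C,\kappa)|<L(s)\}$ (an interval). The local $\kappa$-curve with parameter $C$ is $\gamma(s)=(\cos s\,e^{is_1(s)},\sin s)$, $s\in J(C,\kappa)$, with $\frac{ds_1}{ds}=\frac{R}{\cos s\sqrt{L^2-R^2}}$. $s_\kappa\in(0,\frac{\pi}{2})$ is the unique solution of $-\tan s_\kappa+(n-2)\cot s_\kappa=\kappa$ and $C_\kappa:=L(s_\kappa)-\frac{\kappa}{n-1}\sin^{n-1}s_\kappa$. Extension of a local curve: at every endpoint $s\in(0,\frac{\pi}{2})$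 of a piece, with limiting phase $\theta$ of $s_1$, the curve is continued by its image under $(z,b)\mapsto(e^{2i\theta}\bar z,b)$, and this is repeated; at an endpoint $s=0$ there is no continuation; at an endpoint $s=\frac{\pi}{2}$ (point $p$, only in the flower case), with limiting phase $\theta$, the curve is continued through $p$ by its image under $(z,b)\mapsto(-e^{2i\theta}\bar z,b)$. *)

theory Defs
  imports "HOL-Analysis.Analysis"
begin

text \<open>Throughout, \<open>real ^ 'm\<close> with \<open>CARD('m) = n - 1\<close> is the factor \<open>\<real>\<^bsup>n-1\<^esup>\<close>; the spheres
  \<open>S\<^bsup>n-2\<^esup>\<close>, \<open>S\<^sup>2\<close>, \<open>S\<^sup>n\<close> are the unit spheres of \<open>real ^ 'm\<close>, \<open>complex \<times> real\<close> and
  \<open>complex \<times> real ^ 'm\<close>.\<close>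

section \<open>Generating curves and mean curvature\<close>

text \<open>Curves are parametrized by open intervals; a closed curve is run through periodically.\<close>

definition regular_C2_on :: "real set \<Rightarrow> (real \<Rightarrow> 'a::real_normed_vector) \<Rightarrow> bool" where
  "regular_C2_on I \<gamma> \<longleftrightarrow>
     (\<exists>\<gamma>'. (\<forall>t\<in>I. (\<gamma> has_vector_derivative \<gamma>' t) (at t) \<and> \<gamma>' t \<noteq> 0) \<and>
           \<gamma>' C1_differentiable_on I)"

definition generating_curve :: "real set \<Rightarrow> (real \<Rightarrow> complex \<times> real) \<Rightarrow> bool" where
  "generating_curve I \<gamma> \<longleftrightarrow>
     open I \<and> is_interval I \<and> I \<noteq> {} \<and> regular_C2_on I \<gamma> \<and>
     (\<forall>t\<in>I. \<gamma> t \<in> sphere 0 1 \<and> snd (\<gamma> t) > 0)"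

definition rot_hyp ::
  "(real \<Rightarrow> complex \<times> real) \<Rightarrow> real \<times> (real ^ 'm::finite) \<Rightarrow> complex \<times> (real ^ 'm)" where
  "rot_hyp \<gamma> = (\<lambda>(t, x). (fst (\<gamma> t), snd (\<gamma> t) *\<^sub>R x))"

abbreviation rot_dom :: "real set \<Rightarrow> (real \<times> (real ^ 'm::finite)) set" where
  "rot_dom I \<equiv> I \<times> sphere 0 1"

definition rot_tangent :: "real \<times> (real ^ 'm::finite) \<Rightarrow> (real \<times> (real ^ 'm)) set" where
  "rot_tangent q = {v. snd q \<bullet> snd v = 0}"

text \<open>The formula for \<open>rot_hyp\<close> makes sense on \<open>I \<times> real ^ 'm\<close>; on \<open>rot_tangent q\<close> its derivative
  there is the differential of the hypersurface.\<close>

abbreviation rot_diff ::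
  "(real \<Rightarrow> complex \<times> real) \<Rightarrow> real \<times> (real ^ 'm::finite) \<Rightarrow> real \<times> (real ^ 'm)
     \<Rightarrow> complex \<times> (real ^ 'm)" where
  "rot_diff \<gamma> q \<equiv> frechet_derivative (rot_hyp \<gamma>) (at q)"

text \<open>The normal is normal within the sphere \<open>S\<^sup>n\<close>, hence also orthogonal to the position vector.\<close>

definition unit_normal_field ::
  "real set \<Rightarrow> (real \<Rightarrow> complex \<times> real) \<Rightarrow>
   (real \<times> (real ^ 'm::finite) \<Rightarrow> complex \<times> (real ^ 'm)) \<Rightarrow> bool" where
  "unit_normal_field I \<gamma> N \<longleftrightarrow>
     continuous_on (rot_dom I) N \<and>
     (\<forall>q\<in>rot_dom I. norm (N q) = 1 \<and> N q \<bullet> rot_hyp \<gamma> q = 0 \<and>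
        (\<forall>v\<in>rot_tangent q. N q \<bullet> rot_diff \<gamma> q v = 0))"

text \<open>Trace of the second fundamental form \<open>II(v,w) = - \<langle>dN v, dG w\<rangle>\<close>, computed in a basis \<open>E\<close>
  of the tangent space that is orthonormal for the induced metric. With this sign, small geodesic
  spheres have positive mean curvature for the normal pointing into the ball. The derivative of
  \<open>N\<close> within the domain is determined on \<open>rot_tangent q\<close>, the only place where it is used.\<close>

definition has_mean_curvature ::
  "real set \<Rightarrow> (real \<Rightarrow> complex \<times> real) \<Rightarrow>
   (real \<times> (real ^ 'm::finite) \<Rightarrow> complex \<times> (real ^ 'm)) \<Rightarrow>
   real \<Rightarrow> real \<times> (real ^ 'm) \<Rightarrow> bool" where
  "has_mean_curvature I \<gamma> N H q \<longleftrightarrow>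
     (\<exists>N' E. (N has_derivative N') (at q within rot_dom I) \<and>
        span E = rot_tangent q \<and>
        (\<forall>v\<in>E. \<forall>w\<in>E. rot_diff \<gamma> q v \<bullet> rot_diff \<gamma> q w = (if v = w then 1 else 0)) \<and>
        H = (\<Sum>v\<in>E. - (N' v \<bullet> rot_diff \<gamma> q v)))"

definition cmc_with_normal ::
  "real set \<Rightarrow> (real \<Rightarrow> complex \<times> real) \<Rightarrow>
   (real \<times> (real ^ 'm::finite) \<Rightarrow> complex \<times> (real ^ 'm)) \<Rightarrow> real \<Rightarrow> bool" where
  "cmc_with_normal I \<gamma> N h \<longleftrightarrow>
     unit_normal_field I \<gamma> N \<and> (\<forall>q\<in>rot_dom I. has_mean_curvature I \<gamma> N h q)"

definition delaunay_curve ::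
  "'m::finite itself \<Rightarrow> real \<Rightarrow> real set \<Rightarrow> (real \<Rightarrow> complex \<times> real) \<Rightarrow> bool" where
  "delaunay_curve (_::'m itself) h I \<gamma> \<longleftrightarrow>
     generating_curve I \<gamma> \<and>
     (\<exists>N :: real \<times> (real ^ 'm) \<Rightarrow> complex \<times> (real ^ 'm). cmc_with_normal I \<gamma> N h)"

text \<open>The orientation may be reversed. Between regular \<open>C\<^sup>2\<close> curves a homeomorphic change of
  parameter is automatically a \<open>C\<^sup>2\<close> diffeomorphism; homeomorphisms are used because the model
  curves below are glued from pieces parametrized by \<open>s\<close>, which is not a regular parameter where
  two pieces meet.\<close>

definition reparametrization ::
  "real set \<Rightarrow> (real \<Rightarrow> 'a) \<Rightarrow> real set \<Rightarrow> (real \<Rightarrow> 'a) \<Rightarrow> bool" where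
  "reparametrization I \<gamma> D \<delta> \<longleftrightarrow>
     (\<exists>\<phi> \<psi>. homeomorphism I D \<phi> \<psi> \<and> (\<forall>t\<in>I. \<gamma> t = \<delta> (\<phi> t)))"

definition maximal_delaunay_curve ::
  "'m::finite itself \<Rightarrow> real \<Rightarrow> real set \<Rightarrow> (real \<Rightarrow> complex \<times> real) \<Rightarrow> bool" where
  "maximal_delaunay_curve T h I \<gamma> \<longleftrightarrow>
     delaunay_curve T h I \<gamma> \<and>
     \<not> (\<exists>I' \<gamma>' A. delaunay_curve T h I' \<gamma>' \<and> A \<subset> I' \<and> reparametrization I \<gamma> A \<gamma>')"

definition rotate_phase :: "real \<Rightarrow> complex \<times> real \<Rightarrow> complex \<times> real" where
  "rotate_phase \<phi> q = (cis \<phi> * fst q, snd q)"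

definition congruent_curve ::
  "real set \<Rightarrow> (real \<Rightarrow> complex \<times> real) \<Rightarrow> real set \<Rightarrow> (real \<Rightarrow> complex \<times> real) \<Rightarrow> bool" where
  "congruent_curve I \<gamma> D \<delta> \<longleftrightarrow> (\<exists>\<phi>. reparametrization I \<gamma> D (\<lambda>t. rotate_phase \<phi> (\<delta> t)))"


section \<open>The model curves\<close>

definition sph_point :: "real \<Rightarrow> real \<Rightarrow> complex \<times> real" where
  "sph_point s s1 = (of_real (cos s) * cis s1, sin s)"

definition L_fun :: "nat \<Rightarrow> real \<Rightarrow> real" where
  "L_fun n s = cos s * sin s ^ (n - 2)"

definition R_fun :: "nat \<Rightarrow> real \<Rightarrow> real \<Rightarrow> real \<Rightarrow> real" where
  "R_fun n s C \<kappa> = C + \<kappa> / (real n - 1) * sin s ^ (n - 1)"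

definition J_set :: "nat \<Rightarrow> real \<Rightarrow> real \<Rightarrow> real set" where
  "J_set n C \<kappa> = {s. 0 < s \<and> s < pi / 2 \<and> \<bar>R_fun n s C \<kappa>\<bar> < L_fun n s}"

definition s_stat :: "nat \<Rightarrow> real \<Rightarrow> real" where
  "s_stat n \<kappa> = (THE s. 0 < s \<and> s < pi / 2 \<and> - tan s + (real n - 2) * cot s = \<kappa>)"

definition C_stat :: "nat \<Rightarrow> real \<Rightarrow> real" where
  "C_stat n \<kappa> = L_fun n (s_stat n \<kappa>) - \<kappa> / (real n - 1) * sin (s_stat n \<kappa>) ^ (n - 1)"

definition local_curve :: "nat \<Rightarrow> real \<Rightarrow> real \<Rightarrow> (real \<Rightarrow> complex \<times> real) \<Rightarrow> bool" where
  "local_curve n \<kappa> C \<delta> \<longleftrightarrow>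
     (\<exists>s1. (\<forall>s\<in>J_set n C \<kappa>.
              (s1 has_real_derivative
                 R_fun n s C \<kappa> / (cos s * sqrt ((L_fun n s)\<^sup>2 - (R_fun n s C \<kappa>)\<^sup>2))) (at s)) \<and>
           (\<forall>s\<in>J_set n C \<kappa>. \<delta> s = sph_point s (s1 s)))"

text \<open>\<open>(z, b) \<mapsto> (\<zeta> \<cdot> cnj z, b)\<close>; an involution for \<open>\<zeta>\<close> on the unit circle.\<close>

definition reflect_phase :: "complex \<Rightarrow> complex \<times> real \<Rightarrow> complex \<times> real" where
  "reflect_phase \<zeta> q = (\<zeta> * cnj (fst q), snd q)"

text \<open>The extension of the local curve on \<open>J = (a, b)\<close>, with \<open>w = b - a\<close>. The parameter line is
  cut into pieces of length \<open>w\<close> at the points \<open>e = a + m w\<close>; the piece \<open>J\<close> carries the local curve,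
  and consecutive pieces are images of each other under the reflection determined by the limiting
  phase \<open>\<theta>\<close> at their common endpoint (taken from the left; the phase from the right is \<open>\<theta>\<close>, or
  \<open>\<theta> + pi\<close> at \<open>p = (0, 1)\<close>, and gives the same reflection). Since there is no continuation at
  \<open>s = 0\<close>, for \<open>a = 0\<close> the curve consists of \<open>J\<close> and its image under the reflection at \<open>b\<close> only.\<close>

definition extended_curve ::
  "nat \<Rightarrow> real \<Rightarrow> real \<Rightarrow> real set \<Rightarrow> (real \<Rightarrow> complex \<times> real) \<Rightarrow> bool" where
  "extended_curve n \<kappa> C D \<delta> \<longleftrightarrow>
     (let a = Inf (J_set n C \<kappa>); b = Sup (J_set n C \<kappa>); w = b - a in
        local_curve n \<kappa> C \<delta> \<and>
        D = (if a = 0 then {a<..<b + w} else UNIV) \<and>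
        continuous_on D \<delta> \<and>
        (\<forall>m::int. \<forall>e. e = a + of_int m * w \<and> e \<in> D \<longrightarrow>
           (\<exists>\<theta>. ((\<lambda>t. sgn (fst (\<delta> t))) \<longlongrightarrow> cis \<theta>) (at_left e) \<and>
                (\<forall>t\<in>{e - w<..<e}.
                   \<delta> (2 * e - t) =
                     reflect_phase (if \<delta> e = (0, 1) then - cis (2 * \<theta>) else cis (2 * \<theta>)) (\<delta> t)))))"

definition is_extension_type ::
  "nat \<Rightarrow> real \<Rightarrow> real \<Rightarrow> real set \<Rightarrow> (real \<Rightarrow> complex \<times> real) \<Rightarrow> bool" where
  "is_extension_type n \<kappa> C I \<gamma> \<longleftrightarrow>
     (\<exists>D \<delta>. extended_curve n \<kappa> C D \<delta> \<and> congruent_curve I \<gamma> D \<delta>)"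

definition is_static_type ::
  "nat \<Rightarrow> real \<Rightarrow> real set \<Rightarrow> (real \<Rightarrow> complex \<times> real) \<Rightarrow> bool" where
  "is_static_type n \<kappa> I \<gamma> \<longleftrightarrow> congruent_curve I \<gamma> UNIV (sph_point (s_stat n \<kappa>))"

definition geodesic_sphere ::
  "complex \<times> (real ^ 'm::finite) \<Rightarrow> real \<Rightarrow> (complex \<times> (real ^ 'm)) set" where
  "geodesic_sphere u \<rho> = {y \<in> sphere 0 1. y \<bullet> u = cos \<rho>}"

text \<open>The hypersurface together with the endpoints \<open>(e, 0)\<close> of its generating arc is a geodesic
  sphere; \<open>N q \<bullet> u > 0\<close> says that \<open>N\<close> points into the ball around \<open>u\<close>.\<close>

definition generates_round_sphere ::
  "'m::finite itself \<Rightarrow> real \<Rightarrow> real set \<Rightarrow> (real \<Rightarrow> complex \<times> real) \<Rightarrow> bool" where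
  "generates_round_sphere (_::'m itself) k I \<gamma> \<longleftrightarrow>
     (\<exists>(u :: complex \<times> (real ^ 'm)) \<rho> N.
        u \<in> sphere 0 1 \<and> 0 < \<rho> \<and> \<rho> < pi \<and>
        rot_hyp \<gamma> ` rot_dom I \<union> {(e, 0) | e. (e, 0) \<in> closure (\<gamma> ` I)} = geodesic_sphere u \<rho> \<and>
        cmc_with_normal I \<gamma> N k \<and> (\<forall>q\<in>rot_dom I. N q \<bullet> u > 0))"

end

theory Submission
  imports Defs
begin

text \<open>Parametrize the generating curve by arc length. Constant mean curvature then becomes a second
  order equation with locally Lipschitz right-hand side, so that a maximal curve is a maximal
  solution, and the angular momentum \<open>\<omega>\<close> about the axis satisfies
  \<open>b\<^bsup>n-2\<^esup> \<omega> = C + \<kappa>/(n-1) b\<^bsup>n-1\<^esup>\<close>. Together with \<open>b'\<^sup>2 = 1 - b\<^sup>2 - \<omega>\<^sup>2\<close> this makes \<open>b = sin s\<close>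
  oscillate between the endpoints of the interval where \<open>\<bar>R\<bar> < L\<close>: these are simple zeros of
  \<open>1 - b\<^sup>2 - \<omega>\<^sup>2\<close> unless \<open>C\<close> is extremal, hence are reached in finite time. Uniqueness of solutions
  makes the curve symmetric about every turning point, and the antiderivative of \<open>\<bar>s'\<bar>\<close> is the
  parameter of the glued model curve. Reversing the orientation replaces \<open>(\<kappa>, C)\<close> by \<open>(-\<kappa>, -C)\<close>,
  which reduces everything to \<open>\<kappa> = k\<close>, \<open>C > -k/(n-1)\<close> or \<open>\<kappa> = -k\<close>, \<open>C \<ge> k/(n-1)\<close>.\<close>


section \<open>Ordinary differential equations\<close>

text \<open>Phase and latitude are poor coordinates: along a curve through (0, 1) the phase jumps by
  \<pi>, and at a turning point \<open>s\<close> is no regular parameter. The equation is therefore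
  written for position and velocity in \<complex> \<oplus> \<real> with the cross product, where the
  field is smooth for b > 0, and the phase is recovered only on one monotone piece. The axis b = 0
  is the sole place where a solution can end in finite time. Since \<bar>\<omega>\<bar> \<le> 1, the
  first integral keeps b away from 0 whenever C \<noteq> 0; so C = 0 is the only incomplete case,
  and there the curve is an explicit arc of a circle. The base point is a maximum of b rather than a
  minimum, because a maximum exists for every non-extremal C, including C = 0. Maximality passes
  from the given curve to the solution because every solution generates in turn a hypersurface of
  constant mean curvature, so that a longer solution would be a longer Delaunay curve.\<close>

lemma picard_forward:
  fixes f :: "'a::euclidean_space \<Rightarrow> 'a"
  assumes lip: "L-lipschitz_on (cball y0 r) f" and r: "0 < r"
  obtains \<delta> y where "0 < \<delta>" "y 0 = y0" "continuous_on {0..\<delta>} y"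
    "\<And>t. t \<in> {0<..<\<delta>} \<Longrightarrow> (y has_vector_derivative f (y t)) (at t)"
proof -
  have fcont: "continuous_on (cball y0 r) f"
    using lip by (rule lipschitz_on_continuous_on)
  have "bounded (f ` cball y0 r)"
    by (intro compact_imp_bounded compact_continuous_image fcont compact_cball)
  then obtain M where M: "0 < M" "\<And>x. x \<in> cball y0 r \<Longrightarrow> norm (f x) \<le> M"
    by (metis bounded_pos imageI)
  have L: "0 \<le> L" using lip by (rule lipschitz_on_nonneg)
  \<comment> \<open>The first bound keeps the Picard iterates in the ball, the second makes the
    iteration contract by 1/2; \<open>L + 1\<close> covers \<open>L = 0\<close>.\<close>
  define \<delta> where "\<delta> = min (r / M) (1 / (2 * (L + 1)))"
  have \<delta>: "0 < \<delta>" "\<delta> * M \<le> r" "\<delta> * L \<le> 1 / 2"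
  proof -
    show "0 < \<delta>" using M r L by (simp add: \<delta>_def)
    have "\<delta> * M \<le> r / M * M" using M by (intro mult_right_mono) (auto simp: \<delta>_def)
    then show "\<delta> * M \<le> r" using M by simp
    have "\<delta> * L \<le> 1 / (2 * (L + 1)) * L" using L by (intro mult_right_mono) (auto simp: \<delta>_def)
    also have "\<dots> \<le> 1 / 2" using L by (simp add: field_simps)
    finally show "\<delta> * L \<le> 1 / 2" .
  qed
  \<comment> \<open>The fixed point is sought among bounded continuous functions on the whole line,
    a complete space. Clamping the time with \<open>cl\<close> freezes the integral operator outside
    [0, \<delta>], so that its values lie in this space again.\<close>
  define S :: "(real \<Rightarrow>\<^sub>C 'a) set" where "S = PiC UNIV (\<lambda>_. cball y0 r)"
  have S: "u \<in> S \<longleftrightarrow> (\<forall>t. apply_bcontfun u t \<in> cball y0 r)" for u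
    by (auto simp: S_def mem_PiC_iff)
  define cl where "cl t = max 0 (min \<delta> t)" for t :: real
  have cl: "0 \<le> cl t" "cl t \<le> \<delta>" "continuous_on UNIV cl" for t
    using \<delta> by (auto simp: cl_def intro!: continuous_intros)
  define P where "P u t = y0 + integral {0..t} (\<lambda>s. f (apply_bcontfun u s))"
    for u :: "real \<Rightarrow>\<^sub>C 'a" and t
  have fu: "continuous_on A (\<lambda>s. f (apply_bcontfun u s))" if "u \<in> S" for u A
    using that S by (intro continuous_on_compose2[OF fcont]) auto
  have Pcont: "continuous_on {0..\<delta>} (P u)" if "u \<in> S" for u
    unfolding P_def
    by (intro continuous_intros indefinite_integral_continuous_1 integrable_continuous_real fu that)
  have Pball: "P u t \<in> cball y0 r" if "u \<in> S" "0 \<le> t" "t \<le> \<delta>" for u t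
  proof -
    have "norm (integral {0..t} (\<lambda>s. f (apply_bcontfun u s))) \<le> M * (t - 0)"
      using that S by (intro integral_bound fu M) auto
    also have "\<dots> \<le> M * \<delta>" using M that by (intro mult_left_mono) auto
    also have "\<dots> \<le> r" using \<delta> by (simp add: mult.commute)
    finally show ?thesis by (simp add: P_def dist_norm)
  qed
  have PB: "(\<lambda>t. P u (cl t)) \<in> bcontfun" if "u \<in> S" for u
    unfolding bcontfun_def
  proof (intro CollectI conjI)
    show "continuous_on UNIV (\<lambda>t. P u (cl t))"
      by (rule continuous_on_compose2[OF Pcont[OF that] cl(3)]) (use cl in auto)
    show "bounded (range (\<lambda>t. P u (cl t)))"
      by (rule bounded_subset[OF bounded_cball[of y0 r]]) (use Pball[OF that] cl in auto)
  qed
  define T where "T u = Bcontfun (\<lambda>t. P u (cl t))" for u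
  have T: "apply_bcontfun (T u) t = P u (cl t)" if "u \<in> S" for u t
    using PB[OF that] by (simp add: T_def Bcontfun_inverse)
  have "\<exists>!u. u \<in> S \<and> T u = u"
  proof (rule Banach_fix[where c = "1/2"])
    show "complete S"
      unfolding S_def complete_eq_closed by (intro closed_PiC) auto
    have "const_bcontfun y0 \<in> S" using r by (simp add: S const_bcontfun.rep_eq)
    then show "S \<noteq> {}" by auto
    show "T ` S \<subseteq> S"
      using Pball cl by (auto simp: S T)
    have "dist (T u) (T w) \<le> 1 / 2 * dist u w" if uw: "u \<in> S" "w \<in> S" for u w
    proof (rule dist_bound)
      fix t
      have "P u (cl t) - P w (cl t) =
          integral {0..cl t} (\<lambda>s. f (apply_bcontfun u s) - f (apply_bcontfun w s))"
        unfolding P_def using uw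
        by (subst integral_diff) (auto intro!: integrable_continuous_real fu)
      also have "norm \<dots> \<le> (L * dist u w) * (cl t - 0)"
      proof (rule integral_bound)
        fix s
        have "norm (f (apply_bcontfun u s) - f (apply_bcontfun w s))
            \<le> L * dist (apply_bcontfun u s) (apply_bcontfun w s)"
          unfolding dist_norm[symmetric] using uw S by (intro lipschitz_onD[OF lip]) auto
        also have "\<dots> \<le> L * dist u w" by (intro mult_left_mono dist_bounded L)
        finally show "norm (f (apply_bcontfun u s) - f (apply_bcontfun w s)) \<le> L * dist u w" .
      qed (use cl uw in \<open>auto intro!: continuous_intros fu\<close>)
      also have "\<dots> \<le> (L * dist u w) * \<delta>" using cl L by (intro mult_left_mono) auto
      also have "\<dots> = (\<delta> * L) * dist u w" by simp
      also have "\<dots> \<le> 1 / 2 * dist u w" using \<delta> by (intro mult_right_mono) auto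
      finally show "dist (apply_bcontfun (T u) t) (apply_bcontfun (T w) t) \<le> 1 / 2 * dist u w"
        using uw by (simp add: T dist_norm)
    qed
    then show "\<And>x y. x \<in> S \<Longrightarrow> y \<in> S \<Longrightarrow> dist (T x) (T y) \<le> 1 / 2 * dist x y" by simp
  qed auto
  then obtain u where u: "u \<in> S" "T u = u" by auto
  have up: "apply_bcontfun u t = P u t" if "0 \<le> t" "t \<le> \<delta>" for t
  proof -
    have "cl t = t" using that by (simp add: cl_def)
    then show ?thesis using T[OF u(1), of t] u by simp
  qed
  show ?thesis
  proof (rule that[of \<delta> "apply_bcontfun u"])
    show "apply_bcontfun u 0 = y0" using up[of 0] \<delta> by (simp add: P_def)
    fix t assume t: "t \<in> {0<..<\<delta>}"
    have "((\<lambda>t. integral {0..t} (\<lambda>s. f (apply_bcontfun u s))) has_vector_derivative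
        f (apply_bcontfun u t)) (at t within {0..\<delta>})"
      using t by (intro integral_has_vector_derivative fu u) auto
    then have "(P u has_vector_derivative f (apply_bcontfun u t)) (at t within {0..\<delta>})"
      unfolding P_def by (auto intro!: derivative_eq_intros)
    then have "(P u has_vector_derivative f (apply_bcontfun u t)) (at t)"
      using t at_within_Icc_at[of 0 t \<delta>] by simp
    then show "(apply_bcontfun u has_vector_derivative f (apply_bcontfun u t)) (at t)"
      by (rule has_vector_derivative_transform_within_open[of _ _ _ "{0<..<\<delta>}"])
        (use t up in auto)
  qed (use \<delta> in auto)
qed

text \<open>The fundamental theorem of calculus tolerates the exceptional point \<open>e\<close>, so
  \<open>y\<close> is an integral of the continuous \<open>g\<close> across it, and such an integral
  is differentiable at \<open>e\<close>. This glues two solutions at a common end.\<close>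

lemma has_vector_derivative_at_join:
  fixes y :: "real \<Rightarrow> 'a::euclidean_space"
  assumes cont: "continuous_on {a<..<b} y" and g: "continuous_on {a<..<b} g"
    and d: "\<And>t. t \<in> {a<..<b} \<Longrightarrow> t \<noteq> e \<Longrightarrow> (y has_vector_derivative g t) (at t)"
    and e: "e \<in> {a<..<b}"
  shows "(y has_vector_derivative g e) (at e)"
proof -
  define a' where "a' = (a + e) / 2"
  define b' where "b' = (e + b) / 2"
  have ab: "a < a'" "a' < e" "e < b'" "b' < b" using e by (auto simp: a'_def b'_def)
  have eq: "y t = y a' + integral {a'..t} g" if "t \<in> {a'..b'}" for t
  proof -
    have "(g has_integral (y t - y a')) {a'..t}"
      using that ab
      by (intro fundamental_theorem_of_calculus_interior_strong[of "{e}"])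
        (auto intro!: d continuous_on_subset[OF cont])
    then show ?thesis by (simp add: integral_unique)
  qed
  have "((\<lambda>t. integral {a'..t} g) has_vector_derivative g e) (at e within {a'..b'})"
    using ab by (intro integral_has_vector_derivative continuous_on_subset[OF g]) auto
  then have "((\<lambda>t. y a' + integral {a'..t} g) has_vector_derivative g e) (at e within {a'..b'})"
    by (auto intro!: derivative_eq_intros)
  then have "((\<lambda>t. y a' + integral {a'..t} g) has_vector_derivative g e) (at e)"
    using at_within_Icc_at[of a' e b'] ab by simp
  then show ?thesis
  proof (rule has_vector_derivative_transform_within_open)
    show "y a' + integral {a'..t} g = y t" if "t \<in> {a'<..<b'}" for t
      by (rule eq[symmetric]) (use that in auto)
  qed (use ab in auto)
qed

text \<open>Gronwall in energy form: the Lipschitz bound makes exp (-2 L t) times the squared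
  distance nonincreasing, and it starts at 0.\<close>

lemma ode_unique_forward:
  fixes x y :: "real \<Rightarrow> 'a::euclidean_space"
  assumes lip: "L-lipschitz_on K f"
    and x: "\<And>t. t \<in> {a..b} \<Longrightarrow> (x has_vector_derivative f (x t)) (at t) \<and> x t \<in> K"
    and y: "\<And>t. t \<in> {a..b} \<Longrightarrow> (y has_vector_derivative f (y t)) (at t) \<and> y t \<in> K"
    and eq: "x a = y a" and t: "t \<in> {a..b}"
  shows "x t = y t"
proof -
  define d where "d t = x t - y t" for t
  define w where "w t = exp (- 2 * L * t) * (d t \<bullet> d t)" for t
  have dd: "(d has_vector_derivative (f (x s) - f (y s))) (at s)" if "s \<in> {a..b}" for s
    unfolding d_def using x[OF that] y[OF that] by (auto intro!: derivative_eq_intros)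
  have dw: "(w has_real_derivative
      exp (- 2 * L * s) * (2 * (d s \<bullet> (f (x s) - f (y s)))) - 2 * L * exp (- 2 * L * s) * (d s \<bullet> d s)) (at s)"
    if "s \<in> {a..b}" for s
  proof -
    have "((\<lambda>s. d s \<bullet> d s) has_real_derivative
        (d s \<bullet> (f (x s) - f (y s)) + (f (x s) - f (y s)) \<bullet> d s)) (at s)"
      unfolding has_real_derivative_iff_has_vector_derivative
      by (rule bounded_bilinear.has_vector_derivative[OF bounded_bilinear_inner dd[OF that] dd[OF that]])
    then show ?thesis
      unfolding w_def by (auto intro!: derivative_eq_intros simp: inner_commute algebra_simps)
  qed
  have "w t \<le> w a"
  proof (rule DERIV_nonpos_imp_nonincreasing[of a t w])
    fix s assume s: "a \<le> s" "s \<le> t"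
    with t have s': "s \<in> {a..b}" by auto
    have "d s \<bullet> (f (x s) - f (y s)) \<le> norm (d s) * norm (f (x s) - f (y s))"
      by (rule norm_cauchy_schwarz)
    also have "\<dots> \<le> norm (d s) * (L * norm (d s))"
      using lipschitz_onD[OF lip, of "x s" "y s"] x[OF s'] y[OF s']
      by (intro mult_left_mono) (auto simp: d_def dist_norm)
    finally have "d s \<bullet> (f (x s) - f (y s)) \<le> L * (d s \<bullet> d s)"
      by (simp add: dot_square_norm power2_eq_square mult_ac)
    then have "exp (- 2 * L * s) * (2 * (d s \<bullet> (f (x s) - f (y s))))
        \<le> exp (- 2 * L * s) * (2 * (L * (d s \<bullet> d s)))"
      by (intro mult_left_mono) auto
    then show "\<exists>y. (w has_real_derivative y) (at s) \<and> y \<le> 0"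
      using dw[OF s'] by (intro exI conjI) (auto simp: algebra_simps)
  qed (use t in auto)
  moreover have "w a = 0" using eq by (simp add: w_def d_def)
  ultimately have "d t \<bullet> d t \<le> 0" by (simp add: w_def mult_le_0_iff)
  then have "d t = 0" by (metis inner_ge_zero inner_eq_zero_iff order_antisym)
  then show ?thesis by (simp add: d_def)
qed

text \<open>Boundedness is part of the notion because it is what makes a product of Lipschitz
  functions Lipschitz again. The class is then closed under the operations that build up the profile
  equation.\<close>

definition bounded_lipschitz_on :: "'a::metric_space set \<Rightarrow> ('a \<Rightarrow> 'b::real_normed_vector) \<Rightarrow> bool" where
  "bounded_lipschitz_on X f \<longleftrightarrow> bounded (f ` X) \<and> (\<exists>L. L-lipschitz_on X f)"

lemma bounded_lipschitz_onI:
  assumes "\<And>x. x \<in> X \<Longrightarrow> norm (f x) \<le> B"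
    "\<And>x y. x \<in> X \<Longrightarrow> y \<in> X \<Longrightarrow> norm (f x - f y) \<le> L * dist x y" "0 \<le> L"
  shows "bounded_lipschitz_on X f"
proof -
  have "L-lipschitz_on X f" using assms by (auto intro!: lipschitz_onI simp: dist_norm)
  then show ?thesis using assms(1) unfolding bounded_lipschitz_on_def bounded_iff by blast
qed

lemma bounded_lipschitz_onE:
  assumes "bounded_lipschitz_on X f"
  obtains B L where "0 \<le> B" "0 \<le> L" "\<And>x. x \<in> X \<Longrightarrow> norm (f x) \<le> B"
    "\<And>x y. x \<in> X \<Longrightarrow> y \<in> X \<Longrightarrow> norm (f x - f y) \<le> L * dist x y"
proof -
  obtain B L where "\<And>x. x \<in> X \<Longrightarrow> norm (f x) \<le> B" "L-lipschitz_on X f"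
    using assms unfolding bounded_lipschitz_on_def bounded_iff by auto
  then show ?thesis
    using that[of "\<bar>B\<bar>" L] lipschitz_on_nonneg[of L X f] lipschitz_onD[of L X f]
    by (force simp: dist_norm)
qed

named_theorems bl_intros

lemma bounded_lipschitz_on_linear:
  assumes "bounded_linear g" "bounded_lipschitz_on X f"
  shows "bounded_lipschitz_on X (\<lambda>x. g (f x))"
proof -
  obtain B L where f: "0 \<le> B" "0 \<le> L" "\<And>x. x \<in> X \<Longrightarrow> norm (f x) \<le> B"
    "\<And>x y. x \<in> X \<Longrightarrow> y \<in> X \<Longrightarrow> norm (f x - f y) \<le> L * dist x y"
    using assms(2) by (rule bounded_lipschitz_onE) blast
  obtain M where M: "0 \<le> M" "\<And>x. norm (g x) \<le> norm x * M"
    using bounded_linear.nonneg_bounded[OF assms(1)] by auto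
  show ?thesis
  proof (rule bounded_lipschitz_onI)
    fix x y assume xy: "x \<in> X" "y \<in> X"
    show "norm (g (f x)) \<le> B * M"
      using M(2)[of "f x"] f(3)[OF xy(1)] M(1) by (meson mult_right_mono order_trans)
    have "norm (g (f x) - g (f y)) \<le> norm (f x - f y) * M"
      using M(2)[of "f x - f y"] assms(1) by (simp add: linear_diff bounded_linear.linear)
    also have "\<dots> \<le> (L * dist x y) * M" using f(4)[OF xy] M(1) by (rule mult_right_mono)
    finally show "norm (g (f x) - g (f y)) \<le> (L * M) * dist x y" by (simp add: mult_ac)
  qed (use f M in auto)
qed

lemmas bounded_lipschitz_on_projections [bl_intros] =
  bounded_lipschitz_on_linear[OF bounded_linear_of_real]
  bounded_lipschitz_on_linear[OF bounded_linear_Im]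
  bounded_lipschitz_on_linear[OF bounded_linear_cnj]

lemma bounded_lipschitz_on_bilinear:
  assumes "bounded_bilinear p" "bounded_lipschitz_on X f" "bounded_lipschitz_on X g"
  shows "bounded_lipschitz_on X (\<lambda>x. p (f x) (g x))"
proof -
  interpret bounded_bilinear p by fact
  obtain B L where f: "0 \<le> B" "0 \<le> L" "\<And>x. x \<in> X \<Longrightarrow> norm (f x) \<le> B"
    "\<And>x y. x \<in> X \<Longrightarrow> y \<in> X \<Longrightarrow> norm (f x - f y) \<le> L * dist x y"
    using assms(2) by (rule bounded_lipschitz_onE) blast
  obtain B' L' where g: "0 \<le> B'" "0 \<le> L'" "\<And>x. x \<in> X \<Longrightarrow> norm (g x) \<le> B'"
    "\<And>x y. x \<in> X \<Longrightarrow> y \<in> X \<Longrightarrow> norm (g x - g y) \<le> L' * dist x y"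
    using assms(3) by (rule bounded_lipschitz_onE) blast
  obtain M where M: "0 \<le> M" "\<And>x y. norm (p x y) \<le> norm x * norm y * M"
    using nonneg_bounded by auto
  show ?thesis
  proof (rule bounded_lipschitz_onI)
    fix x y assume xy: "x \<in> X" "y \<in> X"
    show "norm (p (f x) (g x)) \<le> B * B' * M"
      using M(1) f(1) g(1) by (intro order_trans[OF M(2)] mult_mono f(3) g(3) xy) auto
    have "p (f x) (g x) - p (f y) (g y) = p (f x - f y) (g x) + p (f y) (g x - g y)"
      by (simp add: diff_left diff_right)
    also have "norm \<dots> \<le> norm (f x - f y) * norm (g x) * M + norm (f y) * norm (g x - g y) * M"
      by (intro order_trans[OF norm_triangle_ineq] add_mono M)
    also have "\<dots> \<le> (L * dist x y) * B' * M + B * (L' * dist x y) * M"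
      using f(1,2) g(1,2) M(1) by (intro add_mono mult_mono f g xy) auto
    finally show "norm (p (f x) (g x) - p (f y) (g y)) \<le> (L * B' * M + B * L' * M) * dist x y"
      by (simp add: algebra_simps)
  qed (use f g M in auto)
qed

lemmas bounded_lipschitz_on_mult [bl_intros] =
  bounded_lipschitz_on_bilinear[OF bounded_bilinear_mult]

lemma bounded_lipschitz_on_const [bl_intros]: "bounded_lipschitz_on X (\<lambda>x. c)"
  by (rule bounded_lipschitz_onI[of _ _ "norm c" 0]) auto

lemma bounded_lipschitz_on_Pair [bl_intros]:
  assumes "bounded_lipschitz_on X f" "bounded_lipschitz_on X g"
  shows "bounded_lipschitz_on X (\<lambda>x. (f x, g x))"
proof -
  obtain B L where f: "0 \<le> B" "0 \<le> L" "\<And>x. x \<in> X \<Longrightarrow> norm (f x) \<le> B"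
    "\<And>x y. x \<in> X \<Longrightarrow> y \<in> X \<Longrightarrow> norm (f x - f y) \<le> L * dist x y"
    using assms(1) by (rule bounded_lipschitz_onE) blast
  obtain B' L' where g: "0 \<le> B'" "0 \<le> L'" "\<And>x. x \<in> X \<Longrightarrow> norm (g x) \<le> B'"
    "\<And>x y. x \<in> X \<Longrightarrow> y \<in> X \<Longrightarrow> norm (g x - g y) \<le> L' * dist x y"
    using assms(2) by (rule bounded_lipschitz_onE) blast
  show ?thesis
  proof (rule bounded_lipschitz_onI)
    fix x y assume xy: "x \<in> X" "y \<in> X"
    show "norm (f x, g x) \<le> B + B'"
      using norm_Pair_le[of "f x" "g x"] f(3)[OF xy(1)] g(3)[OF xy(1)] by linarith
    show "norm ((f x, g x) - (f y, g y)) \<le> (L + L') * dist x y"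
      using norm_Pair_le[of "f x - f y" "g x - g y"] f(4)[OF xy] g(4)[OF xy]
      by (simp add: algebra_simps)
  qed (use f g in auto)
qed

lemma bounded_lipschitz_on_add [bl_intros]:
  assumes "bounded_lipschitz_on X f" "bounded_lipschitz_on X g"
  shows "bounded_lipschitz_on X (\<lambda>x. f x + g x)"
proof -
  have "bounded_linear (\<lambda>p::'b \<times> 'b. fst p + snd p)"
    by (intro bounded_linear_add bounded_linear_fst bounded_linear_snd)
  from bounded_lipschitz_on_linear[OF this bounded_lipschitz_on_Pair[OF assms]] show ?thesis by simp
qed

lemma bounded_lipschitz_on_diff [bl_intros]:
  assumes "bounded_lipschitz_on X f" "bounded_lipschitz_on X g"
  shows "bounded_lipschitz_on X (\<lambda>x. f x - g x)"
proof -
  have "bounded_linear (\<lambda>p::'b \<times> 'b. fst p - snd p)"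
    by (intro bounded_linear_sub bounded_linear_fst bounded_linear_snd)
  from bounded_lipschitz_on_linear[OF this bounded_lipschitz_on_Pair[OF assms]] show ?thesis by simp
qed

lemma bounded_lipschitz_on_inverse:
  fixes f :: "'a::metric_space \<Rightarrow> real"
  assumes "bounded_lipschitz_on X f" "0 < m" "\<And>x. x \<in> X \<Longrightarrow> m \<le> f x"
  shows "bounded_lipschitz_on X (\<lambda>x. inverse (f x))"
proof -
  obtain B L where f: "0 \<le> B" "0 \<le> L" "\<And>x. x \<in> X \<Longrightarrow> norm (f x) \<le> B"
    "\<And>x y. x \<in> X \<Longrightarrow> y \<in> X \<Longrightarrow> norm (f x - f y) \<le> L * dist x y"
    using assms(1) by (rule bounded_lipschitz_onE) blast
  show ?thesis
  proof (rule bounded_lipschitz_onI)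
    fix x y assume xy: "x \<in> X" "y \<in> X"
    have inv: "0 < f z" "inverse (f z) \<le> inverse m" "0 \<le> inverse (f z)" if "z \<in> X" for z
      using assms(2) assms(3)[OF that] by (auto intro!: le_imp_inverse_le)
    show "norm (inverse (f x)) \<le> inverse m" using inv[OF xy(1)] by simp
    have "inverse (f x) - inverse (f y) = inverse (f x) * (f y - f x) * inverse (f y)"
      using inv(1)[OF xy(1)] inv(1)[OF xy(2)] by (simp add: field_simps)
    also have "norm \<dots> = inverse (f x) * norm (f y - f x) * inverse (f y)"
      using inv(3)[OF xy(1)] inv(3)[OF xy(2)] by (simp add: abs_mult)
    also have "\<dots> \<le> inverse m * (L * dist x y) * inverse m"
      using inv[OF xy(1)] inv[OF xy(2)] f(4)[OF xy] f(2) assms(2)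
      by (intro mult_mono) (auto simp: norm_minus_commute)
    finally show "norm (inverse (f x) - inverse (f y)) \<le> (inverse m * L * inverse m) * dist x y"
      by (simp add: mult_ac)
  qed (use f assms in auto)
qed

type_synonym state = "(complex \<times> real) \<times> (complex \<times> real)"

text \<open>The equation of an arc length parametrized curve of constant mean curvature; \<open>\<kappa>\<close> is minus the
  mean curvature with respect to the normal generated by the cross product of position and velocity.\<close>

definition profile_field :: "nat \<Rightarrow> real \<Rightarrow> state \<Rightarrow> state" where
  "profile_field n \<kappa> y = (let z = fst (fst y); b = snd (fst y); v = fst (snd y); c = snd (snd y);
     \<omega> = Im (cnj z * v); q = (real n - 2) * \<omega> * inverse b - \<kappa> in
     ((v, c), (of_real q * (\<i> * (of_real b * v - of_real c * z)) - z, q * \<omega> - b)))"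

text \<open>The division by b is the only singularity of the field; on a bounded set with b \<ge> m
  it is composed of bounded Lipschitz functions.\<close>

lemma profile_field_lipschitz:
  assumes "0 < m"
  obtains L where "L-lipschitz_on {y. m \<le> snd (fst y) \<and> norm y \<le> r} (profile_field n \<kappa>)"
proof -
  define X :: "state set" where "X = {y. m \<le> snd (fst y) \<and> norm y \<le> r}"
  have id: "bounded_lipschitz_on X (\<lambda>y. y)"
    by (rule bounded_lipschitz_onI[of _ _ r 1]) (auto simp: X_def dist_norm)
  have z: "bounded_lipschitz_on X (\<lambda>y. fst (fst y))" and b: "bounded_lipschitz_on X (\<lambda>y. snd (fst y))"
    and v: "bounded_lipschitz_on X (\<lambda>y. fst (snd y))" and c: "bounded_lipschitz_on X (\<lambda>y. snd (snd y))"
    by (intro bounded_lipschitz_on_linear[OF bounded_linear_fst] bounded_lipschitz_on_linear[OF bounded_linear_snd] id)+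
  have i: "bounded_lipschitz_on X (\<lambda>y. inverse (snd (fst y)))"
    by (rule bounded_lipschitz_on_inverse[OF b assms]) (auto simp: X_def)
  have "bounded_lipschitz_on X (profile_field n \<kappa>)"
    unfolding profile_field_def Let_def
    by (intro bl_intros z b v c i)
  then show ?thesis using that unfolding bounded_lipschitz_on_def X_def by blast
qed

section \<open>Geometry of rotation hypersurfaces\<close>

text \<open>The cross product on \<open>\<complex> \<oplus> \<real> = \<real>\<^sup>3\<close>.\<close>

definition vprod :: "complex \<times> real \<Rightarrow> complex \<times> real \<Rightarrow> complex \<times> real" where
  "vprod p v = (\<i> * (of_real (snd p) * fst v - of_real (snd v) * fst p), Im (cnj (fst p) * fst v))"

lemma bounded_bilinear_vprod: "bounded_bilinear vprod"
  unfolding bilinear_conv_bounded_bilinear[symmetric] bilinear_def vprod_def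
  by (intro conjI allI linearI) (auto simp: algebra_simps scaleR_conv_of_real)

lemma inner_vprod [simp]: "p \<bullet> vprod p v = 0" "v \<bullet> vprod p v = 0" "vprod p v \<bullet> p = 0" "vprod p v \<bullet> v = 0"
  by (auto simp: vprod_def inner_prod_def inner_complex_def algebra_simps)

lemma vprod_self [simp]: "vprod p p = 0"
  by (simp add: vprod_def zero_prod_def complex_eq_iff algebra_simps)

lemma inner_vprod_vprod: "vprod p v \<bullet> vprod p v = (p \<bullet> p) * (v \<bullet> v) - (p \<bullet> v)\<^sup>2"
  by (simp add: vprod_def inner_prod_def inner_complex_def algebra_simps power2_eq_square)

text \<open>A polynomial identity, checked in coordinates. It expands \<open>w\<close> in the frame
  p, v, p \<times> v, multiplied through by the Gram determinant so that nothing has to be assumed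
  about the frame; for orthonormal \<open>p\<close> and \<open>v\<close> it is the usual
  expansion.\<close>

lemma vprod_expand:
  "(vprod p v \<bullet> vprod p v) *\<^sub>R w = (w \<bullet> vprod p v) *\<^sub>R vprod p v
     + (w \<bullet> v) *\<^sub>R ((p \<bullet> p) *\<^sub>R v - (p \<bullet> v) *\<^sub>R p) + (w \<bullet> p) *\<^sub>R ((v \<bullet> v) *\<^sub>R p - (p \<bullet> v) *\<^sub>R v)"
proof -
  obtain p1 p2 p3 where p: "p = (Complex p1 p2, p3)" by (metis complex.exhaust surj_pair)
  obtain v1 v2 v3 where v: "v = (Complex v1 v2, v3)" by (metis complex.exhaust surj_pair)
  obtain w1 w2 w3 where w: "w = (Complex w1 w2, w3)" by (metis complex.exhaust surj_pair)
  show ?thesis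
    unfolding p v w
    by (auto simp: vprod_def inner_prod_def inner_complex_def complex_eq_iff) algebra+
qed

text \<open>Parseval's identity for vectors whose images under \<open>D\<close> are orthonormal. In
  the trace computation \<open>D\<close> is the differential of the hypersurface and
  \<open>u\<close> the direction of the generating curve.\<close>

lemma sum_inner_orthonormal_square:
  fixes D :: "'a::real_vector \<Rightarrow> 'b::real_inner"
  assumes "linear D" "finite E"
    and on: "\<And>v w. v \<in> E \<Longrightarrow> w \<in> E \<Longrightarrow> D v \<bullet> D w = (if v = w then 1 else 0)"
    and u: "u \<in> span E"
  shows "(\<Sum>v\<in>E. (D u \<bullet> D v)\<^sup>2) = D u \<bullet> D u"
proof -
  obtain a where a: "u = (\<Sum>v\<in>E. a v *\<^sub>R v)"
    using u span_finite[OF \<open>finite E\<close>] by auto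
  have Du: "D u = (\<Sum>v\<in>E. a v *\<^sub>R D v)"
    using \<open>linear D\<close> by (simp add: a linear_sum linear_scale)
  have av: "D u \<bullet> D v = a v" if "v \<in> E" for v
  proof -
    have "D u \<bullet> D v = (\<Sum>w\<in>E. if w = v then a w else 0)"
      using that by (auto simp: Du inner_sum_left on intro!: sum.cong)
    then show ?thesis using that \<open>finite E\<close> by simp
  qed
  have "D u \<bullet> D u = (\<Sum>v\<in>E. a v * (D u \<bullet> D v))"
    by (subst (2) Du) (simp add: inner_sum_right)
  then show ?thesis using av by (simp add: power2_eq_square)
qed

text \<open>The definition of mean curvature prescribes only the span of \<open>E\<close> and
  orthonormality. Finiteness has to be derived, since a sum over an infinite set would silently be
  0, and so does the number of vectors.\<close>

lemma card_orthonormal_preimage: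
  fixes D :: "'a::euclidean_space \<Rightarrow> 'b::euclidean_space"
  assumes "linear D"
    and on: "\<And>v w. v \<in> E \<Longrightarrow> w \<in> E \<Longrightarrow> D v \<bullet> D w = (if v = w then 1 else 0)"
    and inj: "inj_on D (span E)"
  shows "finite E \<and> card E = dim (span E)"
proof -
  have injE: "inj_on D E" using inj by (rule inj_on_subset) (rule span_superset)
  have "pairwise orthogonal (D ` E)"
    using on by (force simp: pairwise_def orthogonal_def)
  moreover have "0 \<notin> D ` E"
    using on by force
  ultimately have ind: "independent (D ` E)"
    by (rule pairwise_orthogonal_independent)
  have "card E = card (D ` E)" using injE by (simp add: card_image)
  also have "\<dots> = dim (span (D ` E))" using ind by (simp add: dim_eq_card_independent)
  also have "\<dots> = dim E" using dim_image_eq[OF \<open>linear D\<close> inj] by simp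
  finally show ?thesis
    using independent_imp_finite[OF ind] injE by (simp add: finite_image_iff)
qed

text \<open>A derivative within \<open>rot_dom I\<close>, which is not open, is not unique as a
  linear map. A tangent vector, however, is the velocity of a curve inside the set, and composition
  with that curve determines the derivative on it.\<close>

lemma rot_dom_derivative_unique:
  fixes F G :: "real \<times> (real ^ 'm::finite) \<Rightarrow> 'c::real_normed_vector"
  assumes I: "open I" "t \<in> I" and x: "x \<in> sphere 0 1"
    and F: "(F has_derivative F') (at (t, x) within rot_dom I)"
    and G: "(G has_derivative G') (at (t, x) within rot_dom I)"
    and eq: "\<And>q. q \<in> rot_dom I \<Longrightarrow> F q = G q"
    and v: "v \<in> rot_tangent (t, x)"
  shows "F' v = G' v"
proof -
  obtain \<tau> w where vw: "v = (\<tau>, w)" by (cases v)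
  have xw: "x \<bullet> w = 0" and xx: "x \<bullet> x = 1"
    using v x by (auto simp: vw rot_tangent_def dot_square_norm)
  define m where "m r = 1 + r\<^sup>2 * (w \<bullet> w)" for r :: real
  have m: "0 < m r" for r by (simp add: m_def add_pos_nonneg)
  \<comment> \<open>The straight line through (t, x) with velocity \<open>v\<close>, its second
    component pushed back to the sphere; \<open>m r\<close> is the squared norm of x + r w, and its
    derivative vanishes at 0, so the velocity at 0 is still \<open>v\<close>.\<close>
  define c where "c r = (t + r * \<tau>, (1 / sqrt (m r)) *\<^sub>R (x + r *\<^sub>R w))" for r
  have c0: "c 0 = (t, x)" by (simp add: c_def m_def)
  have dm: "((\<lambda>r. 1 / sqrt (m r)) has_real_derivative 0) (at 0)"
    unfolding m_def by (auto intro!: derivative_eq_intros)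
  have dc: "(c has_vector_derivative v) (at 0)"
  proof -
    have "((\<lambda>r. (1 / sqrt (m r)) *\<^sub>R (x + r *\<^sub>R w)) has_vector_derivative w) (at 0)"
      by (rule derivative_eq_intros dm refl)+ (simp add: m_def)
    moreover have "((\<lambda>r. t + r * \<tau>) has_vector_derivative \<tau>) (at 0)"
      by (auto intro!: derivative_eq_intros simp: has_real_derivative_iff_has_vector_derivative[symmetric])
    ultimately show ?thesis
      unfolding c_def vw by (rule has_vector_derivative_Pair[rotated])
  qed
  have "open ((\<lambda>r. t + r * \<tau>) -` I)"
    using I by (intro continuous_open_vimage) (auto intro!: continuous_intros)
  define S where "S = (\<lambda>r. t + r * \<tau>) -` I"
  have S: "open S" "0 \<in> S" using \<open>open ((\<lambda>r. t + r * \<tau>) -` I)\<close> I by (auto simp: S_def)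
  have cS: "c r \<in> rot_dom I" if "r \<in> S" for r
  proof -
    have "(norm (x + r *\<^sub>R w))\<^sup>2 = m r"
      unfolding power2_norm_eq_inner inner_add_left inner_add_right inner_scaleR_left inner_scaleR_right
        inner_commute[of w x] xw xx by (simp add: m_def power2_eq_square)
    then have "norm (x + r *\<^sub>R w) = sqrt (m r)" by (metis norm_ge_zero real_sqrt_unique)
    then show ?thesis using that m[of r] by (simp add: c_def S_def)
  qed
  have comp: "((\<lambda>r. K (c r)) has_vector_derivative K' v) (at 0)"
    if K: "(K has_derivative K') (at (t, x) within rot_dom I)" for K :: "real \<times> (real ^ 'm) \<Rightarrow> 'c" and K'
  proof -
    have "(c has_derivative (\<lambda>r. r *\<^sub>R v)) (at 0 within S)"
      using dc unfolding has_vector_derivative_def by (rule has_derivative_at_withinI)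
    moreover have "(K has_derivative K') (at (c 0) within c ` S)"
      unfolding c0 by (rule has_derivative_subset[OF K image_subsetI[OF cS]])
    ultimately have "((\<lambda>r. K (c r)) has_derivative (\<lambda>r. K' (r *\<^sub>R v))) (at 0 within S)"
      by (rule has_derivative_in_compose)
    then have "((\<lambda>r. K (c r)) has_derivative (\<lambda>r. K' (r *\<^sub>R v))) (at 0)"
      unfolding at_within_open[OF S(2,1)] .
    moreover have "K' (r *\<^sub>R v) = r *\<^sub>R K' v" for r
      by (rule linear_scale[OF has_derivative_linear[OF K]])
    ultimately show ?thesis
      unfolding has_vector_derivative_def by simp
  qed
  have "((\<lambda>r. F (c r)) has_vector_derivative G' v) (at 0)"
    by (rule has_vector_derivative_transform_within_open[OF comp[OF G] S]) (use cS eq in auto)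
  with comp[OF F] show ?thesis by (rule vector_derivative_unique_at)
qed

section \<open>Unit normals and mean curvature of the generated hypersurface\<close>

locale C2_curve =
  fixes I :: "real set" and \<gamma> \<gamma>1 \<gamma>2 :: "real \<Rightarrow> complex \<times> real"
  assumes open_I: "open I" and interval_I: "is_interval I" and nonempty_I: "I \<noteq> {}"
    and d1: "\<And>t. t \<in> I \<Longrightarrow> (\<gamma> has_vector_derivative \<gamma>1 t) (at t)"
    and d2: "\<And>t. t \<in> I \<Longrightarrow> (\<gamma>1 has_vector_derivative \<gamma>2 t) (at t)"
    and nz: "\<And>t. t \<in> I \<Longrightarrow> \<gamma>1 t \<noteq> 0"
    and cont2: "continuous_on I \<gamma>2"
    and sphere: "\<And>t. t \<in> I \<Longrightarrow> \<gamma> t \<bullet> \<gamma> t = 1"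
    and pos: "\<And>t. t \<in> I \<Longrightarrow> 0 < snd (\<gamma> t)"
begin

definition conormal where "conormal t = (1 / norm (\<gamma>1 t)) *\<^sub>R vprod (\<gamma> t) (\<gamma>1 t)"

definition rot_normal :: "real \<Rightarrow> real \<times> (real ^ 'm::finite) \<Rightarrow> complex \<times> (real ^ 'm)" where
  "rot_normal \<epsilon> q = (of_real \<epsilon> * fst (conormal (fst q)), (\<epsilon> * snd (conormal (fst q))) *\<^sub>R snd q)"

text \<open>Taken by choice and not by a formula: the trace sees it only through its inner product
  with the velocity, which follows from orthogonality.\<close>

definition conormal' where
  "conormal' t = (SOME d. (conormal has_vector_derivative d) (at t))"

lemma inner_deriv_zero: assumes t: "t \<in> I" shows "\<gamma> t \<bullet> \<gamma>1 t = 0"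
proof -
  have "((\<lambda>t. \<gamma> t \<bullet> \<gamma> t) has_vector_derivative (\<gamma> t \<bullet> \<gamma>1 t + \<gamma>1 t \<bullet> \<gamma> t)) (at t)"
    by (rule bounded_bilinear.has_vector_derivative[OF bounded_bilinear_inner d1[OF t] d1[OF t]])
  moreover have "((\<lambda>t. \<gamma> t \<bullet> \<gamma> t) has_vector_derivative 0) (at t)"
    by (rule has_vector_derivative_transform_within_open[OF has_vector_derivative_const open_I t])
      (simp add: sphere)
  ultimately have "\<gamma> t \<bullet> \<gamma>1 t + \<gamma>1 t \<bullet> \<gamma> t = 0" by (rule vector_derivative_unique_at)
  then show ?thesis by (simp add: inner_commute)
qed

lemma speed_pos: "t \<in> I \<Longrightarrow> 0 < norm (\<gamma>1 t)"
  using nz by simp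

lemma inner_vprod_velocity: assumes t: "t \<in> I"
  shows "vprod (\<gamma> t) (\<gamma>1 t) \<bullet> vprod (\<gamma> t) (\<gamma>1 t) = (norm (\<gamma>1 t))\<^sup>2"
  unfolding inner_vprod_vprod sphere[OF t] inner_deriv_zero[OF t] by (simp add: dot_square_norm)

lemma conormal_unit: assumes t: "t \<in> I" shows "conormal t \<bullet> conormal t = 1"
  using speed_pos[OF t] inner_vprod_velocity[OF t]
  by (simp add: conormal_def power2_eq_square)

lemma conormal_orth: "\<gamma> t \<bullet> conormal t = 0" "\<gamma>1 t \<bullet> conormal t = 0"
  by (auto simp: conormal_def)

text \<open>In the three-dimensional ambient space the vectors orthogonal to position and velocity
  form a line.\<close>

lemma conormal_unique:
  assumes t: "t \<in> I" and w: "w \<bullet> \<gamma> t = 0" "w \<bullet> \<gamma>1 t = 0"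
  shows "w = (w \<bullet> conormal t) *\<^sub>R conormal t"
proof -
  have "(norm (\<gamma>1 t))\<^sup>2 *\<^sub>R w = (w \<bullet> vprod (\<gamma> t) (\<gamma>1 t)) *\<^sub>R vprod (\<gamma> t) (\<gamma>1 t)"
    using vprod_expand[of "\<gamma> t" "\<gamma>1 t" w] w
    unfolding inner_vprod_velocity[OF t] by simp
  then have "w = (1 / (norm (\<gamma>1 t))\<^sup>2) *\<^sub>R (w \<bullet> vprod (\<gamma> t) (\<gamma>1 t)) *\<^sub>R vprod (\<gamma> t) (\<gamma>1 t)"
    using speed_pos[OF t] by (metis (no_types, lifting) inverse_eq_divide left_inverse less_numeral_extra(3) power_not_zero scaleR_one scaleR_scaleR)
  then show ?thesis by (simp add: conormal_def power2_eq_square)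
qed

lemma conormal_deriv: assumes t: "t \<in> I"
  shows "(conormal has_vector_derivative conormal' t) (at t)"
proof -
  have "\<exists>d. ((\<lambda>t. norm (\<gamma>1 t)) has_real_derivative d) (at t)"
  proof -
    have "(\<lambda>t. norm (\<gamma>1 t)) differentiable (at t)"
      by (intro differentiable_compose[of norm \<gamma>1 t, OF differentiable_norm_at[OF nz[OF t]]]
          differentiableI_vector[OF d2[OF t]])
    then show ?thesis
      by (metis real_differentiable_def)
  qed
  then obtain d where d: "((\<lambda>t. norm (\<gamma>1 t)) has_real_derivative d) (at t)" ..
  have v: "((\<lambda>t. vprod (\<gamma> t) (\<gamma>1 t)) has_vector_derivative
      (vprod (\<gamma> t) (\<gamma>2 t) + vprod (\<gamma>1 t) (\<gamma>1 t))) (at t)"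
    by (rule bounded_bilinear.has_vector_derivative[OF bounded_bilinear_vprod d1[OF t] d2[OF t]])
  have "((\<lambda>t. 1 / norm (\<gamma>1 t)) has_real_derivative - d / (norm (\<gamma>1 t))\<^sup>2) (at t)"
    using nz[OF t] by (auto intro!: derivative_eq_intros d simp: power2_eq_square)
  from has_vector_derivative_scaleR[OF this v]
  have "\<exists>d. (conormal has_vector_derivative d) (at t)"
    unfolding conormal_def by blast
  then show ?thesis unfolding conormal'_def by (rule someI_ex)
qed

lemma conormal'_inner: assumes t: "t \<in> I"
  shows "conormal' t \<bullet> \<gamma>1 t = - (conormal t \<bullet> \<gamma>2 t)"
proof -
  have "((\<lambda>t. conormal t \<bullet> \<gamma>1 t) has_vector_derivative (conormal t \<bullet> \<gamma>2 t + conormal' t \<bullet> \<gamma>1 t)) (at t)"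
    by (rule bounded_bilinear.has_vector_derivative[OF bounded_bilinear_inner conormal_deriv[OF t] d2[OF t]])
  moreover have "((\<lambda>t. conormal t \<bullet> \<gamma>1 t) has_vector_derivative 0) (at t)"
    by (rule has_vector_derivative_transform_within_open[OF has_vector_derivative_const open_I t])
      (simp add: conormal_def)
  ultimately have "conormal t \<bullet> \<gamma>2 t + conormal' t \<bullet> \<gamma>1 t = 0" by (rule vector_derivative_unique_at)
  then show ?thesis by simp
qed

lemma rot_hyp_deriv:
  assumes t: "t \<in> I"
  shows "(rot_hyp \<gamma> has_derivative (\<lambda>v. (fst v *\<^sub>R fst (\<gamma>1 t), (fst v * snd (\<gamma>1 t)) *\<^sub>R x + snd (\<gamma> t) *\<^sub>R snd v)))
     (at (t, x :: real ^ 'm::finite))"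
proof -
  have "(\<gamma> has_derivative (\<lambda>r. r *\<^sub>R \<gamma>1 t)) (at t)" using d1[OF t] by (simp add: has_vector_derivative_def)
  then have g: "((\<lambda>q::real \<times> (real ^ 'm). \<gamma> (fst q)) has_derivative (\<lambda>v. fst v *\<^sub>R \<gamma>1 t)) (at (t, x))"
    by (auto intro!: has_derivative_compose[of fst fst _ _ \<gamma>] derivative_eq_intros)
  have "((\<lambda>q::real \<times> (real ^ 'm). (fst (\<gamma> (fst q)), snd (\<gamma> (fst q)) *\<^sub>R snd q)) has_derivative
     (\<lambda>v. (fst v *\<^sub>R fst (\<gamma>1 t), (fst v * snd (\<gamma>1 t)) *\<^sub>R x + snd (\<gamma> t) *\<^sub>R snd v))) (at (t, x))"
    by (rule derivative_eq_intros g refl)+ (auto simp: algebra_simps)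
  then show ?thesis by (simp add: rot_hyp_def case_prod_beta')
qed

lemma rot_diff_eq:
  assumes t: "t \<in> I"
  shows "rot_diff \<gamma> (t, x :: real ^ 'm::finite) =
    (\<lambda>v. (fst v *\<^sub>R fst (\<gamma>1 t), (fst v * snd (\<gamma>1 t)) *\<^sub>R x + snd (\<gamma> t) *\<^sub>R snd v))"
  by (rule frechet_derivative_at[OF rot_hyp_deriv[OF t], symmetric])

lemma rot_normal_deriv:
  assumes t: "t \<in> I"
  shows "(rot_normal \<epsilon> has_derivative (\<lambda>v. (\<epsilon> * fst v) *\<^sub>R (fst (conormal' t), snd (conormal' t) *\<^sub>R x)
      + (0, (\<epsilon> * snd (conormal t)) *\<^sub>R snd v))) (at (t, x :: real ^ 'm::finite))"
proof -
  have "(conormal has_derivative (\<lambda>r. r *\<^sub>R conormal' t)) (at t)"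
    using conormal_deriv[OF t] by (simp add: has_vector_derivative_def)
  then have g: "((\<lambda>q::real \<times> (real ^ 'm). conormal (fst q)) has_derivative (\<lambda>v. fst v *\<^sub>R conormal' t)) (at (t, x))"
    by (auto intro!: has_derivative_compose[of fst fst _ _ conormal] derivative_eq_intros)
  show ?thesis
    unfolding rot_normal_def
    by (rule derivative_eq_intros g refl)+ (auto simp: algebra_simps scaleR_conv_of_real)
qed

lemma rot_diff_inner:
  assumes t: "t \<in> I" and x: "x \<bullet> x = 1" "x \<bullet> snd v = 0" "x \<bullet> snd w = 0"
  shows "rot_diff \<gamma> (t, x :: real ^ 'm::finite) v \<bullet> rot_diff \<gamma> (t, x) w =
    fst v * fst w * (norm (\<gamma>1 t))\<^sup>2 + (snd (\<gamma> t))\<^sup>2 * (snd v \<bullet> snd w)"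
proof -
  have x': "snd v \<bullet> x = 0" "snd w \<bullet> x = 0" using x by (simp_all add: inner_commute)
  have s: "(norm (\<gamma>1 t))\<^sup>2 = fst (\<gamma>1 t) \<bullet> fst (\<gamma>1 t) + snd (\<gamma>1 t) * snd (\<gamma>1 t)"
    by (simp add: power2_norm_eq_inner inner_prod_def)
  show ?thesis
    unfolding rot_diff_eq[OF t] s
    by (simp add: inner_add_left inner_add_right x x' algebra_simps power2_eq_square)
qed

text \<open>The sum of the principal curvatures with respect to \<open>rot_normal 1\<close>: the
  geodesic curvature of the generating curve in the 2-sphere, and the curvature - snd (conormal) / b
  of the spheres of rotation with multiplicity m - 1.\<close>

definition rot_mean :: "nat \<Rightarrow> real \<Rightarrow> real" where
  "rot_mean m t = (conormal t \<bullet> \<gamma>2 t) / (norm (\<gamma>1 t))\<^sup>2 - (real m - 1) * snd (conormal t) / snd (\<gamma> t)"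

text \<open>The basis \<open>E\<close> is arbitrary, so no basis vector can be assumed to point
  along the generating curve. Each summand depends on \<open>v\<close> only through the share (fst
  v)^2 s^2 of the unit vector \<open>v\<close> in the profile direction, and by Parseval these
  shares add up to 1.\<close>

lemma trace_rot_normal:
  fixes x :: "real ^ 'm::finite"
  assumes t: "t \<in> I" and x: "x \<in> sphere 0 1"
    and N': "\<And>v. v \<in> rot_tangent (t, x) \<Longrightarrow> N' v =
      (\<epsilon> * fst v) *\<^sub>R (fst (conormal' t), snd (conormal' t) *\<^sub>R x) + (0, (\<epsilon> * snd (conormal t)) *\<^sub>R snd v)"
    and span: "span E = rot_tangent (t, x)"
    and on: "\<And>v w. v \<in> E \<Longrightarrow> w \<in> E \<Longrightarrow> rot_diff \<gamma> (t, x) v \<bullet> rot_diff \<gamma> (t, x) w = (if v = w then 1 else 0)"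
  shows "(\<Sum>v\<in>E. - (N' v \<bullet> rot_diff \<gamma> (t, x) v)) = \<epsilon> * rot_mean CARD('m) t"
proof -
  have xx: "x \<bullet> x = 1" using x by (simp add: dot_square_norm)
  have tan: "x \<bullet> snd v = 0" if "v \<in> rot_tangent (t, x)" for v
    using that by (simp add: rot_tangent_def)
  have E: "v \<in> rot_tangent (t, x)" if "v \<in> E" for v using that span span_superset by blast
  have lin: "linear (rot_diff \<gamma> (t, x))"
    using has_derivative_linear[OF rot_hyp_deriv[OF t, of x]] by (simp add: rot_diff_eq[OF t])
  define s where "s = norm (\<gamma>1 t)"
  define b where "b = snd (\<gamma> t)"
  have s: "0 < s" and b: "0 < b" using speed_pos pos t by (auto simp: s_def b_def)
  have "inj_on (rot_diff \<gamma> (t, x)) (span E)"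
  proof (rule inj_onI)
    fix v' v'' assume v': "v' \<in> span E" "v'' \<in> span E" "rot_diff \<gamma> (t, x) v' = rot_diff \<gamma> (t, x) v''"
    have "v' - v'' = 0"
    proof -
      define v where "v = v' - v''"
      have v: "v \<in> span E" "rot_diff \<gamma> (t, x) v = 0"
        using v' linear_diff[OF lin, of v' v''] by (auto simp: v_def intro: span_diff)
      then have "fst v * fst v * s\<^sup>2 + b\<^sup>2 * (snd v \<bullet> snd v) = 0"
        using rot_diff_inner[OF t xx, of v v] tan[of v] span by (simp add: s_def b_def)
      moreover have "0 \<le> fst v * fst v * s\<^sup>2" "0 \<le> b\<^sup>2 * (snd v \<bullet> snd v)" by auto
      ultimately have "fst v * fst v * s\<^sup>2 = 0" "b\<^sup>2 * (snd v \<bullet> snd v) = 0" by linarith+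
      then have "v = 0" using s b by (simp add: prod_eq_iff)
      then show ?thesis by (simp add: v_def)
    qed
    then show "v' = v''" by simp
  qed
  from card_orthonormal_preimage[OF lin on this]
  have fin: "finite E" and card: "card E = dim (rot_tangent (t, x))" by (auto simp: span)
  have "dim (rot_tangent (t, x)) = CARD('m)"
  proof -
    have "(0, x) \<noteq> (0 :: real \<times> (real ^ 'm))" using xx by (auto simp: zero_prod_def)
    moreover have "rot_tangent (t, x) = {v :: real \<times> (real ^ 'm). (0, x) \<bullet> v = 0}"
      by (auto simp: rot_tangent_def inner_prod_def)
    ultimately show ?thesis using dim_hyperplane[of "(0, x) :: real \<times> (real ^ 'm)"] by simp
  qed
  with card have card: "card E = CARD('m)" by simp
  have u: "(1, 0) \<in> span E" unfolding span by (simp add: rot_tangent_def)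
  have "s\<^sup>2 = (\<Sum>v\<in>E. (fst v * s\<^sup>2)\<^sup>2)"
  proof -
    have "(\<Sum>v\<in>E. (rot_diff \<gamma> (t, x) (1, 0) \<bullet> rot_diff \<gamma> (t, x) v)\<^sup>2)
        = rot_diff \<gamma> (t, x) (1, 0) \<bullet> rot_diff \<gamma> (t, x) (1, 0)"
      by (rule sum_inner_orthonormal_square[OF lin fin on u])
    then show ?thesis
      using tan[OF E] by (simp add: rot_diff_inner[OF t xx] s_def cong: sum.cong)
  qed
  also have "\<dots> = s\<^sup>2 * (\<Sum>v\<in>E. (fst v)\<^sup>2 * s\<^sup>2)"
    by (simp add: sum_distrib_left power2_eq_square mult_ac)
  finally have one: "(\<Sum>v\<in>E. (fst v)\<^sup>2 * s\<^sup>2) = 1" using s by simp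
  have summand: "- (N' v \<bullet> rot_diff \<gamma> (t, x) v) =
      \<epsilon> * (- (conormal' t \<bullet> \<gamma>1 t) / s\<^sup>2 * ((fst v)\<^sup>2 * s\<^sup>2)
        - snd (conormal t) / b * (1 - (fst v)\<^sup>2 * s\<^sup>2))" if v: "v \<in> E" for v
  proof -
    have xv: "x \<bullet> snd v = 0" using tan[OF E[OF v]] .
    then have vx: "snd v \<bullet> x = 0" by (simp add: inner_commute)
    have ip: "conormal' t \<bullet> \<gamma>1 t = fst (conormal' t) \<bullet> fst (\<gamma>1 t) + snd (conormal' t) * snd (\<gamma>1 t)"
      by (simp add: inner_prod_def)
    have "1 = (fst v)\<^sup>2 * s\<^sup>2 + b\<^sup>2 * (snd v \<bullet> snd v)"
      using on[OF v v] rot_diff_inner[OF t xx xv xv] by (simp add: s_def b_def power2_eq_square)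
    then have bv: "b * (snd v \<bullet> snd v) = (1 - (fst v)\<^sup>2 * s\<^sup>2) / b"
      using b by (simp add: field_simps power2_eq_square)
    have "N' v \<bullet> rot_diff \<gamma> (t, x) v = \<epsilon> * ((conormal' t \<bullet> \<gamma>1 t) * (fst v)\<^sup>2 + snd (conormal t) * (b * (snd v \<bullet> snd v)))"
      unfolding N'[OF E[OF v]] rot_diff_eq[OF t] ip
      by (simp add: inner_add_left inner_add_right xv vx xx b_def algebra_simps power2_eq_square)
    then show ?thesis using s b unfolding bv by (simp add: field_simps)
  qed
  have "(\<Sum>v\<in>E. - (N' v \<bullet> rot_diff \<gamma> (t, x) v)) =
     \<epsilon> * (- (conormal' t \<bullet> \<gamma>1 t) / s\<^sup>2 * (\<Sum>v\<in>E. (fst v)\<^sup>2 * s\<^sup>2)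
        - snd (conormal t) / b * (real (card E) - (\<Sum>v\<in>E. (fst v)\<^sup>2 * s\<^sup>2)))"
  proof -
    define A where "A = - (conormal' t \<bullet> \<gamma>1 t) / s\<^sup>2"
    define B where "B = snd (conormal t) / b"
    define X where "X v = (fst v)\<^sup>2 * s\<^sup>2" for v :: "real \<times> (real ^ 'm)"
    have "(\<Sum>v\<in>E. - (N' v \<bullet> rot_diff \<gamma> (t, x) v)) = (\<Sum>v\<in>E. \<epsilon> * (A * X v - B * (1 - X v)))"
      unfolding A_def B_def X_def by (rule sum.cong[OF refl]) (rule summand)
    also have "\<dots> = \<epsilon> * (A * sum X E - B * (real (card E) - sum X E))"
      by (simp add: sum_distrib_left sum_subtractf right_diff_distrib)
    finally show ?thesis unfolding A_def B_def X_def .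
  qed
  then show ?thesis
    unfolding one card by (simp add: conormal'_inner[OF t] rot_mean_def s_def b_def)
qed

lemma rot_tangent_orthonormal_basis:
  fixes x :: "real ^ 'm::finite"
  assumes t: "t \<in> I" and x: "x \<in> sphere 0 1"
  shows "\<exists>E. span E = rot_tangent (t, x) \<and>
    (\<forall>v\<in>E. \<forall>w\<in>E. rot_diff \<gamma> (t, x) v \<bullet> rot_diff \<gamma> (t, x) w = (if v = w then 1 else 0))"
proof -
  have xx: "x \<bullet> x = 1" using x by (simp add: dot_square_norm)
  define s where "s = norm (\<gamma>1 t)"
  define b where "b = snd (\<gamma> t)"
  have s: "0 < s" and b: "0 < b" using speed_pos pos t by (auto simp: s_def b_def)
  obtain B where B: "B \<subseteq> {w. x \<bullet> w = 0}" "pairwise orthogonal B" "\<forall>w\<in>B. norm w = 1"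
    "span B = {w. x \<bullet> w = 0}"
    by (rule orthonormal_basis_subspace[OF subspace_hyperplane[of x]]) blast
  define f where "f w = (0::real, (1 / b) *\<^sub>R w)" for w :: "real ^ 'm"
  \<comment> \<open>The factors 1 / s and 1 / b undo the stretching by the induced metric along the
    curve and along the spheres of rotation.\<close>
  define E where "E = insert (1 / s, 0) (f ` B)"
  have lf: "linear f" unfolding f_def by (auto intro!: linearI simp: algebra_simps)
  have "span E = rot_tangent (t, x)"
  proof
    have sub: "subspace (rot_tangent (t, x))"
    proof -
      have "rot_tangent (t, x) = {v :: real \<times> (real ^ 'm). (0, x) \<bullet> v = 0}"
        by (auto simp: rot_tangent_def inner_prod_def)
      then show ?thesis using subspace_hyperplane by metis
    qed
    show "span E \<subseteq> rot_tangent (t, x)"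
      by (rule span_minimal[OF _ sub]) (use B in \<open>auto simp: E_def f_def rot_tangent_def\<close>)
    show "rot_tangent (t, x) \<subseteq> span E"
    proof
      fix v :: "real \<times> (real ^ 'm)" assume "v \<in> rot_tangent (t, x)"
      then have "b *\<^sub>R snd v \<in> span B" by (simp add: B rot_tangent_def)
      then have "f (b *\<^sub>R snd v) \<in> span (f ` B)" using linear_span_image[OF lf] by blast
      then have "f (b *\<^sub>R snd v) \<in> span E" using span_mono[of "f ` B" E] by (auto simp: E_def)
      moreover have "(1 / s, 0) \<in> span E" by (simp add: E_def span_base)
      ultimately have "(fst v * s) *\<^sub>R (1 / s, 0) + f (b *\<^sub>R snd v) \<in> span E"
        by (intro span_add span_scale)
      then show "v \<in> span E" using s b by (simp add: f_def)
    qed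
  qed
  moreover have "rot_diff \<gamma> (t, x) v \<bullet> rot_diff \<gamma> (t, x) w = (if v = w then 1 else 0)"
    if vw: "v \<in> E" "w \<in> E" for v w
  proof -
    have T: "x \<bullet> snd v = 0" "x \<bullet> snd w = 0" using vw B by (auto simp: E_def f_def)
    have BB: "w' \<bullet> w'' = (if w' = w'' then 1 else 0)" if "w' \<in> B" "w'' \<in> B" for w' w''
      using B(2,3) that by (auto simp: pairwise_def orthogonal_def dot_square_norm)
    show ?thesis
      unfolding rot_diff_inner[OF t xx T] s_def[symmetric] b_def[symmetric]
      using vw s b by (auto simp: E_def f_def BB power2_eq_square split: if_splits)
  qed
  ultimately show ?thesis by blast
qed

text \<open>\<open>N\<close> is known on \<open>rot_dom I\<close> only. From left to right,
  uniqueness on tangent vectors replaces its unknown derivative by that of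
  \<open>rot_normal\<close>; from right to left, the derivative of \<open>rot_normal\<close> itself
  serves as witness.\<close>

lemma has_mean_curvature_rot_normal:
  fixes x :: "real ^ 'm::finite"
  assumes t: "t \<in> I" and x: "x \<in> sphere 0 1"
    and N: "\<And>q. q \<in> rot_dom I \<Longrightarrow> N q = rot_normal \<epsilon> q"
  shows "has_mean_curvature I \<gamma> N H (t, x) \<longleftrightarrow> H = \<epsilon> * rot_mean CARD('m) t"
proof
  define R' where "R' v = (\<epsilon> * fst v) *\<^sub>R (fst (conormal' t), snd (conormal' t) *\<^sub>R x)
      + (0, (\<epsilon> * snd (conormal t)) *\<^sub>R snd v)" for v :: "real \<times> (real ^ 'm)"
  have R: "(rot_normal \<epsilon> has_derivative R') (at (t, x) within rot_dom I)"
    unfolding R'_def[abs_def] by (rule has_derivative_at_withinI[OF rot_normal_deriv[OF t]])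
  {
    assume "has_mean_curvature I \<gamma> N H (t, x)"
    then obtain N' E where N': "(N has_derivative N') (at (t, x) within rot_dom I)"
      and E: "span E = rot_tangent (t, x)"
        "\<forall>v\<in>E. \<forall>w\<in>E. rot_diff \<gamma> (t, x) v \<bullet> rot_diff \<gamma> (t, x) w = (if v = w then 1 else 0)"
      and H: "H = (\<Sum>v\<in>E. - (N' v \<bullet> rot_diff \<gamma> (t, x) v))"
      unfolding has_mean_curvature_def by blast
    have "N' v = R' v" if "v \<in> rot_tangent (t, x)" for v
      by (rule rot_dom_derivative_unique[OF open_I t x N' R N that])
    then show "H = \<epsilon> * rot_mean CARD('m) t"
      unfolding H R'_def by (intro trace_rot_normal[OF t x _ E(1)]) (use E(2) in auto)
  }
  assume H: "H = \<epsilon> * rot_mean CARD('m) t"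
  obtain E where E: "span E = rot_tangent (t, x)"
    "\<forall>v\<in>E. \<forall>w\<in>E. rot_diff \<gamma> (t, x) v \<bullet> rot_diff \<gamma> (t, x) w = (if v = w then 1 else 0)"
    using rot_tangent_orthonormal_basis[OF t x] by blast
  have "(N has_derivative R') (at (t, x) within rot_dom I)"
    by (rule has_derivative_transform[OF _ N R]) (use t x in auto)
  moreover have "(\<Sum>v\<in>E. - (R' v \<bullet> rot_diff \<gamma> (t, x) v)) = \<epsilon> * rot_mean CARD('m) t"
    unfolding R'_def by (intro trace_rot_normal[OF t x _ E(1)]) (use E(2) in auto)
  ultimately show "has_mean_curvature I \<gamma> N H (t, x)"
    unfolding has_mean_curvature_def using E H by (intro exI[of _ R'] exI[of _ E] conjI) auto
qed

lemma continuous_on_conormal: "continuous_on I conormal"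
  by (intro continuous_at_imp_continuous_on ballI has_vector_derivative_continuous[OF conormal_deriv])

lemma continuous_on_rot_normal: "continuous_on (rot_dom I) (rot_normal \<epsilon>)"
  unfolding rot_normal_def
  by (intro continuous_intros continuous_on_compose2[OF continuous_on_conormal]) auto

lemma unit_normal_rot_normal:
  assumes "\<epsilon> = 1 \<or> \<epsilon> = -1"
  shows "unit_normal_field I \<gamma> (rot_normal \<epsilon> :: real \<times> (real ^ 'm::finite) \<Rightarrow> _)"
  unfolding unit_normal_field_def
proof (intro conjI ballI)
  fix q :: "real \<times> (real ^ 'm)" assume q: "q \<in> rot_dom I"
  obtain t x where tx: "q = (t, x)" by (cases q)
  have t: "t \<in> I" and x: "x \<bullet> x = 1" using q tx by (auto simp: dot_square_norm)
  have ee: "\<epsilon> * \<epsilon> = 1" using assms by auto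
  have cc: "fst (conormal t) \<bullet> fst (conormal t) + snd (conormal t) * snd (conormal t) = 1"
    using conormal_unit[OF t] by (simp add: inner_prod_def)
  have "rot_normal \<epsilon> q \<bullet> rot_normal \<epsilon> q = (\<epsilon> * \<epsilon>) * (fst (conormal t) \<bullet> fst (conormal t) + snd (conormal t) * snd (conormal t))"
    by (simp add: rot_normal_def tx x scaleR_conv_of_real[symmetric] algebra_simps)
  then have "rot_normal \<epsilon> q \<bullet> rot_normal \<epsilon> q = 1" using cc ee by simp
  then show "norm (rot_normal \<epsilon> q) = 1" by (simp add: norm_eq_sqrt_inner)
  have "rot_normal \<epsilon> q \<bullet> rot_hyp \<gamma> q = \<epsilon> * (\<gamma> t \<bullet> conormal t)"
    by (simp add: rot_normal_def rot_hyp_def tx x scaleR_conv_of_real[symmetric] algebra_simps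
        inner_prod_def[of "\<gamma> t"] inner_commute)
  then show "rot_normal \<epsilon> q \<bullet> rot_hyp \<gamma> q = 0" by (simp add: conormal_orth)
  fix v assume "v \<in> rot_tangent q"
  then have v: "x \<bullet> snd v = 0" by (simp add: rot_tangent_def tx)
  have "rot_normal \<epsilon> q \<bullet> rot_diff \<gamma> q v = \<epsilon> * fst v * (\<gamma>1 t \<bullet> conormal t)"
    unfolding tx rot_diff_eq[OF t]
    by (simp add: rot_normal_def v x inner_add_right scaleR_conv_of_real[symmetric] algebra_simps
        inner_prod_def[of "\<gamma>1 t"] inner_commute)
  then show "rot_normal \<epsilon> q \<bullet> rot_diff \<gamma> q v = 0" by (simp add: conormal_orth)
qed (rule continuous_on_rot_normal)

text \<open>The hypersurface has codimension one in the sphere, so pointwise there are two unit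
  normals. The sign relative to \<open>rot_normal 1\<close> is continuous with finite range on a
  connected domain, hence constant.\<close>

lemma unit_normal_field_cases:
  fixes N :: "real \<times> (real ^ 'm::finite) \<Rightarrow> complex \<times> (real ^ 'm)"
  assumes N: "unit_normal_field I \<gamma> N" and m: "2 \<le> CARD('m)"
  obtains \<epsilon> where "\<epsilon> = 1 \<or> \<epsilon> = -1" "\<And>q. q \<in> rot_dom I \<Longrightarrow> N q = rot_normal \<epsilon> q"
proof -
  define e where "e q = N q \<bullet> rot_normal 1 q" for q
  have key: "N q = rot_normal (e q) q \<and> (e q = 1 \<or> e q = -1)" if q: "q \<in> rot_dom I" for q
  proof -
    obtain t x where tx: "q = (t, x)" by (cases q)
    have t: "t \<in> I" and x: "x \<bullet> x = 1" using q tx by (auto simp: dot_square_norm)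
    have NN: "N q \<bullet> N q = 1" and N0: "N q \<bullet> rot_hyp \<gamma> q = 0"
      and NT: "\<And>v. v \<in> rot_tangent q \<Longrightarrow> N q \<bullet> rot_diff \<gamma> q v = 0"
      using N q by (auto simp: unit_normal_field_def dot_square_norm)
    define n2 where "n2 = snd (N q)"
    \<comment> \<open>The part of \<open>n2\<close> orthogonal to \<open>x\<close>. The vector (0,
      w) is tangent, so normality forces w = 0: the second component of a normal is radial, and the
      question reduces to the vector \<open>p\<close> in \<complex> \<oplus> \<real>.\<close>
    define w where "w = n2 - (n2 \<bullet> x) *\<^sub>R x"
    have xw: "x \<bullet> w = 0" by (simp add: w_def inner_diff_right x inner_commute)
    then have "N q \<bullet> rot_diff \<gamma> q (0, w) = 0" by (intro NT) (simp add: rot_tangent_def tx)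
    then have "n2 \<bullet> w = 0"
      unfolding tx rot_diff_eq[OF t] using pos[OF t] by (simp add: inner_prod_def n2_def tx)
    then have "w \<bullet> w = 0" using xw by (simp add: w_def inner_diff_left inner_commute)
    then have n2: "n2 = (n2 \<bullet> x) *\<^sub>R x" by (simp add: w_def)
    define p where "p = (fst (N q), n2 \<bullet> x)"
    have "p \<bullet> \<gamma> t = 0"
      using N0 by (simp add: p_def tx rot_hyp_def inner_prod_def n2_def mult.commute)
    moreover have "p \<bullet> \<gamma>1 t = 0"
      using NT[of "(1, 0)"] unfolding tx rot_diff_eq[OF t]
      by (simp add: p_def tx inner_prod_def n2_def mult.commute rot_tangent_def)
    ultimately have p: "p = (p \<bullet> conormal t) *\<^sub>R conormal t" by (rule conormal_unique[OF t])
    have eq: "e q = p \<bullet> conormal t"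
      by (simp add: e_def p_def rot_normal_def tx inner_prod_def n2_def)
    have "p \<bullet> p = 1"
    proof -
      have "n2 \<bullet> n2 = (n2 \<bullet> x) * (n2 \<bullet> x)" by (subst n2) (simp add: x)
      then show ?thesis using NN by (simp add: p_def inner_prod_def n2_def)
    qed
    moreover have "p \<bullet> p = (e q)\<^sup>2"
      unfolding eq by (subst p, subst (2) p) (simp add: conormal_unit[OF t] power2_eq_square)
    ultimately have "(e q)\<^sup>2 = 1" by simp
    then have "e q = 1 \<or> e q = -1" by (simp add: power2_eq_1_iff)
    moreover have "N q = rot_normal (e q) q"
    proof -
      have "fst (N q) = e q *\<^sub>R fst (conormal t)"
        using arg_cong[OF p, of fst] eq by (simp add: p_def)
      moreover have "n2 \<bullet> x = e q * snd (conormal t)"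
        using arg_cong[OF p, of snd] eq by (simp add: p_def)
      ultimately show ?thesis
        using n2 by (simp add: rot_normal_def tx prod_eq_iff n2_def scaleR_conv_of_real)
    qed
    ultimately show ?thesis by blast
  qed
  have "continuous_on (rot_dom I) e"
    using N unfolding e_def unit_normal_field_def
    by (intro continuous_intros continuous_on_rot_normal) auto
  \<comment> \<open>The unit sphere of \<open>real ^ 'm\<close> is connected from dimension two on,
    hence the hypothesis \<open>m\<close>.\<close>
  moreover have "connected (rot_dom I :: (real \<times> (real ^ 'm)) set)"
    using m interval_I by (intro connected_Times connected_sphere) (auto simp: is_interval_connected_1)
  moreover have "finite (e ` rot_dom I)"
    by (rule finite_subset[of _ "{1, -1}"]) (use key in auto)
  ultimately have "e constant_on rot_dom I" by (intro continuous_finite_range_constant)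
  then obtain \<epsilon> where \<epsilon>: "\<And>q. q \<in> rot_dom I \<Longrightarrow> e q = \<epsilon>" by (auto simp: constant_on_def)
  obtain t where "t \<in> I" using nonempty_I by auto
  moreover obtain x :: "real ^ 'm" where "x \<in> sphere 0 1"
    using vector_choose_size[of 1] by auto
  ultimately have "(t, x) \<in> rot_dom I" by simp
  with key \<epsilon> that show ?thesis by metis
qed

end

section \<open>Profile curves parametrized by arc length\<close>

text \<open>Endpoints in the extended reals treat bounded and unbounded intervals at once.\<close>

lemma open_interval_antiderivative:
  fixes f :: "real \<Rightarrow> real"
  assumes I: "open I" "is_interval I" and f: "continuous_on I f"
  obtains F where "\<And>t. t \<in> I \<Longrightarrow> (F has_real_derivative f t) (at t)"
proof (cases "I = {}")
  case False
  define a where "a = Inf (ereal ` I)"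
  define b where "b = Sup (ereal ` I)"
  have mem: "t \<in> I \<longleftrightarrow> a < ereal t \<and> ereal t < b" for t
  proof
    assume t: "t \<in> I"
    then obtain e where e: "0 < e" "ball t e \<subseteq> I" using I(1) openE by blast
    then have "t - e / 2 \<in> I" "t + e / 2 \<in> I" by (auto simp: dist_real_def subset_iff)
    then have "a \<le> ereal (t - e / 2)" "ereal (t + e / 2) \<le> b"
      by (auto simp: a_def b_def intro: Inf_lower Sup_upper)
    moreover have "ereal (t - e / 2) < ereal t" "ereal t < ereal (t + e / 2)" using e by auto
    ultimately show "a < ereal t \<and> ereal t < b" by (meson le_less_trans less_le_trans)
  next
    assume "a < ereal t \<and> ereal t < b"
    then obtain t1 t2 where "t1 \<in> I" "t2 \<in> I" "t1 < t" "t < t2"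
      by (auto simp: a_def b_def Inf_less_iff less_Sup_iff)
    then show "t \<in> I" using mem_is_interval_1_I[OF I(2), of t1 t2 t] by auto
  qed
  obtain t where "t \<in> I" using False by auto
  then have "a < b" using mem by (meson less_trans)
  moreover have "isCont f t" if "a < ereal t" "ereal t < b" for t
    using that mem I f by (simp add: continuous_on_eq_continuous_at)
  ultimately obtain F where "\<forall>t::real. a < t \<longrightarrow> t < b \<longrightarrow> (F has_vector_derivative f t) (at t)"
    using einterval_antiderivative by blast
  then show ?thesis
    using that mem by (auto simp: has_real_derivative_iff_has_vector_derivative)
qed (use that in auto)

text \<open>The factor \<open>s\<close> only carries the sign of the derivative, so that decreasing
  arc length functions, which reverse the orientation, are covered as well.\<close>

lemma interval_homeomorphism_of_deriv:
  fixes F :: "real \<Rightarrow> real"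
  assumes I: "open I" "is_interval I"
    and F: "\<And>t. t \<in> I \<Longrightarrow> (F has_real_derivative f t) (at t)"
    and s: "\<And>t. t \<in> I \<Longrightarrow> 0 < s * f t"
  obtains K G where "homeomorphism I K F G" "open K" "is_interval K"
    "\<And>r. r \<in> K \<Longrightarrow> (G has_real_derivative inverse (f (G r))) (at r)"
proof -
  have cont: "continuous_on I F"
    by (intro continuous_at_imp_continuous_on ballI DERIV_isCont[OF F])
  have "F x \<noteq> F y" if xy: "x \<in> I" "y \<in> I" "x < y" for x y
  proof -
    have "s * F x < s * F y"
    proof (rule DERIV_pos_imp_increasing[OF xy(3)])
      fix t assume "x \<le> t" "t \<le> y"
      then have t: "t \<in> I" using mem_is_interval_1_I[OF I(2)] xy by blast
      then show "\<exists>d. ((\<lambda>t. s * F t) has_real_derivative d) (at t) \<and> 0 < d"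
        using s[OF t] by (intro exI[of _ "s * f t"]) (auto intro!: derivative_eq_intros F)
    qed
    then show ?thesis by auto
  qed
  then have inj: "inj_on F I" by (metis inj_onI linorder_neqE_linordered_idom)
  obtain G where G: "homeomorphism I (F ` I) F G"
    using invariance_of_domain_homeomorphism[OF I(1) cont _ inj] by auto
  have op: "open (F ` I)"
    using invariance_of_domain_gen[OF I(1) cont inj] by simp
  have int: "is_interval (F ` I)"
    using connected_continuous_image[OF cont] I(2) by (simp add: is_interval_connected_1)
  have dG: "(G has_real_derivative inverse (f (G r))) (at r)" if r: "r \<in> F ` I" for r
  proof (rule has_field_derivative_inverse_basic[OF _ _ _ op r])
    have "G r \<in> I" using G r by (auto simp: homeomorphism_def)
    then show "(F has_real_derivative f (G r)) (at (G r))" "f (G r) \<noteq> 0"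
      using F s[of "G r"] by auto
    show "isCont G r"
      using G op r by (auto simp: homeomorphism_def continuous_on_eq_continuous_at)
    show "\<And>z. z \<in> F ` I \<Longrightarrow> F (G z) = z" using G by (auto simp: homeomorphism_def)
  qed
  show ?thesis using that[OF G op int dG] .
qed

definition trajectory :: "nat \<Rightarrow> real \<Rightarrow> real set \<Rightarrow> (real \<Rightarrow> complex \<times> real) \<Rightarrow> (real \<Rightarrow> complex \<times> real) \<Rightarrow> bool" where
  "trajectory n \<kappa> J g v \<longleftrightarrow> open J \<and> is_interval J \<and> J \<noteq> {} \<and>
     (\<forall>t\<in>J. ((\<lambda>t. (g t, v t)) has_vector_derivative profile_field n \<kappa> (g t, v t)) (at t) \<and>
        0 < snd (g t) \<and> g t \<bullet> g t = 1 \<and> v t \<bullet> v t = 1 \<and> g t \<bullet> v t = 0)"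

text \<open>Agreement of the positions is enough to call a trajectory an extension: on the open set
  \<open>J\<close> it forces the velocities to agree.\<close>

definition maximal_trajectory where
  "maximal_trajectory n \<kappa> J g v \<longleftrightarrow> trajectory n \<kappa> J g v \<and>
     (\<forall>J' g' v'. trajectory n \<kappa> J' g' v' \<longrightarrow> J \<subseteq> J' \<longrightarrow> (\<forall>t\<in>J. g' t = g t) \<longrightarrow> J' = J)"

lemma profile_field_vprod:
  "profile_field n \<kappa> (p, v) =
     (v, ((real n - 2) * snd (vprod p v) / snd p - \<kappa>) *\<^sub>R vprod p v - p)"
  by (simp add: profile_field_def Let_def vprod_def prod_eq_iff scaleR_conv_of_real divide_inverse)

lemma has_vector_derivative_fst:
  "(f has_vector_derivative d) F \<Longrightarrow> ((\<lambda>t. fst (f t)) has_vector_derivative fst d) F"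
  by (rule bounded_linear.has_vector_derivative[OF bounded_linear_fst])

lemma has_vector_derivative_snd:
  "(f has_vector_derivative d) F \<Longrightarrow> ((\<lambda>t. snd (f t)) has_vector_derivative snd d) F"
  by (rule bounded_linear.has_vector_derivative[OF bounded_linear_snd])

lemma trajectoryD:
  assumes "trajectory n \<kappa> J g v" "t \<in> J"
  shows "(g has_vector_derivative v t) (at t)"
    "(v has_vector_derivative
       ((real n - 2) * snd (vprod (g t) (v t)) / snd (g t) - \<kappa>) *\<^sub>R vprod (g t) (v t) - g t) (at t)"
    "0 < snd (g t)" "g t \<bullet> g t = 1" "v t \<bullet> v t = 1" "g t \<bullet> v t = 0"
proof -
  have d: "((\<lambda>t. (g t, v t)) has_vector_derivative profile_field n \<kappa> (g t, v t)) (at t)"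
    using assms by (auto simp: trajectory_def)
  show "(g has_vector_derivative v t) (at t)"
    using has_vector_derivative_fst[OF d] by (simp add: profile_field_vprod)
  show "(v has_vector_derivative
       ((real n - 2) * snd (vprod (g t) (v t)) / snd (g t) - \<kappa>) *\<^sub>R vprod (g t) (v t) - g t) (at t)"
    using has_vector_derivative_snd[OF d] by (simp add: profile_field_vprod)
qed (use assms in \<open>auto simp: trajectory_def\<close>)

lemma trajectoryI:
  assumes "open J" "is_interval J" "J \<noteq> {}"
    and "\<And>t. t \<in> J \<Longrightarrow> (g has_vector_derivative v t) (at t)"
    and "\<And>t. t \<in> J \<Longrightarrow> (v has_vector_derivative
       ((real n - 2) * snd (vprod (g t) (v t)) / snd (g t) - \<kappa>) *\<^sub>R vprod (g t) (v t) - g t) (at t)"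
    and "\<And>t. t \<in> J \<Longrightarrow> 0 < snd (g t) \<and> g t \<bullet> g t = 1 \<and> v t \<bullet> v t = 1 \<and> g t \<bullet> v t = 0"
  shows "trajectory n \<kappa> J g v"
  using assms unfolding trajectory_def by (auto simp: profile_field_vprod intro!: has_vector_derivative_Pair)

lemma vprod_minus_right [simp]: "vprod p (- v) = - vprod p v"
  by (simp add: vprod_def prod_eq_iff algebra_simps)

lemma has_vector_derivative_reflect:
  fixes t :: real
  assumes "(f has_vector_derivative d) (at (c - t))"
  shows "((\<lambda>t. f (c - t)) has_vector_derivative - d) (at t)"
proof -
  have "((\<lambda>t. c - t) has_vector_derivative - 1) (at t)"
    by (auto intro!: derivative_eq_intros)
  from vector_diff_chain_at[OF this] assms show ?thesis by (simp add: o_def)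
qed

text \<open>Under t \<mapsto> c - t the velocity, and with it \<open>vprod\<close>, changes sign
  while the acceleration does not, so the equation holds with -\<kappa>. The value c = 0 gives
  reversal of orientation, c = 2 e the reflection of time at e.\<close>

lemma trajectory_reflect:
  assumes "trajectory n \<kappa> J g v"
  shows "trajectory n (- \<kappa>) ((\<lambda>t. c - t) ` J) (\<lambda>t. g (c - t)) (\<lambda>t. - v (c - t))"
proof (rule trajectoryI)
  have J: "open J" "is_interval J" "J \<noteq> {}" using assms by (auto simp: trajectory_def)
  have img: "(\<lambda>t. c - t) ` J = (\<lambda>t. c + (-1) *\<^sub>R t) ` J" by auto
  show "open ((\<lambda>t. c - t) ` J)"
    using open_affinity[OF J(1), of "-1" c] unfolding img by simp
  show "is_interval ((\<lambda>t. c - t) ` J)"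
    using J(2) unfolding is_interval_connected_1
    by (intro connected_continuous_image) (auto intro!: continuous_intros)
  show "(\<lambda>t. c - t) ` J \<noteq> {}" using J by auto
  fix t assume "t \<in> (\<lambda>t. c - t) ` J"
  then have t: "c - t \<in> J" by auto
  note D = trajectoryD[OF assms t]
  show "((\<lambda>t. g (c - t)) has_vector_derivative - v (c - t)) (at t)"
    by (rule has_vector_derivative_reflect[OF D(1)])
  have "((\<lambda>t. - v (c - t)) has_vector_derivative
      - (- (((real n - 2) * snd (vprod (g (c - t)) (v (c - t))) / snd (g (c - t)) - \<kappa>)
        *\<^sub>R vprod (g (c - t)) (v (c - t)) - g (c - t)))) (at t)"
    by (intro has_vector_derivative_minus has_vector_derivative_reflect[OF D(2)])
  then show "((\<lambda>t. - v (c - t)) has_vector_derivative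
      ((real n - 2) * snd (vprod (g (c - t)) (- v (c - t))) / snd (g (c - t)) - (- \<kappa>))
        *\<^sub>R vprod (g (c - t)) (- v (c - t)) - g (c - t)) (at t)"
  proof -
    define A where "A = (real n - 2) * snd (vprod (g (c - t)) (v (c - t))) / snd (g (c - t))"
    have "(real n - 2) * snd (- vprod (g (c - t)) (v (c - t))) / snd (g (c - t)) = - A"
      by (simp add: A_def)
    then show ?thesis
      using \<open>((\<lambda>t. - v (c - t)) has_vector_derivative _) (at t)\<close>
      unfolding vprod_minus_right A_def[symmetric] by (simp add: algebra_simps)
  qed
qed (use trajectoryD[OF assms] in auto)

lemma maximal_trajectory_reverse:
  assumes "maximal_trajectory n \<kappa> J g v"
  shows "maximal_trajectory n (- \<kappa>) ((\<lambda>t. - t) ` J) (\<lambda>t. g (- t)) (\<lambda>t. - v (- t))"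
  unfolding maximal_trajectory_def
proof (intro conjI allI impI)
  show "trajectory n (- \<kappa>) ((\<lambda>t. - t) ` J) (\<lambda>t. g (- t)) (\<lambda>t. - v (- t))"
    using trajectory_reflect[of n \<kappa> J g v 0] assms by (simp add: maximal_trajectory_def)
  fix J' g' v' assume T: "trajectory n (- \<kappa>) J' g' v'" "(\<lambda>t. - t) ` J \<subseteq> J'"
    "\<forall>t\<in>(\<lambda>t. - t) ` J. g' t = g (- t)"
  have "trajectory n \<kappa> ((\<lambda>t. - t) ` J') (\<lambda>t. g' (- t)) (\<lambda>t. - v' (- t))"
    using trajectory_reflect[OF T(1), of 0] by simp
  moreover have "J \<subseteq> (\<lambda>t. - t) ` J'" using T(2) by force
  moreover have "\<forall>t\<in>J. g' (- t) = g t" using T(3) by auto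
  ultimately have "(\<lambda>t. - t) ` J' = J" using assms unfolding maximal_trajectory_def by blast
  then show "J' = (\<lambda>t. - t) ` J" by (force simp: image_image)
qed

lemma profile_field_continuous:
  "continuous_on {y. 0 < snd (fst y)} (profile_field n \<kappa>)"
  unfolding profile_field_def Let_def by (intro continuous_intros) auto

text \<open>The deviations from a unit speed curve on the sphere satisfy a linear system with a
  conserved energy.\<close>

lemma profile_field_invariants:
  assumes J: "open J" "is_interval J" "t0 \<in> J"
    and d: "\<And>t. t \<in> J \<Longrightarrow> ((\<lambda>t. (g t, v t)) has_vector_derivative profile_field n \<kappa> (g t, v t)) (at t)"
    and i: "g t0 \<bullet> g t0 = 1" "v t0 \<bullet> v t0 = 1" "g t0 \<bullet> v t0 = 0" and t: "t \<in> J"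
  shows "g t \<bullet> g t = 1 \<and> v t \<bullet> v t = 1 \<and> g t \<bullet> v t = 0"
proof -
  define a where "a t = (real n - 2) * snd (vprod (g t) (v t)) / snd (g t) - \<kappa>" for t
  have dg: "(g has_vector_derivative v t) (at t)"
    and dv: "(v has_vector_derivative a t *\<^sub>R vprod (g t) (v t) - g t) (at t)" if "t \<in> J" for t
    using has_vector_derivative_fst[OF d[OF that]] has_vector_derivative_snd[OF d[OF that]]
    by (simp_all add: profile_field_vprod a_def)
  have gg: "((\<lambda>t. g t \<bullet> g t) has_real_derivative 2 * (g t \<bullet> v t)) (at t)" if t: "t \<in> J" for t
    using bounded_bilinear.has_vector_derivative[OF bounded_bilinear_inner dg[OF t] dg[OF t]]
    by (simp add: has_real_derivative_iff_has_vector_derivative inner_commute)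
  have vv: "((\<lambda>t. v t \<bullet> v t) has_real_derivative - 2 * (g t \<bullet> v t)) (at t)" if t: "t \<in> J" for t
    using bounded_bilinear.has_vector_derivative[OF bounded_bilinear_inner dv[OF t] dv[OF t]]
    by (simp add: has_real_derivative_iff_has_vector_derivative inner_commute[of "v t" "g t"] inner_diff_left inner_diff_right)
  have gv: "((\<lambda>t. g t \<bullet> v t) has_real_derivative v t \<bullet> v t - g t \<bullet> g t) (at t)" if t: "t \<in> J" for t
    using bounded_bilinear.has_vector_derivative[OF bounded_bilinear_inner dg[OF t] dv[OF t]]
    by (simp add: has_real_derivative_iff_has_vector_derivative inner_diff_right)
  have const: "f t = f t0" if f: "\<And>t. t \<in> J \<Longrightarrow> (f has_real_derivative 0) (at t)" for f :: "real \<Rightarrow> real"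
  proof -
    have "\<exists>c. \<forall>x\<in>J. f x = c"
      by (rule has_field_derivative_zero_constant)
        (use J f in \<open>auto simp: is_interval_convex intro: has_field_derivative_at_within\<close>)
    then show ?thesis using t J(3) by auto
  qed
  have "g t \<bullet> g t + v t \<bullet> v t = g t0 \<bullet> g t0 + v t0 \<bullet> v t0"
    by (rule const) (auto intro!: derivative_eq_intros gg vv)
  moreover have "(v t \<bullet> v t - g t \<bullet> g t)\<^sup>2 + 4 * (g t \<bullet> v t)\<^sup>2
      = (v t0 \<bullet> v t0 - g t0 \<bullet> g t0)\<^sup>2 + 4 * (g t0 \<bullet> v t0)\<^sup>2"
    by (rule const) (auto intro!: derivative_eq_intros gg vv gv simp: algebra_simps)
  ultimately have *: "g t \<bullet> g t + v t \<bullet> v t = 2" "(v t \<bullet> v t - g t \<bullet> g t)\<^sup>2 + 4 * (g t \<bullet> v t)\<^sup>2 = 0"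
    using i by auto
  from *(2) have "v t \<bullet> v t - g t \<bullet> g t = 0" "g t \<bullet> v t = 0"
    by (auto simp: add_nonneg_eq_0_iff)
  with *(1) show ?thesis by auto
qed

text \<open>As long as b \<ge> m, position and velocity stay in a compact set on which the field is
  bounded. The solution is then Lipschitz up to the finite end \<beta>, has a limit there, and is
  continued by a local solution starting at the limit.\<close>

lemma trajectory_extend_right:
  assumes T: "trajectory n \<kappa> J g v" and bdd: "bdd_above J" and t0: "t0 \<in> J"
    and m: "0 < m" "\<And>t. t \<in> J \<Longrightarrow> t0 \<le> t \<Longrightarrow> m \<le> snd (g t)"
  shows "\<exists>J' g' v'. trajectory n \<kappa> J' g' v' \<and> J \<subset> J' \<and> (\<forall>t\<in>J. g' t = g t)"
proof -
  define f where "f = profile_field n \<kappa>"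
  define y where "y t = (g t, v t)" for t
  define \<beta> where "\<beta> = Sup J"
  have J: "open J" "is_interval J" "J \<noteq> {}" using T by (auto simp: trajectory_def)
  have J\<beta>: "t < \<beta>" if t: "t \<in> J" for t
  proof -
    obtain e where e: "0 < e" "ball t e \<subseteq> J" using J(1) t openE by blast
    then have "t + e / 2 \<in> J" by (auto simp: dist_real_def subset_iff)
    then have "t + e / 2 \<le> \<beta>" unfolding \<beta>_def by (intro cSup_upper bdd)
    then show ?thesis using e by linarith
  qed
  have in_J: "t \<in> J" if t: "t0 \<le> t" "t < \<beta>" for t
  proof -
    obtain t2 where "t2 \<in> J" "t < t2" using less_cSup_iff[OF J(3) bdd] t by (auto simp: \<beta>_def)
    then show ?thesis using mem_is_interval_1_I[OF J(2) t0] t by auto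
  qed
  have t0\<beta>: "t0 < \<beta>" by (rule J\<beta>[OF t0])
  have dy: "(y has_vector_derivative f (y t)) (at t)" if "t \<in> J" for t
    using T that by (auto simp: trajectory_def y_def[abs_def] f_def)
  define X :: "real \<Rightarrow> real \<Rightarrow> state set" where "X m r = {y. m \<le> snd (fst y) \<and> norm y \<le> r}" for m r
  have closed_X: "closed (X m r)" for m r
    unfolding X_def by (intro closed_Collect_conj closed_Collect_le continuous_intros)
  have yX: "y t \<in> X m 2" if "t0 \<le> t" "t < \<beta>" for t
  proof -
    have t: "t \<in> J" using in_J that by auto
    have "norm (y t) \<le> norm (g t) + norm (v t)" unfolding y_def by (rule norm_Pair_le)
    also have "\<dots> = 2" using trajectoryD(4,5)[OF T t] by (simp add: norm_eq_sqrt_inner)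
    finally show ?thesis using m(2)[OF t that(1)] by (simp add: X_def y_def)
  qed
  have lipX: "\<exists>L. L-lipschitz_on (X m r) f" if "0 < m" for m r
    using profile_field_lipschitz[OF that] unfolding f_def X_def by blast
  have "bounded (f ` X m 2)"
  proof (rule compact_imp_bounded, rule compact_continuous_image)
    show "continuous_on (X m 2) f"
      unfolding f_def
      by (rule continuous_on_subset[OF profile_field_continuous]) (use m in \<open>auto simp: X_def\<close>)
    have "bounded (X m 2)" unfolding X_def by (intro boundedI[of _ 2]) auto
    then show "compact (X m 2)" using closed_X by (simp add: compact_eq_bounded_closed)
  qed
  then obtain B where B: "0 < B" "\<And>x. x \<in> X m 2 \<Longrightarrow> norm (f x) \<le> B"
    by (metis bounded_pos imageI)
  have "B-lipschitz_on {t0..<\<beta>} y"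
  proof (rule bounded_derivative_imp_lipschitz)
    fix t assume t: "t \<in> {t0..<\<beta>}"
    show "(y has_derivative (\<lambda>h. h *\<^sub>R f (y t))) (at t within {t0..<\<beta>})"
      using dy[of t] in_J[of t] t by (auto simp: has_vector_derivative_def intro: has_derivative_at_withinI)
    have "norm (h *\<^sub>R f (y t)) \<le> B * norm h" for h :: real
      using mult_left_mono[OF B(2)[OF yX[of t]], of "\<bar>h\<bar>"] t by (simp add: mult.commute)
    then show "onorm (\<lambda>h. h *\<^sub>R f (y t)) \<le> B" using B by (intro onorm_bound) auto
  qed (use B in auto)
  \<comment> \<open>The Lipschitz extension to the closure supplies the limit at \<beta>.\<close>
  then obtain Y where "B-lipschitz_on (closure {t0..<\<beta>}) Y" and Yy: "\<forall>t\<in>{t0..<\<beta>}. Y t = y t"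
    using lipschitz_extend_closure by blast
  then have contY: "continuous_on {t0..\<beta>} Y"
    using t0\<beta> by (auto dest: lipschitz_on_continuous_on)
  have YX: "Y \<beta> \<in> X m 2"
  proof -
    have "Y ` closure {t0..<\<beta>} \<subseteq> X m 2"
      by (rule image_closure_subset) (use contY closed_X yX Yy t0\<beta> in auto)
    then show ?thesis using t0\<beta> by auto
  qed
  \<comment> \<open>The limit has b \<ge> m, so a ball of radius m / 2 around it stays away from the
    singularity b = 0.\<close>
  have ball: "cball (Y \<beta>) (m / 2) \<subseteq> X (m / 2) (2 + m / 2)"
  proof
    fix p assume "p \<in> cball (Y \<beta>) (m / 2)"
    then have p: "norm (Y \<beta> - p) \<le> m / 2" by (simp add: dist_norm)
    have "norm (snd (fst (Y \<beta> - p))) \<le> norm (Y \<beta> - p)"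
      using norm_snd_le[of "snd (fst (Y \<beta> - p))" "fst (fst (Y \<beta> - p))"]
        norm_fst_le[of "fst (Y \<beta> - p)" "snd (Y \<beta> - p)"]
      unfolding prod.collapse by (rule order_trans)
    then have "m / 2 \<le> snd (fst p)" using p YX by (auto simp: X_def)
    moreover have "norm p \<le> 2 + m / 2"
      using p YX norm_triangle_sub[of p "Y \<beta>"] by (simp add: X_def norm_minus_commute)
    ultimately show "p \<in> X (m / 2) (2 + m / 2)" by (simp add: X_def)
  qed
  obtain L where "L-lipschitz_on (X (m / 2) (2 + m / 2)) f" using lipX[of "m / 2"] m by auto
  then have "L-lipschitz_on (cball (Y \<beta>) (m / 2)) f" by (rule lipschitz_on_subset[OF _ ball])
  then obtain \<delta> w where w: "0 < \<delta>" "w 0 = Y \<beta>" "continuous_on {0..\<delta>} w"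
    "\<And>t. t \<in> {0<..<\<delta>} \<Longrightarrow> (w has_vector_derivative f (w t)) (at t)"
    using picard_forward[of L "Y \<beta>" "m / 2" f] m by auto
  \<comment> \<open>Nothing is known about where the local solution stays, so b > 0 is secured by
    continuity, at the cost of a shorter interval.\<close>
  have "continuous_on {0..\<delta>} (\<lambda>s. snd (fst (w s)))" by (intro continuous_intros w)
  then obtain d where d: "0 < d" "\<forall>s\<in>{0..\<delta>}. dist s 0 < d \<longrightarrow> dist (snd (fst (w s))) (snd (fst (w 0))) < m"
    unfolding continuous_on_iff using w(1) m(1) by force
  define \<delta>' where "\<delta>' = min d \<delta>"
  have \<delta>': "0 < \<delta>'" "\<delta>' \<le> \<delta>" using d w by (auto simp: \<delta>'_def)
  have wpos: "0 < snd (fst (w s))" if "0 \<le> s" "s < \<delta>'" for s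
  proof -
    have "dist (snd (fst (w s))) (snd (fst (w 0))) < m" using d that by (auto simp: \<delta>'_def)
    then show ?thesis using YX by (auto simp: w(2) X_def dist_real_def)
  qed
  define Z where "Z t = (if t < \<beta> then y t else w (t - \<beta>))" for t
  define J' where "J' = J \<union> {t0<..<\<beta> + \<delta>'}"
  have "continuous_on {t0<..<\<beta> + \<delta>'} (\<lambda>t. if t \<le> \<beta> then Y t else w (t - \<beta>))"
  proof (rule continuous_on_cases_le)
    show "continuous_on {t \<in> {t0<..<\<beta> + \<delta>'}. t \<le> \<beta>} Y"
      by (rule continuous_on_subset[OF contY]) auto
    show "continuous_on {t \<in> {t0<..<\<beta> + \<delta>'}. \<beta> \<le> t} (\<lambda>t. w (t - \<beta>))"
      by (rule continuous_on_compose2[OF w(3)]) (use \<delta>' in \<open>auto intro!: continuous_intros\<close>)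
  qed (use w in \<open>auto intro!: continuous_intros\<close>)
  then have contZ: "continuous_on {t0<..<\<beta> + \<delta>'} Z"
    by (rule continuous_on_eq) (use Yy w in \<open>auto simp: Z_def\<close>)
  have Zy: "Z t = y t" if "t \<in> J" for t using J\<beta>[OF that] by (simp add: Z_def)
  have Zpos: "0 < snd (fst (Z t))" if "t \<in> J'" for t
  proof (cases "t < \<beta>")
    case True
    then have "t \<in> J" using that in_J[of t] by (auto simp: J'_def)
    then show ?thesis using trajectoryD(3)[OF T] by (simp add: Zy y_def)
  next
    case False
    then show ?thesis using that wpos[of "t - \<beta>"] J\<beta>[of t] by (auto simp: J'_def Z_def)
  qed
  have dZ: "(Z has_vector_derivative f (Z t)) (at t)" if "t \<in> J'" for t
  proof -
    have J_case: ?thesis if "t \<in> J"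
      unfolding Zy[OF that]
      by (rule has_vector_derivative_transform_within_open[OF dy[OF that] J(1) that]) (simp add: Zy)
    have right: "(Z has_vector_derivative f (Z s)) (at s)" if s: "s \<in> {\<beta><..<\<beta> + \<delta>'}" for s
    proof -
      have "(w has_vector_derivative f (w (s - \<beta>))) (at (s - \<beta>))" using w(4) s \<delta>' by auto
      then have "((\<lambda>s. w (s - \<beta>)) has_vector_derivative f (w (s - \<beta>))) (at s)"
        using vector_diff_chain_at[of "\<lambda>s. s - \<beta>" 1 s w "f (w (s - \<beta>))"]
          has_vector_derivative_diff[OF has_vector_derivative_id has_vector_derivative_const]
        by (simp add: o_def)
      then have "((\<lambda>s. w (s - \<beta>)) has_vector_derivative f (Z s)) (at s)"
        using s by (simp add: Z_def)
      then show ?thesis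
        by (rule has_vector_derivative_transform_within_open[of _ _ _ "{\<beta><..<\<beta> + \<delta>'}"])
          (use s in \<open>auto simp: Z_def\<close>)
    qed
    \<comment> \<open>At \<beta> only continuity is available from the two sides; it suffices,
      because the prescribed derivative f (Z t) is continuous there.\<close>
    have "(Z has_vector_derivative f (Z \<beta>)) (at \<beta>)"
    proof (rule has_vector_derivative_at_join[OF contZ, of "\<lambda>t. f (Z t)"])
      show "continuous_on {t0<..<\<beta> + \<delta>'} (\<lambda>t. f (Z t))"
        unfolding f_def
        by (rule continuous_on_compose2[OF profile_field_continuous contZ])
          (use Zpos in \<open>auto simp: J'_def\<close>)
      fix s assume s: "s \<in> {t0<..<\<beta> + \<delta>'}" "s \<noteq> \<beta>"
      show "(Z has_vector_derivative f (Z s)) (at s)"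
      proof (cases "s < \<beta>")
        case True
        then have "s \<in> J" using in_J s by auto
        then show ?thesis
          unfolding Zy[OF \<open>s \<in> J\<close>]
          by (intro has_vector_derivative_transform_within_open[OF dy J(1)]) (simp_all add: Zy)
      qed (use right s in auto)
    qed (use t0\<beta> \<delta>' in auto)
    then show ?thesis
      using J_case right[of t] that in_J[of t] by (cases "t < \<beta>"; cases "t = \<beta>") (auto simp: J'_def)
  qed
  have J': "open J'" "is_interval J'" "t0 \<in> J'"
  proof -
    show "open J'" unfolding J'_def by (intro open_Un J) auto
    have "(t0 + \<beta>) / 2 \<in> J" using in_J t0\<beta> by auto
    moreover have "(t0 + \<beta>) / 2 \<in> {t0<..<\<beta> + \<delta>'}" using t0\<beta> \<delta>' by (auto simp: field_simps)
    ultimately show "is_interval J'"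
      using J(2) unfolding is_interval_connected_1 J'_def by (intro connected_Un) auto
  qed (use t0 in \<open>auto simp: J'_def\<close>)
  have "trajectory n \<kappa> J' (\<lambda>t. fst (Z t)) (\<lambda>t. snd (Z t))"
    unfolding trajectory_def
  proof (intro conjI ballI)
    have i: "fst (Z t0) \<bullet> fst (Z t0) = 1" "snd (Z t0) \<bullet> snd (Z t0) = 1" "fst (Z t0) \<bullet> snd (Z t0) = 0"
      using trajectoryD[OF T t0] by (auto simp: Zy[OF t0] y_def)
    have d': "((\<lambda>t. (fst (Z t), snd (Z t))) has_vector_derivative profile_field n \<kappa> (fst (Z t), snd (Z t))) (at t)"
      if "t \<in> J'" for t using dZ[OF that] by (simp add: f_def)
    fix t assume t: "t \<in> J'"
    show "((\<lambda>t. (fst (Z t), snd (Z t))) has_vector_derivative profile_field n \<kappa> (fst (Z t), snd (Z t))) (at t)"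
      by (rule d'[OF t])
    have "fst (Z t) \<bullet> fst (Z t) = 1 \<and> snd (Z t) \<bullet> snd (Z t) = 1 \<and> fst (Z t) \<bullet> snd (Z t) = 0"
      by (rule profile_field_invariants[OF J' d' i t])
    then show "fst (Z t) \<bullet> fst (Z t) = 1" "snd (Z t) \<bullet> snd (Z t) = 1" "fst (Z t) \<bullet> snd (Z t) = 0"
      by auto
    show "0 < snd (fst (Z t))" by (rule Zpos[OF t])
  qed (use J' in auto)
  moreover have "J \<subset> J'"
  proof -
    have "\<beta> \<in> J'" using t0\<beta> \<delta>' by (simp add: J'_def)
    moreover have "\<beta> \<notin> J" using J\<beta>[of \<beta>] by blast
    moreover have "J \<subseteq> J'" unfolding J'_def by (rule Un_upper1)
    ultimately show ?thesis by blast
  qed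
  moreover have "\<forall>t\<in>J. fst (Z t) = g t" by (simp add: Zy y_def)
  ultimately show ?thesis by blast
qed

text \<open>A maximal trajectory ends in finite time only by approaching the axis: b comes below
  every positive bound, or else the trajectory could be continued.\<close>

lemma maximal_trajectory_right_end:
  assumes M: "maximal_trajectory n \<kappa> J g v" and J: "bdd_above J" "t0 \<in> J" and m: "0 < m"
  obtains t where "t \<in> J" "t0 \<le> t" "snd (g t) < m"
proof (rule ccontr)
  assume "\<not> thesis"
  then have b: "\<And>t. t \<in> J \<Longrightarrow> t0 \<le> t \<Longrightarrow> m \<le> snd (g t)" using that by force
  have T: "trajectory n \<kappa> J g v" using M by (simp add: maximal_trajectory_def)
  obtain J' g' v' where E: "trajectory n \<kappa> J' g' v'" "J \<subset> J'" "\<forall>t\<in>J. g' t = g t"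
    using trajectory_extend_right[OF T J m b] by blast
  then have "J' = J" using M psubset_imp_subset[OF E(2)] unfolding maximal_trajectory_def by blast
  then show False using E(2) by simp
qed

text \<open>The sign \<open>s\<close> chooses the direction in which arc length is counted and
  \<epsilon> the side of the normal. Since \<open>vprod\<close> of position and velocity is
  \<open>s\<close> times the conormal, the mean curvature h turns into the parameter - s \<epsilon>
  h.\<close>

lemma (in C2_curve) arclength_trajectory:
  assumes s: "s = 1 \<or> s = -1" and \<epsilon>: "\<epsilon> = 1 \<or> \<epsilon> = -1"
    and mean: "\<And>t. t \<in> I \<Longrightarrow> \<epsilon> * rot_mean m t = h" and m: "real m = real n - 1"
  obtains K g v \<sigma> \<tau> where "trajectory n (- (s * \<epsilon> * h)) K g v" "homeomorphism I K \<sigma> \<tau>"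
    "\<And>t. t \<in> I \<Longrightarrow> \<gamma> t = g (\<sigma> t)"
    "\<And>t. t \<in> I \<Longrightarrow> vprod (g (\<sigma> t)) (v (\<sigma> t)) = s *\<^sub>R conormal t"
proof -
  have ss: "s * s = 1" and ee: "\<epsilon> * \<epsilon> = 1" using s \<epsilon> by auto
  have "continuous_on I (\<lambda>t. s * norm (\<gamma>1 t))"
    by (intro continuous_intros continuous_at_imp_continuous_on ballI has_vector_derivative_continuous[OF d2])
  then obtain \<sigma> where \<sigma>: "\<And>t. t \<in> I \<Longrightarrow> (\<sigma> has_real_derivative s * norm (\<gamma>1 t)) (at t)"
    using open_interval_antiderivative[OF open_I interval_I] by blast
  have "0 < s * (s * norm (\<gamma>1 t))" if "t \<in> I" for t
    using nz[OF that] ss by (simp add: mult.assoc[symmetric])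
  then obtain K \<tau> where K: "homeomorphism I K \<sigma> \<tau>" "open K" "is_interval K"
    and d\<tau>: "\<And>r. r \<in> K \<Longrightarrow> (\<tau> has_real_derivative inverse (s * norm (\<gamma>1 (\<tau> r)))) (at r)"
    using interval_homeomorphism_of_deriv[OF open_I interval_I \<sigma>] by blast
  have \<tau>I: "\<tau> r \<in> I" if "r \<in> K" for r using K(1) that by (auto simp: homeomorphism_def)
  have inv: "inverse s = s"
    using s by auto
  define u where "u t = (s / norm (\<gamma>1 t)) *\<^sub>R \<gamma>1 t" for t
  define g where "g r = \<gamma> (\<tau> r)" for r
  define v where "v r = u (\<tau> r)" for r
  \<comment> \<open>The coefficient \<open>c\<close> of the tangential part stays unspecified; it
    drops out on pairing with the conormal.\<close>
  have du: "\<exists>c. (u has_vector_derivative (s / norm (\<gamma>1 t)) *\<^sub>R \<gamma>2 t + c *\<^sub>R \<gamma>1 t) (at t)" if t: "t \<in> I" for t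
  proof -
    have "(\<lambda>t. norm (\<gamma>1 t)) differentiable (at t)"
      by (intro differentiable_compose[of norm \<gamma>1 t, OF differentiable_norm_at[OF nz[OF t]]]
          differentiableI_vector[OF d2[OF t]])
    then obtain d where d: "((\<lambda>t. norm (\<gamma>1 t)) has_real_derivative d) (at t)"
      by (metis real_differentiable_def)
    have "((\<lambda>t. s / norm (\<gamma>1 t)) has_real_derivative - s * d / (norm (\<gamma>1 t))\<^sup>2) (at t)"
      using nz[OF t] by (auto intro!: derivative_eq_intros d simp: power2_eq_square)
    from has_vector_derivative_scaleR[OF this d2[OF t]] show ?thesis
      unfolding u_def by blast
  qed
  have dg: "(g has_vector_derivative v r) (at r)" if r: "r \<in> K" for r
    using vector_diff_chain_at[OF d\<tau>[OF r, unfolded has_real_derivative_iff_has_vector_derivative] d1[OF \<tau>I[OF r]]]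
    by (simp add: o_def g_def[abs_def] v_def u_def inv divide_inverse)
  have gg: "g r \<bullet> g r = 1" and vv: "v r \<bullet> v r = 1" and gv: "g r \<bullet> v r = 0" if r: "r \<in> K" for r
    using sphere[OF \<tau>I[OF r]] inner_deriv_zero[OF \<tau>I[OF r]] nz[OF \<tau>I[OF r]] ss
    by (simp_all add: g_def v_def u_def dot_square_norm power2_eq_square)
  have e: "vprod (g r) (v r) = s *\<^sub>R conormal (\<tau> r)" for r
    by (simp add: g_def v_def u_def conormal_def bounded_bilinear.scaleR_right[OF bounded_bilinear_vprod])
  have dv: "(v has_vector_derivative
      ((real n - 2) * snd (vprod (g r) (v r)) / snd (g r) - (- (s * \<epsilon> * h))) *\<^sub>R vprod (g r) (v r) - g r) (at r)"
    if r: "r \<in> K" for r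
  proof -
    define t where "t = \<tau> r"
    have t: "t \<in> I" using \<tau>I[OF r] by (simp add: t_def)
    obtain c where c: "(u has_vector_derivative (s / norm (\<gamma>1 t)) *\<^sub>R \<gamma>2 t + c *\<^sub>R \<gamma>1 t) (at t)"
      using du[OF t] by blast
    define w where "w = (s / norm (\<gamma>1 t)) *\<^sub>R ((s / norm (\<gamma>1 t)) *\<^sub>R \<gamma>2 t + c *\<^sub>R \<gamma>1 t)"
    have dw: "(v has_vector_derivative w) (at r)"
      using vector_diff_chain_at[OF d\<tau>[OF r, unfolded has_real_derivative_iff_has_vector_derivative] c[unfolded t_def]]
      by (simp add: o_def v_def[abs_def] w_def inv t_def divide_inverse)
    have wv: "w \<bullet> v r = 0"
    proof -
      have "((\<lambda>r. v r \<bullet> v r) has_vector_derivative (v r \<bullet> w + w \<bullet> v r)) (at r)"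
        by (rule bounded_bilinear.has_vector_derivative[OF bounded_bilinear_inner dw dw])
      moreover have "((\<lambda>r. v r \<bullet> v r) has_vector_derivative 0) (at r)"
        by (rule has_vector_derivative_transform_within_open[OF has_vector_derivative_const K(2) r])
          (simp add: vv)
      ultimately have "v r \<bullet> w + w \<bullet> v r = 0" by (rule vector_derivative_unique_at)
      then show ?thesis by (simp add: inner_commute)
    qed
    have wg: "w \<bullet> g r = -1"
    proof -
      have "((\<lambda>r. g r \<bullet> v r) has_vector_derivative (g r \<bullet> w + v r \<bullet> v r)) (at r)"
        by (rule bounded_bilinear.has_vector_derivative[OF bounded_bilinear_inner dg[OF r] dw])
      moreover have "((\<lambda>r. g r \<bullet> v r) has_vector_derivative 0) (at r)"
        by (rule has_vector_derivative_transform_within_open[OF has_vector_derivative_const K(2) r])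
          (simp add: gv)
      ultimately have "g r \<bullet> w + v r \<bullet> v r = 0" by (rule vector_derivative_unique_at)
      then show ?thesis by (simp add: inner_commute vv[OF r])
    qed
    \<comment> \<open>The acceleration is found by its components in the frame: none along v because
      v has length one, -1 along g because g and v stay orthogonal, and along E the one given by the
      mean curvature.\<close>
    define E where "E = vprod (g r) (v r)"
    have EE: "E \<bullet> E = 1" by (simp add: E_def inner_vprod_vprod gg[OF r] vv[OF r] gv[OF r])
    have "w = (w \<bullet> E) *\<^sub>R E - g r"
      using vprod_expand[of "g r" "v r" w]
      by (simp add: E_def[symmetric] EE gg[OF r] vv[OF r] gv[OF r] wv wg)
    moreover have "w \<bullet> E = (real n - 2) * snd E / snd (g r) - (- (s * \<epsilon> * h))"
    proof -
      have "w \<bullet> E = (s / norm (\<gamma>1 t)) * (s / norm (\<gamma>1 t)) * s * (\<gamma>2 t \<bullet> conormal t)"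
        by (simp add: E_def e t_def[symmetric] w_def inner_add_left conormal_orth)
      also have "\<dots> = s * ((conormal t \<bullet> \<gamma>2 t) / (norm (\<gamma>1 t))\<^sup>2)"
        using ss by (simp add: power2_eq_square inner_commute)
      also have "(conormal t \<bullet> \<gamma>2 t) / (norm (\<gamma>1 t))\<^sup>2 = \<epsilon> * h + (real n - 2) * snd (conormal t) / snd (\<gamma> t)"
      proof -
        have "rot_mean m t = \<epsilon> * h"
          using mean[OF t] ee by (metis mult.assoc mult_1)
        then show ?thesis by (simp add: rot_mean_def m algebra_simps)
      qed
      finally have "w \<bullet> E = s * (\<epsilon> * h + (real n - 2) * snd (conormal t) / snd (\<gamma> t))" .
      moreover have "snd E = s * snd (conormal t)" "snd (g r) = snd (\<gamma> t)"
        unfolding E_def e by (simp_all add: g_def t_def)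
      ultimately show ?thesis by (simp add: algebra_simps)
    qed
    ultimately show ?thesis using dw by (simp add: E_def)
  qed
  have "trajectory n (- (s * \<epsilon> * h)) K g v"
  proof (rule trajectoryI)
    show "K \<noteq> {}" using K(1) nonempty_I by (auto simp: homeomorphism_def)
  qed (use K dg dv gg vv gv pos[OF \<tau>I] in \<open>auto simp: g_def\<close>)
  moreover have "\<tau> (\<sigma> t) = t" if "t \<in> I" for t using K(1) that by (auto simp: homeomorphism_def)
  ultimately show ?thesis
    by (intro that[OF _ K(1), of g v]) (simp_all only: e, simp_all add: g_def)
qed

text \<open>The converse of \<open>arclength_trajectory\<close>, needed to turn an extension of the
  trajectory into a larger Delaunay curve. The side of the normal is free, so \<kappa> matters only
  up to sign.\<close>

lemma trajectory_delaunay: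
  assumes T: "trajectory n \<kappa> J g v" and m: "real CARD('m::finite) = real n - 1" and h: "\<bar>h\<bar> = \<bar>\<kappa>\<bar>"
  shows "delaunay_curve TYPE('m) h J g"
proof -
  define a where "a t = ((real n - 2) * snd (vprod (g t) (v t)) / snd (g t) - \<kappa>) *\<^sub>R vprod (g t) (v t) - g t" for t
  note D = trajectoryD[OF T]
  have cg: "continuous_on J g" and cv: "continuous_on J v"
    by (intro continuous_at_imp_continuous_on ballI has_vector_derivative_continuous[OF D(1)]
        has_vector_derivative_continuous[OF D(2)], assumption)+
  have cp: "continuous_on J (\<lambda>t. vprod (g t) (v t))"
    by (rule bounded_bilinear.continuous_on[OF bounded_bilinear_vprod cg cv])
  have ca: "continuous_on J a"
    unfolding a_def by (intro continuous_intros cp cg) (use D(3) in force)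
  have vnz: "v t \<noteq> 0" if "t \<in> J" for t using D(5)[OF that] by auto
  interpret C2_curve J g v a
    by unfold_locales (use T D vnz ca in \<open>auto simp: trajectory_def a_def\<close>)
  have con: "conormal t = vprod (g t) (v t)" if "t \<in> J" for t
    using D(5)[OF that] by (simp add: conormal_def norm_eq_sqrt_inner)
  have mean: "rot_mean CARD('m) t = - \<kappa>" if t: "t \<in> J" for t
  proof -
    have "conormal t \<bullet> a t = (real n - 2) * snd (conormal t) / snd (g t) - \<kappa>"
      unfolding a_def con[OF t] by (simp add: inner_diff_right inner_vprod_vprod D(4-6)[OF t])
    then show ?thesis
      using D(5)[OF t] by (simp add: rot_mean_def m power2_norm_eq_inner)
  qed
  obtain \<epsilon> where \<epsilon>: "\<epsilon> = 1 \<or> \<epsilon> = -1" "h = \<epsilon> * - \<kappa>" using h by (metis abs_eq_iff mult_1 mult_minus1 minus_minus)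
  have "cmc_with_normal J g (rot_normal \<epsilon> :: real \<times> (real ^ 'm) \<Rightarrow> _) h"
    unfolding cmc_with_normal_def
  proof (intro conjI ballI)
    show "unit_normal_field J g (rot_normal \<epsilon> :: real \<times> (real ^ 'm) \<Rightarrow> _)"
      by (rule unit_normal_rot_normal[OF \<epsilon>(1)])
    fix q :: "real \<times> (real ^ 'm)" assume "q \<in> rot_dom J"
    then obtain t x where "q = (t, x)" "t \<in> J" "x \<in> sphere 0 1" by auto
    then show "has_mean_curvature J g (rot_normal \<epsilon>) h q"
      using has_mean_curvature_rot_normal[of t x "rot_normal \<epsilon>" \<epsilon> h] mean \<epsilon>(2) by simp
  qed
  moreover have "generating_curve J g"
  proof -
    have "regular_C2_on J g"
      unfolding regular_C2_on_def C1_differentiable_on_def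
      by (intro exI[of _ v] conjI exI[of _ a]) (use d1 d2 nz ca in auto)
    then show ?thesis
      unfolding generating_curve_def
      using open_I interval_I nonempty_I pos D(4) by (auto simp: norm_eq_sqrt_inner)
  qed
  ultimately show ?thesis unfolding delaunay_curve_def by blast
qed

lemma generating_curve_C2:
  assumes "generating_curve I \<gamma>"
  obtains \<gamma>1 \<gamma>2 where "C2_curve I \<gamma> \<gamma>1 \<gamma>2"
proof -
  obtain \<gamma>1 \<gamma>2 where "\<forall>t\<in>I. (\<gamma> has_vector_derivative \<gamma>1 t) (at t) \<and> \<gamma>1 t \<noteq> 0"
    "\<forall>t\<in>I. (\<gamma>1 has_vector_derivative \<gamma>2 t) (at t)" "continuous_on I \<gamma>2"
    using assms unfolding generating_curve_def regular_C2_on_def C1_differentiable_on_def by blast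
  then have "C2_curve I \<gamma> \<gamma>1 \<gamma>2"
    using assms by unfold_locales (auto simp: generating_curve_def dot_square_norm)
  then show ?thesis by (rule that)
qed

text \<open>The normal is chosen such that the mean curvature is k \<ge> 0, the orientation such
  that the equation has \<kappa> = k. The normal then is the negative of the cross product; this
  explicit form decides later on which side the ball of a round sphere lies.\<close>

lemma maximal_delaunay_trajectory:
  assumes n: "n \<ge> 3" and m: "CARD('m::finite) = n - 1" and M: "maximal_delaunay_curve TYPE('m) h I \<gamma>"
    and k: "k = \<bar>h\<bar>"
  obtains K g v \<sigma> \<tau> and N :: "real \<times> (real ^ 'm) \<Rightarrow> complex \<times> (real ^ 'm)"
  where "maximal_trajectory n k K g v" "homeomorphism I K \<sigma> \<tau>" "\<And>t. t \<in> I \<Longrightarrow> \<gamma> t = g (\<sigma> t)"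
    "cmc_with_normal I \<gamma> N k"
    "\<And>t x. t \<in> I \<Longrightarrow> N (t, x) =
       (- fst (vprod (g (\<sigma> t)) (v (\<sigma> t))), (- snd (vprod (g (\<sigma> t)) (v (\<sigma> t)))) *\<^sub>R x)"
proof -
  have m': "real CARD('m) = real n - 1" using m n by simp
  have gen: "generating_curve I \<gamma>" using M by (simp add: maximal_delaunay_curve_def delaunay_curve_def)
  obtain \<gamma>1 \<gamma>2 where "C2_curve I \<gamma> \<gamma>1 \<gamma>2" using generating_curve_C2[OF gen] .
  then interpret C2_curve I \<gamma> \<gamma>1 \<gamma>2 .
  obtain N0 :: "real \<times> (real ^ 'm) \<Rightarrow> complex \<times> (real ^ 'm)" where N0: "cmc_with_normal I \<gamma> N0 h"
    using M by (auto simp: maximal_delaunay_curve_def delaunay_curve_def)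
  have "unit_normal_field I \<gamma> N0" "2 \<le> CARD('m)"
    using N0 n m by (auto simp: cmc_with_normal_def)
  then obtain \<epsilon>0 where \<epsilon>0: "\<epsilon>0 = 1 \<or> \<epsilon>0 = -1" "\<And>q. q \<in> rot_dom I \<Longrightarrow> N0 q = rot_normal \<epsilon>0 q"
    using unit_normal_field_cases by blast
  obtain x0 :: "real ^ 'm" where x0: "x0 \<in> sphere 0 1"
    using vector_choose_size[of 1] by auto
  have mean0: "\<epsilon>0 * rot_mean CARD('m) t = h" if t: "t \<in> I" for t
    using has_mean_curvature_rot_normal[OF t x0 \<epsilon>0(2), of h] N0 t x0
    by (auto simp: cmc_with_normal_def)
  obtain \<epsilon> where \<epsilon>: "\<epsilon> = 1 \<or> \<epsilon> = -1" and mean: "\<And>t. t \<in> I \<Longrightarrow> \<epsilon> * rot_mean CARD('m) t = k"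
  proof (cases "0 \<le> h")
    case True
    then show ?thesis using that[of \<epsilon>0] \<epsilon>0 mean0 k by simp
  next
    case False
    then show ?thesis using that[of "- \<epsilon>0"] \<epsilon>0 mean0 k by auto
  qed
  \<comment> \<open>This direction of travel gives - (s \<epsilon> k) = k, since \<epsilon> squares
    to 1.\<close>
  define s where "s = - \<epsilon>"
  have s: "s = 1 \<or> s = -1" and se: "- (s * \<epsilon> * k) = k" using \<epsilon> by (auto simp: s_def)
  obtain K g v \<sigma> \<tau> where T: "trajectory n k K g v" and H: "homeomorphism I K \<sigma> \<tau>"
    and g: "\<And>t. t \<in> I \<Longrightarrow> \<gamma> t = g (\<sigma> t)"
    and e: "\<And>t. t \<in> I \<Longrightarrow> vprod (g (\<sigma> t)) (v (\<sigma> t)) = s *\<^sub>R conormal t"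
    using arclength_trajectory[OF s \<epsilon> mean m'] unfolding se by blast
  show ?thesis
  proof (rule that[OF _ H g])
    show "maximal_trajectory n k K g v"
      unfolding maximal_trajectory_def
    proof (intro conjI allI impI T)
      fix J' g' v' assume T': "trajectory n k J' g' v'" "K \<subseteq> J'" "\<forall>t\<in>K. g' t = g t"
      show "J' = K"
      \<comment> \<open>A strictly larger trajectory would be a larger Delaunay curve containing a
        reparametrization of \<gamma>.\<close>
      proof (rule ccontr)
        assume "J' \<noteq> K"
        then have "K \<subset> J'" using T' by auto
        moreover have "delaunay_curve TYPE('m) h J' g'"
          by (rule trajectory_delaunay[OF T'(1) m']) (use k in auto)
        moreover have "\<sigma> t \<in> K" if "t \<in> I" for t using H that by (auto simp: homeomorphism_def)
        then have "reparametrization I \<gamma> K g'"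
          unfolding reparametrization_def using H g T'(3) by force
        ultimately show False using M unfolding maximal_delaunay_curve_def by blast
      qed
    qed
    show "cmc_with_normal I \<gamma> (rot_normal \<epsilon> :: real \<times> (real ^ 'm) \<Rightarrow> _) k"
      unfolding cmc_with_normal_def
    proof (intro conjI ballI)
      show "unit_normal_field I \<gamma> (rot_normal \<epsilon> :: real \<times> (real ^ 'm) \<Rightarrow> _)"
        by (rule unit_normal_rot_normal[OF \<epsilon>])
      fix q :: "real \<times> (real ^ 'm)" assume "q \<in> rot_dom I"
      then obtain t x where "q = (t, x)" "t \<in> I" "x \<in> sphere 0 1" by auto
      then show "has_mean_curvature I \<gamma> (rot_normal \<epsilon>) k q"
        using has_mean_curvature_rot_normal[of t x "rot_normal \<epsilon>" \<epsilon> k] mean by simp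
    qed
    fix t and x :: "real ^ 'm" assume t: "t \<in> I"
    show "rot_normal \<epsilon> (t, x) =
        (- fst (vprod (g (\<sigma> t)) (v (\<sigma> t))), (- snd (vprod (g (\<sigma> t)) (v (\<sigma> t)))) *\<^sub>R x)"
      by (simp add: e[OF t] rot_normal_def s_def scaleR_conv_of_real)
  qed
qed

section \<open>The barrier functions\<close>

text \<open>The inequality R < L reads C < \<open>barrier n \<kappa> s\<close>, and - R < L reads -
  C < \<open>barrier n (- \<kappa>) s\<close>. Thus the two-sided condition splits into two
  conditions of the same form, exchanged by reversal of orientation.\<close>

definition barrier :: "nat \<Rightarrow> real \<Rightarrow> real \<Rightarrow> real" where
  "barrier n \<kappa> s = L_fun n s - \<kappa> / (real n - 1) * sin s ^ (n - 1)"

text \<open>The derivative of the barrier without its factor sin^(n-3). It is also cos s sin s times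
  the difference of the two sides of the equation that defines \<open>s_stat\<close>.\<close>

definition barrier_slope :: "nat \<Rightarrow> real \<Rightarrow> real \<Rightarrow> real" where
  "barrier_slope n \<kappa> s = (real n - 2) * (cos s)\<^sup>2 - (sin s)\<^sup>2 - \<kappa> * sin s * cos s"

lemma barrier_deriv:
  assumes n: "n \<ge> 3"
  shows "(barrier n \<kappa> has_real_derivative sin s ^ (n - 3) * barrier_slope n \<kappa> s) (at s)"
proof -
  obtain m where m: "n = m + 3" using n by (metis add.commute le_Suc_ex)
  have e: "n - 2 = Suc m" "n - 1 = Suc (Suc m)" "n - 3 = m" "real n - 2 = real m + 1" "real n - 1 = real m + 2"
    by (auto simp: m)
  have nz: "real m + 2 \<noteq> 0" by linarith
  show ?thesis
    unfolding barrier_def L_fun_def barrier_slope_def e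
    by (rule derivative_eq_intros refl)+
      (use nz in \<open>simp add: field_simps power2_eq_square\<close>)
qed

lemma tan_less_pi_half:
  assumes "0 < s" "s < t" "t < pi / 2"
  shows "tan s < tan t"
  using assms tan_monotone[of s t] by auto

lemma cot_less_pi_half:
  assumes "0 < s" "s < t" "t < pi / 2"
  shows "cot t < cot s"
proof -
  have "0 < tan s" "0 < tan t" using assms by (auto intro: tan_gt_zero)
  then have "inverse (tan t) < inverse (tan s)" using tan_less_pi_half[OF assms] by simp
  then show ?thesis by (simp add: cot_altdef)
qed

lemma barrier_slope_eq:
  assumes "0 < s" "s < pi / 2"
  shows "barrier_slope n \<kappa> s = cos s * sin s * ((- tan s + (real n - 2) * cot s) - \<kappa>)"
proof -
  have "0 < cos s" "0 < sin s" using assms by (auto intro: cos_gt_zero sin_gt_zero)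
  then show ?thesis
    by (simp add: barrier_slope_def tan_def cot_def field_simps power2_eq_square)
qed

lemma s_stat:
  assumes n: "n \<ge> 3"
  shows "0 < s_stat n \<kappa>" "s_stat n \<kappa> < pi / 2"
    "- tan (s_stat n \<kappa>) + (real n - 2) * cot (s_stat n \<kappa>) = \<kappa>"
proof -
  define P where "P s \<longleftrightarrow> 0 < s \<and> s < pi / 2 \<and> - tan s + (real n - 2) * cot s = \<kappa>" for s
  \<comment> \<open>Unlike tan and cot, the slope is continuous up to both ends, where its values
    are n - 2 and -1.\<close>
  have "\<exists>s\<ge>0. s \<le> pi / 2 \<and> barrier_slope n \<kappa> s = 0"
  proof (rule IVT2')
    show "continuous_on {0..pi / 2} (barrier_slope n \<kappa>)"
      unfolding barrier_slope_def by (intro continuous_intros)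
  qed (use n in \<open>auto simp: barrier_slope_def\<close>)
  then obtain s where s: "0 \<le> s" "s \<le> pi / 2" "barrier_slope n \<kappa> s = 0" by blast
  have "barrier_slope n \<kappa> 0 \<noteq> 0" "barrier_slope n \<kappa> (pi / 2) \<noteq> 0"
    using n by (auto simp: barrier_slope_def)
  then have "s \<noteq> 0" "s \<noteq> pi / 2" using s(3) by metis+
  then have s': "0 < s" "s < pi / 2" using s by auto
  have "cos s * sin s \<noteq> 0" using s' cos_gt_zero[of s] sin_gt_zero[of s] by auto
  then have "P s" using s(3) s' unfolding barrier_slope_eq[OF s'] P_def by auto
  moreover have "t = s" if "P t" for t
  proof -
    have "False" if "P x" "P y" "x < y" for x y
    proof -
      have "tan x < tan y" "cot y < cot x"
        using that by (auto simp: P_def intro: tan_less_pi_half cot_less_pi_half)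
      moreover have "(real n - 2) * cot y \<le> (real n - 2) * cot x"
        using n \<open>cot y < cot x\<close> by (intro mult_left_mono) auto
      ultimately show False using that by (auto simp: P_def)
    qed
    then show ?thesis using \<open>P s\<close> that by (metis linorder_neqE_linordered_idom)
  qed
  ultimately have "P (THE s. P s)" by (rule theI)
  then show "0 < s_stat n \<kappa>" "s_stat n \<kappa> < pi / 2"
    "- tan (s_stat n \<kappa>) + (real n - 2) * cot (s_stat n \<kappa>) = \<kappa>"
    unfolding s_stat_def P_def by auto
qed

lemma barrier_slope_sign:
  assumes n: "n \<ge> 3" and s: "0 < s" "s < pi / 2"
  shows "s < s_stat n \<kappa> \<Longrightarrow> 0 < barrier_slope n \<kappa> s"
    "s_stat n \<kappa> < s \<Longrightarrow> barrier_slope n \<kappa> s < 0"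
proof -
  have cs: "0 < cos s * sin s" using s by (auto intro!: mult_pos_pos cos_gt_zero sin_gt_zero)
  note st = s_stat[OF n, of \<kappa>]
  {
    assume l: "s < s_stat n \<kappa>"
    have "(real n - 2) * cot (s_stat n \<kappa>) \<le> (real n - 2) * cot s"
      using n cot_less_pi_half[OF s(1) l st(2)] by (intro mult_left_mono) auto
    then have "0 < (- tan s + (real n - 2) * cot s) - \<kappa>"
      using st(3) tan_less_pi_half[OF s(1) l st(2)] by linarith
    then show "0 < barrier_slope n \<kappa> s"
      unfolding barrier_slope_eq[OF s] using cs by (metis mult_pos_pos)
  }
  assume l: "s_stat n \<kappa> < s"
  have "(real n - 2) * cot s \<le> (real n - 2) * cot (s_stat n \<kappa>)"
    using n cot_less_pi_half[OF st(1) l s(2)] by (intro mult_left_mono) auto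
  then have "(- tan s + (real n - 2) * cot s) - \<kappa> < 0"
    using st(3) tan_less_pi_half[OF st(1) l s(2)] by linarith
  then show "barrier_slope n \<kappa> s < 0"
    unfolding barrier_slope_eq[OF s] using cs by (metis mult_pos_neg)
qed

lemma barrier_increasing:
  assumes n: "n \<ge> 3" and s: "0 \<le> s" "s < t" "t \<le> s_stat n \<kappa>"
  shows "barrier n \<kappa> s < barrier n \<kappa> t"
proof (rule DERIV_pos_imp_increasing_open[OF s(2)])
  show "continuous_on {s..t} (barrier n \<kappa>)"
    by (intro continuous_at_imp_continuous_on ballI DERIV_isCont[OF barrier_deriv[OF n]])
  fix x assume x: "s < x" "x < t"
  then have "0 < x" "x < pi / 2" "x < s_stat n \<kappa>" using s s_stat[OF n, of \<kappa>] by auto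
  then have "0 < sin x ^ (n - 3) * barrier_slope n \<kappa> x"
    using barrier_slope_sign(1)[OF n] by (intro mult_pos_pos zero_less_power sin_gt_zero) auto
  then show "\<exists>y. (barrier n \<kappa> has_real_derivative y) (at x) \<and> 0 < y"
    using barrier_deriv[OF n] by blast
qed

lemma barrier_decreasing:
  assumes n: "n \<ge> 3" and s: "s_stat n \<kappa> \<le> s" "s < t" "t \<le> pi / 2"
  shows "barrier n \<kappa> t < barrier n \<kappa> s"
proof (rule DERIV_neg_imp_decreasing_open[OF s(2)])
  show "continuous_on {s..t} (barrier n \<kappa>)"
    by (intro continuous_at_imp_continuous_on ballI DERIV_isCont[OF barrier_deriv[OF n]])
  fix x assume x: "s < x" "x < t"
  then have "0 < x" "x < pi / 2" "s_stat n \<kappa> < x" using s s_stat[OF n, of \<kappa>] by auto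
  then have "sin x ^ (n - 3) * barrier_slope n \<kappa> x < 0"
    using barrier_slope_sign(2)[OF n] by (intro mult_pos_neg zero_less_power sin_gt_zero) auto
  then show "\<exists>y. (barrier n \<kappa> has_real_derivative y) (at x) \<and> y < 0"
    using barrier_deriv[OF n] by blast
qed

lemma C_stat_barrier: "C_stat n \<kappa> = barrier n \<kappa> (s_stat n \<kappa>)"
  by (simp add: C_stat_def barrier_def)

lemma barrier_less_C_stat:
  assumes "n \<ge> 3" "0 \<le> s" "s \<le> pi / 2" "s \<noteq> s_stat n \<kappa>"
  shows "barrier n \<kappa> s < C_stat n \<kappa>"
  using barrier_increasing[of n s "s_stat n \<kappa>" \<kappa>] barrier_decreasing[of n \<kappa> "s_stat n \<kappa>" s]
    s_stat[of n \<kappa>] assms by (cases "s < s_stat n \<kappa>") (auto simp: C_stat_barrier)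

lemma barrier_le_C_stat:
  assumes "n \<ge> 3" "0 \<le> s" "s \<le> pi / 2"
  shows "barrier n \<kappa> s \<le> C_stat n \<kappa>"
  using barrier_less_C_stat[OF assms, of \<kappa>] by (cases "s = s_stat n \<kappa>") (auto simp: C_stat_barrier)

text \<open>The barrier rises up to \<open>s_stat\<close> and falls afterwards, so its superlevel
  sets are intervals; \<open>J_set\<close> is an intersection of two of them.\<close>

lemma barrier_quasiconcave:
  assumes n: "n \<ge> 3" and s: "0 \<le> x" "x \<le> s" "s \<le> y" "y \<le> pi / 2"
    and c: "c < barrier n \<kappa> x" "c < barrier n \<kappa> y"
  shows "c < barrier n \<kappa> s"
proof (cases "s \<le> s_stat n \<kappa>")
  case True
  then show ?thesis using barrier_increasing[OF n s(1), of s \<kappa>] c s by (cases "x = s") auto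
next
  case False
  then show ?thesis using barrier_decreasing[OF n _ _ s(4), of \<kappa> s] c s by (cases "s = y") auto
qed

lemma J_set_barrier:
  "J_set n C \<kappa> = {s. 0 < s \<and> s < pi / 2 \<and> C < barrier n \<kappa> s \<and> - C < barrier n (- \<kappa>) s}"
  by (auto simp: J_set_def R_fun_def barrier_def abs_less_iff)

lemma J_set_between:
  assumes n: "n \<ge> 3" and "x \<in> J_set n C \<kappa>" "y \<in> J_set n C \<kappa>" "x \<le> s" "s \<le> y"
  shows "s \<in> J_set n C \<kappa>"
  using assms barrier_quasiconcave[OF n, of x s y] by (auto simp: J_set_barrier)

text \<open>With \<open>\<omega>\<close> expressed through \<open>b\<close>, the term below is half the derivative of \<open>1 - b\<^sup>2 - \<omega>\<^sup>2\<close>.\<close>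

lemma turning_point_simple:
  assumes n: "n \<ge> 3" and nd: "C < C_stat n \<kappa>" "- C < C_stat n (- \<kappa>)"
    and b: "0 < b" "b\<^sup>2 + \<omega>\<^sup>2 = 1" and fi: "b ^ (n - 2) * \<omega> = C + \<kappa> / (real n - 1) * b ^ (n - 1)"
  shows "((real n - 2) * \<omega> / b - \<kappa>) * \<omega> - b \<noteq> 0"
proof
  assume z: "((real n - 2) * \<omega> / b - \<kappa>) * \<omega> - b = 0"
  have "b\<^sup>2 \<le> 1\<^sup>2" using b by (metis le_add_same_cancel1 one_power2 zero_le_power2)
  then have b1: "b \<le> 1" by (rule power2_le_imp_le) simp
  define s where "s = arcsin b"
  have ss: "sin s = b" using b b1 by (simp add: s_def)
  have s: "0 < s" "s \<le> pi / 2"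
    using arcsin_less_arcsin[of 0 b] arcsin_bounded[of b] b b1 by (auto simp: s_def)
  show False
  proof (cases "b = 1")
    case True
    \<comment> \<open>Here \<omega> = 0, and the expression has the value -1.\<close>
    then show False using b z by auto
  next
    case False
    then have s2: "s < pi / 2" using s ss by (cases "s = pi / 2") auto
    have "(cos s)\<^sup>2 = \<omega>\<^sup>2" using b ss sin_cos_squared_add[of s] by simp
    \<comment> \<open>The two signs stand for contact with the barrier of \<kappa> and with that of
      -\<kappa>; each is excluded by its own half of \<open>nd\<close>.\<close>
    then have cases: "\<omega> = cos s \<or> \<omega> = - cos s" by (metis power2_eq_iff)
    have cs: "0 < cos s" using s s2 by (intro cos_gt_zero) auto
    have zb: "(real n - 2) * \<omega>\<^sup>2 - \<kappa> * \<omega> * b - b\<^sup>2 = 0"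
      using z b by (simp add: field_simps power2_eq_square)
    \<comment> \<open>A zero of the slope occurs only at the maximum of the barrier, where contact
      would make C extremal.\<close>
    have *: "False" if "barrier_slope n \<kappa>' s = 0" "C' = barrier n \<kappa>' s" "C' < C_stat n \<kappa>'" for \<kappa>' C'
    proof -
      have "s = s_stat n \<kappa>'"
        using that(1) barrier_slope_sign[OF n s(1) s2, of \<kappa>'] by (metis less_irrefl linorder_neqE_linordered_idom)
      then show False using that by (simp add: C_stat_barrier)
    qed
    from cases show False
    proof
      assume w: "\<omega> = cos s"
      show False
      proof (rule *[OF _ _ nd(1)])
        show "barrier_slope n \<kappa> s = 0"
          using zb unfolding w ss[symmetric] barrier_slope_def by (simp add: algebra_simps)
        show "C = barrier n \<kappa> s" using fi by (simp add: barrier_def L_fun_def ss w mult.commute)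
      qed
    next
      assume w: "\<omega> = - cos s"
      show False
      proof (rule *[OF _ _ nd(2)])
        show "barrier_slope n (- \<kappa>) s = 0"
          using zb unfolding w ss[symmetric] barrier_slope_def by (simp add: algebra_simps)
        show "- C = barrier n (- \<kappa>) s" using fi by (simp add: barrier_def L_fun_def ss w mult.commute)
      qed
    qed
  qed
qed

section \<open>Motion of a profile curve\<close>

text \<open>The mean value theorem on [t, t + 1] gives points tending to infinity at which the
  derivative is an increment of f, and these increments tend to l - l.\<close>

lemma deriv_limit_zero:
  fixes f :: "real \<Rightarrow> real"
  assumes d: "\<And>t. t0 \<le> t \<Longrightarrow> (f has_real_derivative f' t) (at t)"
    and f: "(f \<longlongrightarrow> l) at_top" and f': "(f' \<longlongrightarrow> L) at_top"
  shows "L = 0"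
proof -
  have "\<exists>x. t0 \<le> t \<longrightarrow> t < x \<and> f (t + 1) - f t = f' x" for t
    using MVT2[of t "t + 1" f f'] d by force
  then obtain x where x: "t0 \<le> t \<Longrightarrow> t < x t \<and> f (t + 1) - f t = f' (x t)" for t by metis
  have "filterlim x at_top at_top"
    by (rule filterlim_at_top_mono[OF filterlim_ident])
      (use x in \<open>auto intro!: eventually_at_top_linorderI[of t0] less_imp_le\<close>)
  then have fx: "((\<lambda>t. f' (x t)) \<longlongrightarrow> L) at_top" by (rule filterlim_compose[OF f'])
  have "filterlim (\<lambda>t::real. t + 1) at_top at_top"
    by (rule filterlim_at_top_mono[OF filterlim_ident]) simp
  then have "((\<lambda>t. f (t + 1) - f t) \<longlongrightarrow> l - l) at_top"
    by (intro tendsto_diff f filterlim_compose[OF f])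
  moreover have "eventually (\<lambda>t. f (t + 1) - f t = f' (x t)) at_top"
    using x by (auto intro!: eventually_at_top_linorderI[of t0])
  ultimately have "((\<lambda>t. f' (x t)) \<longlongrightarrow> l - l) at_top"
    by (rule Lim_transform_eventually)
  then have "L = l - l"
    by (rule tendsto_unique[OF trivial_limit_at_top_linorder fx])
  then show ?thesis by simp
qed

lemma increasing_bounded_tendsto_at_top:
  fixes f :: "real \<Rightarrow> real"
  assumes mono: "\<And>s t. t0 \<le> s \<Longrightarrow> s \<le> t \<Longrightarrow> f s \<le> f t" and bd: "\<And>t. t0 \<le> t \<Longrightarrow> f t \<le> M"
  obtains l where "(f \<longlongrightarrow> l) at_top" "\<And>t. t0 \<le> t \<Longrightarrow> f t \<le> l"
proof -
  define l where "l = Sup (f ` {t0..})"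
  have bdd: "bdd_above (f ` {t0..})" using bd by (auto intro!: bdd_aboveI)
  have le: "f t \<le> l" if "t0 \<le> t" for t
    unfolding l_def using that by (intro cSup_upper bdd) auto
  have "(f \<longlongrightarrow> l) at_top"
  proof (rule increasing_tendsto)
    show "\<forall>\<^sub>F t in at_top. f t \<le> l" using le by (auto intro: eventually_at_top_linorderI[of t0])
    fix x assume "x < l"
    then obtain s where s: "t0 \<le> s" "x < f s"
      using less_cSup_iff[OF _ bdd, of x] by (auto simp: l_def)
    then show "\<forall>\<^sub>F t in at_top. x < f t"
      by (intro eventually_at_top_linorderI[of s] less_le_trans[OF s(2) mono[OF s(1)]])
  qed
  then show ?thesis using that le by blast
qed

text \<open>Both ends are handled by the escape property, the left one through the reversed
  trajectory.\<close>

lemma maximal_trajectory_UNIV: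
  assumes M: "maximal_trajectory n \<kappa> J g v" and m: "0 < m" "\<And>t. t \<in> J \<Longrightarrow> m \<le> snd (g t)"
  shows "J = UNIV"
proof -
  have J: "is_interval J" "J \<noteq> {}" using M by (auto simp: maximal_trajectory_def trajectory_def)
  obtain t0 where t0: "t0 \<in> J" using J by auto
  have not_bdd: "\<not> bdd_above J"
  proof
    assume "bdd_above J"
    then obtain t where "t \<in> J" "snd (g t) < m"
      by (rule maximal_trajectory_right_end[OF M _ t0 m(1)])
    then show False using m(2)[of t] by simp
  qed
  have not_bdd': "\<not> bdd_above ((\<lambda>t. - t) ` J)"
  proof
    assume "bdd_above ((\<lambda>t. - t) ` J)"
    then obtain t where "t \<in> (\<lambda>t. - t) ` J" "snd (g (- t)) < m"
      by (rule maximal_trajectory_right_end[OF maximal_trajectory_reverse[OF M] _ _ m(1), of "- t0"])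
        (use t0 in auto)
    then show False using m(2)[of "- t"] by auto
  qed
  have "t \<in> J" for t
  proof -
    obtain y where y: "y \<in> J" "t < y" using not_bdd by (meson bdd_above.I not_le)
    have "\<exists>x\<in>J. x < t"
    proof (rule ccontr)
      assume "\<not> (\<exists>x\<in>J. x < t)"
      then have "bdd_above ((\<lambda>t. - t) ` J)" by (intro bdd_aboveI[of _ "- t"]) auto
      then show False using not_bdd' by simp
    qed
    then obtain x where "x \<in> J" "x < t" by blast
    then show ?thesis using mem_is_interval_1_I[OF J(1), of x y t] y by auto
  qed
  then show ?thesis by auto
qed

lemma vprod_vprod: "vprod p (vprod p v) = (p \<bullet> v) *\<^sub>R p - (p \<bullet> p) *\<^sub>R v"
proof -
  obtain p1 p2 p3 where p: "p = (Complex p1 p2, p3)" by (metis complex.exhaust surj_pair)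
  obtain v1 v2 v3 where v: "v = (Complex v1 v2, v3)" by (metis complex.exhaust surj_pair)
  show ?thesis
    unfolding p v by (intro prod_eqI complex_eqI)
      (simp_all add: vprod_def inner_prod_def inner_complex_def algebra_simps)
qed

locale profile_curve =
  fixes n :: nat and \<kappa> :: real and J :: "real set" and g v :: "real \<Rightarrow> complex \<times> real" and C :: real
  assumes n: "n \<ge> 3" and T: "trajectory n \<kappa> J g v"
    and first_integral: "\<And>t. t \<in> J \<Longrightarrow>
      snd (g t) ^ (n - 2) * snd (vprod (g t) (v t)) = C + \<kappa> / (real n - 1) * snd (g t) ^ (n - 1)"
begin

abbreviation "z t \<equiv> fst (g t)"
abbreviation "b t \<equiv> snd (g t)"
abbreviation "c t \<equiv> snd (v t)"
definition "\<omega> t = snd (vprod (g t) (v t))"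
text \<open>The geodesic curvature of the curve in the 2-sphere, that is, the component of the
  acceleration along \<open>vprod (g t) (v t)\<close>.\<close>

definition "q t = (real n - 2) * \<omega> t / b t - \<kappa>"

lemma J: "open J" "is_interval J" "J \<noteq> {}" using T by (auto simp: trajectory_def)

lemmas unit = trajectoryD(4-6)[OF T] and b_pos = trajectoryD(3)[OF T] and dg = trajectoryD(1)[OF T]

lemma dv: "t \<in> J \<Longrightarrow> (v has_vector_derivative q t *\<^sub>R vprod (g t) (v t) - g t) (at t)"
  using trajectoryD(2)[OF T] by (simp add: q_def \<omega>_def)

lemma db: "t \<in> J \<Longrightarrow> (b has_real_derivative c t) (at t)"
  using has_vector_derivative_snd[OF dg] by (simp add: has_real_derivative_iff_has_vector_derivative)

lemma dc: "t \<in> J \<Longrightarrow> (c has_real_derivative q t * \<omega> t - b t) (at t)"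
  using has_vector_derivative_snd[OF dv]
  by (simp add: has_real_derivative_iff_has_vector_derivative \<omega>_def)

lemma d\<omega>: assumes t: "t \<in> J" shows "(\<omega> has_real_derivative - q t * c t) (at t)"
proof -
  have "(\<omega> has_vector_derivative snd (vprod (g t) (q t *\<^sub>R vprod (g t) (v t) - g t) + vprod (v t) (v t))) (at t)"
    unfolding \<omega>_def
    by (rule has_vector_derivative_snd[OF bounded_bilinear.has_vector_derivative[OF
          bounded_bilinear_vprod dg[OF t] dv[OF t]]])
  moreover have "vprod (g t) (q t *\<^sub>R vprod (g t) (v t) - g t) = - q t *\<^sub>R v t"
    by (simp add: bounded_bilinear.diff_right[OF bounded_bilinear_vprod]
        bounded_bilinear.scaleR_right[OF bounded_bilinear_vprod] vprod_vprod unit[OF t])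
  ultimately show ?thesis by (simp add: has_real_derivative_iff_has_vector_derivative)
qed

text \<open>The numbers c, b and \<omega> are the coordinates of the axis vector (0, 1) in the
  orthonormal frame of velocity, position and their cross product.\<close>

lemma energy: assumes t: "t \<in> J" shows "(c t)\<^sup>2 + (b t)\<^sup>2 + (\<omega> t)\<^sup>2 = 1"
proof -
  define e where "e = ((0, 1) :: complex \<times> real)"
  have "vprod (g t) (v t) \<bullet> vprod (g t) (v t) = 1"
    by (simp add: inner_vprod_vprod unit[OF t])
  moreover have "e \<bullet> p = snd p" for p by (simp add: e_def inner_prod_def)
  ultimately have "e = \<omega> t *\<^sub>R vprod (g t) (v t) + c t *\<^sub>R v t + b t *\<^sub>R g t"
    using vprod_expand[of "g t" "v t" e] by (simp add: unit[OF t] \<omega>_def)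
  from arg_cong[OF this, of snd] show ?thesis
    by (simp add: e_def \<omega>_def power2_eq_square)
qed

lemma cont: "continuous_on J g" "continuous_on J v" "continuous_on J b" "continuous_on J c" "continuous_on J \<omega>"
  by (intro continuous_at_imp_continuous_on ballI has_vector_derivative_continuous[OF dg]
      has_vector_derivative_continuous[OF dv] DERIV_isCont[OF db] DERIV_isCont[OF dc] DERIV_isCont[OF d\<omega>], assumption)+

lemma b_le_1: assumes "t \<in> J" shows "b t \<le> 1"
proof (rule power2_le_imp_le)
  have "0 \<le> (c t)\<^sup>2" "0 \<le> (\<omega> t)\<^sup>2" by auto
  then show "(b t)\<^sup>2 \<le> 1\<^sup>2" unfolding one_power2 using energy[OF assms] by linarith
qed simp

lemma abs_\<omega>_le_1: assumes "t \<in> J" shows "\<bar>\<omega> t\<bar> \<le> 1"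
proof -
  have "0 \<le> (c t)\<^sup>2" "0 \<le> (b t)\<^sup>2" by auto
  then have "(\<omega> t)\<^sup>2 \<le> 1" using energy[OF assms] by linarith
  then show ?thesis by (simp add: abs_square_le_1)
qed

lemma in_J: "s \<in> J \<Longrightarrow> t \<in> J \<Longrightarrow> s \<le> x \<Longrightarrow> x \<le> t \<Longrightarrow> x \<in> J"
  using mem_is_interval_1_I[OF J(2)] by blast

text \<open>As n - 2 \<ge> 1 and b \<le> 1, all powers of b in the first integral are at most b, and
  \<bar>\<omega>\<bar> \<le> 1. Hence a curve with C \<noteq> 0 stays away from the axis.\<close>

lemma b_lower:
  assumes t: "t \<in> J" shows "\<bar>C\<bar> \<le> (1 + \<bar>\<kappa>\<bar>) * b t"
proof -
  have n': "1 \<le> real n - 1" using n by simp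
  have pw: "0 \<le> b t ^ k \<and> (0 < k \<longrightarrow> b t ^ k \<le> b t)" for k
    using b_pos[OF t] b_le_1[OF t] power_decreasing[of 1 k "b t"] by (cases "k = 0") auto
  have "C = b t ^ (n - 2) * \<omega> t - \<kappa> / (real n - 1) * b t ^ (n - 1)"
    using first_integral[OF t] by (simp add: \<omega>_def)
  then have "\<bar>C\<bar> \<le> b t ^ (n - 2) * \<bar>\<omega> t\<bar> + \<bar>\<kappa>\<bar> / (real n - 1) * b t ^ (n - 1)"
    using n' pw[of "n - 2"] pw[of "n - 1"] abs_triangle_ineq4[of "b t ^ (n - 2) * \<omega> t" "\<kappa> / (real n - 1) * b t ^ (n - 1)"]
    by (simp add: abs_mult)
  also have "\<dots> \<le> b t * 1 + \<bar>\<kappa>\<bar> / 1 * b t"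
    using n' n pw b_pos[OF t] abs_\<omega>_le_1[OF t] by (intro add_mono mult_mono divide_left_mono) auto
  finally show ?thesis by (simp add: algebra_simps)
qed

lemma reverse_profile: "profile_curve n (- \<kappa>) ((\<lambda>t. - t) ` J) (\<lambda>t. g (- t)) (\<lambda>t. - v (- t)) (- C)"
proof unfold_locales
  show "trajectory n (- \<kappa>) ((\<lambda>t. - t) ` J) (\<lambda>t. g (- t)) (\<lambda>t. - v (- t))"
    using trajectory_reflect[OF T, of 0] by simp
  fix t assume "t \<in> (\<lambda>t. - t) ` J"
  then have "- t \<in> J" by auto
  from first_integral[OF this]
  show "snd (g (- t)) ^ (n - 2) * snd (vprod (g (- t)) (- v (- t))) =
      - C + - \<kappa> / (real n - 1) * snd (g (- t)) ^ (n - 1)" by simp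
qed (rule n)

end

text \<open>With \<omega>' = - q b', the terms containing \<omega> cancel in the derivative of
  b^(n-2) \<omega>, which leaves \<kappa> b^(n-2) b'.\<close>

lemma trajectory_first_integral:
  assumes n: "n \<ge> 3" and T: "trajectory n \<kappa> J g v"
  obtains C where "profile_curve n \<kappa> J g v C"
proof -
  obtain m where m: "n = m + 3" using n by (metis add.commute le_Suc_ex)
  have e: "n - 2 = Suc m" "n - 1 = Suc (Suc m)" by (auto simp: m)
  define f where "f t = snd (g t) ^ (n - 2) * snd (vprod (g t) (v t)) - \<kappa> / (real n - 1) * snd (g t) ^ (n - 1)" for t
  note D = trajectoryD[OF T]
  have J: "open J" "is_interval J" "J \<noteq> {}" using T by (auto simp: trajectory_def)
  have "(f has_real_derivative 0) (at t)" if t: "t \<in> J" for t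
  proof -
    define q where "q = (real n - 2) * snd (vprod (g t) (v t)) / snd (g t) - \<kappa>"
    have db: "((\<lambda>t. snd (g t)) has_real_derivative snd (v t)) (at t)"
      using has_vector_derivative_snd[OF D(1)[OF t]] by (simp add: has_real_derivative_iff_has_vector_derivative)
    have "((\<lambda>t. snd (vprod (g t) (v t))) has_vector_derivative
        snd (vprod (g t) (q *\<^sub>R vprod (g t) (v t) - g t) + vprod (v t) (v t))) (at t)"
      unfolding q_def
      by (rule has_vector_derivative_snd[OF bounded_bilinear.has_vector_derivative[OF
            bounded_bilinear_vprod D(1)[OF t] D(2)[OF t]]])
    moreover have "vprod (g t) (q *\<^sub>R vprod (g t) (v t) - g t) = - q *\<^sub>R v t"
      by (simp add: bounded_bilinear.diff_right[OF bounded_bilinear_vprod]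
          bounded_bilinear.scaleR_right[OF bounded_bilinear_vprod] vprod_vprod D(4-6)[OF t])
    ultimately have dw: "((\<lambda>t. snd (vprod (g t) (v t))) has_real_derivative - q * snd (v t)) (at t)"
      by (simp add: has_real_derivative_iff_has_vector_derivative)
    have nz: "real m + 2 \<noteq> 0" by linarith
    show ?thesis
      unfolding f_def e
      by (rule derivative_eq_intros db dw refl | rule DERIV_cong)+
        (use nz D(3)[OF t] in \<open>simp add: q_def m field_simps\<close>)
  qed
  then have "\<exists>C. \<forall>x\<in>J. f x = C"
    by (intro has_field_derivative_zero_constant)
      (use J in \<open>auto simp: is_interval_convex intro: has_field_derivative_at_within\<close>)
  then obtain C where "\<And>t. t \<in> J \<Longrightarrow> f t = C" by blast
  then have "profile_curve n \<kappa> J g v C"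
    by unfold_locales (use n T in \<open>auto simp: f_def algebra_simps\<close>)
  then show ?thesis by (rule that)
qed

text \<open>The strict bounds on C exclude the circles s = const, the case in which turning points
  fail to be isolated.\<close>

locale maximal_profile = profile_curve +
  assumes M: "maximal_trajectory n \<kappa> J g v"
    and nd: "C < C_stat n \<kappa>" "- C < C_stat n (- \<kappa>)"
begin

lemma reverse: "maximal_profile n (- \<kappa>) ((\<lambda>t. - t) ` J) (\<lambda>t. g (- t)) (\<lambda>t. - v (- t)) (- C)"
proof -
  interpret R: profile_curve n "- \<kappa>" "(\<lambda>t. - t) ` J" "\<lambda>t. g (- t)" "\<lambda>t. - v (- t)" "- C"
    by (rule reverse_profile)
  show ?thesis
    by unfold_locales (use maximal_trajectory_reverse[OF M] nd in auto)
qed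

lemma turning_nonzero:
  assumes "t \<in> J" "c t = 0" shows "q t * \<omega> t - b t \<noteq> 0"
  using turning_point_simple[OF n nd b_pos[OF assms(1)], of "\<omega> t"] energy[OF assms(1)] assms
    first_integral[OF assms(1)] by (simp add: q_def \<omega>_def)

text \<open>\<sigma> is the direction in which b moves. Without a turning point b would be monotone
  and bounded away from 0, so the trajectory would last forever and b, c and c' would converge. The
  limit would be a degenerate turning point, which does not exist. A falling b could run into the
  axis; for \<sigma> = -1 this is ruled out by C \<noteq> 0.\<close>

lemma turning_right:
  assumes t0: "t0 \<in> J" and \<sigma>: "\<sigma> = 1 \<or> \<sigma> = -1 \<and> C \<noteq> 0" and c0: "0 < \<sigma> * c t0"
  obtains t1 where "t1 \<in> J" "t0 < t1" "c t1 = 0" "\<And>t. t0 \<le> t \<Longrightarrow> t < t1 \<Longrightarrow> 0 < \<sigma> * c t"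
proof -
  have sgn: "0 < \<sigma> * c t" if t: "t \<in> J" "t0 \<le> t" "\<And>s. t0 \<le> s \<Longrightarrow> s \<le> t \<Longrightarrow> c s \<noteq> 0" for t
  proof (rule ccontr)
    assume "\<not> 0 < \<sigma> * c t"
    then have "\<exists>x\<ge>t0. x \<le> t \<and> \<sigma> * c x = 0"
      using c0 t in_J[OF t0 t(1)]
      by (intro IVT2') (auto intro!: continuous_intros continuous_on_subset[OF cont(4)])
    then show False using t(3) c0 by auto
  qed
  have "\<exists>t\<in>J. t0 \<le> t \<and> c t = 0"
  proof (rule ccontr)
    assume "\<not> (\<exists>t\<in>J. t0 \<le> t \<and> c t = 0)"
    then have pos: "0 < \<sigma> * c t" if "t \<in> J" "t0 \<le> t" for t
      using sgn[OF that] in_J[OF t0 that(1)] by blast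
    have mono: "\<sigma> * b s \<le> \<sigma> * b t" if st: "t \<in> J" "t0 \<le> s" "s \<le> t" for s t
    proof (rule DERIV_nonneg_imp_nondecreasing[OF st(3)])
      fix x assume "s \<le> x" "x \<le> t"
      then have x: "x \<in> J" "t0 \<le> x" using in_J[OF t0 st(1)] st by auto
      then show "\<exists>y. ((\<lambda>t. \<sigma> * b t) has_real_derivative y) (at x) \<and> 0 \<le> y"
        using pos[OF x] by (intro exI[of _ "\<sigma> * c x"]) (auto intro!: derivative_eq_intros db)
    qed
    \<comment> \<open>A rising b is bounded below by its initial value, a falling one by the first
      integral.\<close>
    obtain m where m: "0 < m" "\<And>t. t \<in> J \<Longrightarrow> t0 \<le> t \<Longrightarrow> m \<le> b t"
    proof (cases "\<sigma> = 1")
      case True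
      then show ?thesis using that[of "b t0"] mono b_pos[OF t0] by auto
    next
      case False
      then have "C \<noteq> 0" using \<sigma> by auto
      have p: "0 < 1 + \<bar>\<kappa>\<bar>" by simp
      show ?thesis
        using that[of "\<bar>C\<bar> / (1 + \<bar>\<kappa>\<bar>)"] b_lower \<open>C \<noteq> 0\<close> p by (simp add: divide_le_eq mult.commute)
    qed
    have "\<not> bdd_above J"
    proof
      assume "bdd_above J"
      then obtain t where "t \<in> J" "t0 \<le> t" "b t < m"
        by (rule maximal_trajectory_right_end[OF M _ t0 m(1)])
      then show False using m(2)[of t] by simp
    qed
    then have J_ge: "t \<in> J" if "t0 \<le> t" for t
    proof -
      obtain t2 where "t2 \<in> J" "t < t2"
        using \<open>\<not> bdd_above J\<close> by (meson bdd_above.I not_le)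
      then show ?thesis using in_J[OF t0] that by auto
    qed
    obtain B' where B': "((\<lambda>t. \<sigma> * b t) \<longlongrightarrow> B') at_top"
    proof (rule increasing_bounded_tendsto_at_top[of t0 "\<lambda>t. \<sigma> * b t" 1])
      show "\<sigma> * b s \<le> \<sigma> * b t" if "t0 \<le> s" "s \<le> t" for s t
        using mono J_ge that by auto
      show "\<sigma> * b t \<le> 1" if "t0 \<le> t" for t
        using \<sigma> b_le_1[OF J_ge[OF that]] b_pos[OF J_ge[OF that]] by auto
    qed blast
    have ss: "\<sigma> * \<sigma> = 1" using \<sigma> by auto
    define B where "B = \<sigma> * B'"
    have B: "(b \<longlongrightarrow> B) at_top"
      using tendsto_mult_left[OF B', of \<sigma>] ss by (simp add: B_def mult.assoc[symmetric])
    have ev: "\<forall>\<^sub>F t in at_top. t \<in> J \<and> t0 \<le> t" using J_ge by (auto intro: eventually_at_top_linorderI[of t0])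
    have "m \<le> B"
      by (rule tendsto_lowerbound[OF B]) (use ev m(2) in \<open>auto elim: eventually_mono\<close>)
    then have Bpos: "0 < B" using m by simp
    \<comment> \<open>The first integral solved for \<omega> as a function of b, so that convergence
      of b carries over to \<omega>.\<close>
    define W where "W x = (C + \<kappa> / (real n - 1) * x ^ (n - 1)) / x ^ (n - 2)" for x
    have \<omega>W: "\<omega> t = W (b t)" if "t \<in> J" for t
      using first_integral[OF that] b_pos[OF that] by (simp add: W_def \<omega>_def field_simps)
    have "((\<lambda>t. W (b t)) \<longlongrightarrow> W B) at_top"
      unfolding W_def using Bpos by (intro tendsto_intros B) auto
    then have \<omega>: "(\<omega> \<longlongrightarrow> W B) at_top"
      by (rule Lim_transform_eventually) (use ev \<omega>W in \<open>auto elim: eventually_mono\<close>)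
    have "((\<lambda>t. sqrt (1 - (b t)\<^sup>2 - (\<omega> t)\<^sup>2)) \<longlongrightarrow> sqrt (1 - B\<^sup>2 - (W B)\<^sup>2)) at_top"
      by (intro tendsto_intros B \<omega>)
    moreover have "\<forall>\<^sub>F t in at_top. sqrt (1 - (b t)\<^sup>2 - (\<omega> t)\<^sup>2) = \<sigma> * c t"
    proof (rule eventually_mono[OF ev])
      fix t assume t: "t \<in> J \<and> t0 \<le> t"
      have "1 - (b t)\<^sup>2 - (\<omega> t)\<^sup>2 = (\<sigma> * c t)\<^sup>2"
        using energy[of t] t ss by (simp add: power_mult_distrib power2_eq_square[of \<sigma>])
      then show "sqrt (1 - (b t)\<^sup>2 - (\<omega> t)\<^sup>2) = \<sigma> * c t" using pos[of t] t by simp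
    qed
    ultimately have c: "((\<lambda>t. \<sigma> * c t) \<longlongrightarrow> sqrt (1 - B\<^sup>2 - (W B)\<^sup>2)) at_top"
      by (rule Lim_transform_eventually)
    have "sqrt (1 - B\<^sup>2 - (W B)\<^sup>2) = 0"
      by (rule deriv_limit_zero[OF _ B' c, of t0]) (auto intro!: derivative_eq_intros db J_ge)
    then have BW: "B\<^sup>2 + (W B)\<^sup>2 = 1" by simp
    \<comment> \<open>Since c converges, the limit of c' is 0 as well: in the limit velocity and
      acceleration of b vanish together.\<close>
    have "\<sigma> * (((real n - 2) * W B / B - \<kappa>) * W B - B) = 0"
    proof (rule deriv_limit_zero[OF _ c, of t0 "\<lambda>t. \<sigma> * (q t * \<omega> t - b t)"])
      show "((\<lambda>t. \<sigma> * (q t * \<omega> t - b t)) \<longlongrightarrow> \<sigma> * (((real n - 2) * W B / B - \<kappa>) * W B - B)) at_top"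
        unfolding q_def using Bpos by (intro tendsto_intros B \<omega>) auto
      show "((\<lambda>t. \<sigma> * c t) has_real_derivative \<sigma> * (q t * \<omega> t - b t)) (at t)" if "t0 \<le> t" for t
        by (auto intro!: derivative_eq_intros dc J_ge that)
    qed
    moreover have "B ^ (n - 2) * W B = C + \<kappa> / (real n - 1) * B ^ (n - 1)"
      using Bpos by (simp add: W_def)
    ultimately show False
      using turning_point_simple[OF n nd Bpos BW] \<sigma> by auto
  qed
  then obtain t2 where t2: "t2 \<in> J" "t0 \<le> t2" "c t2 = 0" by blast
  \<comment> \<open>The zeros of c up to \<open>t2\<close> form a compact set; its least element is
    the first turning point.\<close>
  define Z where "Z = {t \<in> {t0..t2}. c t = 0}"
  have cc: "continuous_on {t0..t2} c"
    by (rule continuous_on_subset[OF cont(4)]) (use in_J[OF t0 t2(1)] in auto)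
  have "closed Z"
    unfolding Z_def using continuous_closed_preimage_constant[OF cc, of 0] by simp
  moreover have "bounded Z" by (rule bounded_subset[of "{t0..t2}"]) (auto simp: Z_def)
  ultimately have "compact Z" by (simp add: compact_eq_bounded_closed)
  moreover have "Z \<noteq> {}" using t2 by (auto simp: Z_def)
  ultimately obtain t1 where t1: "t1 \<in> Z" "\<And>t. t \<in> Z \<Longrightarrow> t1 \<le> t"
    using compact_attains_inf[of Z] by blast
  show ?thesis
  proof (rule that[of t1])
    have Z1: "t0 \<le> t1" "t1 \<le> t2" "c t1 = 0" using t1(1) by (auto simp: Z_def)
    show "t1 \<in> J" by (rule in_J[OF t0 t2(1) Z1(1,2)])
    show "c t1 = 0" by (rule Z1(3))
    then show "t0 < t1" using Z1(1) c0 by (cases "t0 = t1") auto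
    fix t assume t: "t0 \<le> t" "t < t1"
    then have tJ: "t \<in> J" using Z1(2) by (intro in_J[OF t0 t2(1)]) auto
    show "0 < \<sigma> * c t"
    proof (rule sgn[OF tJ t(1)])
      fix s assume s: "t0 \<le> s" "s \<le> t"
      show "c s \<noteq> 0"
      proof
        assume "c s = 0"
        then have "s \<in> Z" using s t Z1(2) by (simp add: Z_def)
        then show False using t1(2)[of s] s t by simp
      qed
    qed
  qed
qed

text \<open>The same statement for the reversed trajectory, whose velocity is - v; hence the
  opposite sign in the hypothesis.\<close>

lemma turning_left:
  assumes t0: "t0 \<in> J" and \<sigma>: "\<sigma> = 1 \<or> \<sigma> = -1 \<and> C \<noteq> 0" and c0: "\<sigma> * c t0 < 0"
  obtains t1 where "t1 \<in> J" "t1 < t0" "c t1 = 0" "\<And>t. t1 < t \<Longrightarrow> t \<le> t0 \<Longrightarrow> \<sigma> * c t < 0"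
proof -
  interpret R: maximal_profile n "- \<kappa>" "(\<lambda>t. - t) ` J" "\<lambda>t. g (- t)" "\<lambda>t. - v (- t)" "- C" by (rule reverse)
  obtain t1 where t1: "t1 \<in> (\<lambda>t. - t) ` J" "- t0 < t1" "snd (- v (- t1)) = 0"
    "\<And>t. - t0 \<le> t \<Longrightarrow> t < t1 \<Longrightarrow> 0 < \<sigma> * snd (- v (- t))"
    using R.turning_right[of "- t0" \<sigma>] t0 \<sigma> c0 by auto
  show ?thesis
  proof (rule that[of "- t1"])
    fix t assume "- t1 < t" "t \<le> t0"
    then show "\<sigma> * c t < 0" using t1(4)[of "- t"] by simp
  qed (use t1 in auto)
qed

lemma crest:
  obtains t1 \<tau> where "t1 \<in> J" "\<tau> \<in> J" "\<tau> < t1" "c t1 = 0" "\<And>t. \<tau> \<le> t \<Longrightarrow> t < t1 \<Longrightarrow> 0 < c t"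
proof -
  have "\<exists>t\<in>J. c t \<noteq> 0"
  proof (rule ccontr)
    assume "\<not> (\<exists>t\<in>J. c t \<noteq> 0)"
    then have z: "c t = 0" if "t \<in> J" for t using that by blast
    obtain t where t: "t \<in> J" using J by auto
    have "(c has_real_derivative 0) (at t)"
      by (rule has_field_derivative_transform_within_open[of "\<lambda>_. 0" _ _ J]) (use J t z in auto)
    then show False using DERIV_unique[OF dc[OF t]] turning_nonzero[OF t z[OF t]] by simp
  qed
  then obtain \<tau> where \<tau>: "\<tau> \<in> J" "c \<tau> \<noteq> 0" by blast
  show ?thesis
  proof (cases "0 < c \<tau>")
    case True
    then show ?thesis using turning_right[OF \<tau>(1), of 1] that \<tau> by (metis mult_1)
  next
    case False
    then obtain t1 where t1: "t1 \<in> J" "t1 < \<tau>" "c t1 = 0" "\<And>t. t1 < t \<Longrightarrow> t \<le> \<tau> \<Longrightarrow> c t < 0"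
      using turning_left[OF \<tau>(1), of 1] \<tau> by (metis linorder_neqE_linordered_idom mult_1)
    define l where "l = q t1 * \<omega> t1 - b t1"
    \<comment> \<open>A positive derivative of c would make c positive just after \<open>t1\<close>,
      where b is falling. So l < 0, and c is positive just before \<open>t1\<close>.\<close>
    have "\<not> 0 < l"
    proof
      assume "0 < l"
      then obtain d where d: "0 < d" "\<And>h. 0 < h \<Longrightarrow> h < d \<Longrightarrow> c t1 < c (t1 + h)"
        using DERIV_pos_inc_right[OF dc[OF t1(1)]] by (auto simp: l_def)
      define h where "h = min (d / 2) (\<tau> - t1)"
      have "0 < h" "h < d" "t1 < t1 + h" "t1 + h \<le> \<tau>" using d(1) t1(2) by (auto simp: h_def)
      then show False using d(2)[of h] t1(4)[of "t1 + h"] t1(3) by simp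
    qed
    then have "l < 0" using turning_nonzero[OF t1(1,3)] by (simp add: l_def)
    then obtain d where d: "0 < d" "\<And>h. 0 < h \<Longrightarrow> h < d \<Longrightarrow> c t1 < c (t1 - h)"
      using DERIV_neg_dec_left[OF dc[OF t1(1)]] by (auto simp: l_def)
    obtain e where e: "0 < e" "ball t1 e \<subseteq> J" using J(1) t1(1) openE by blast
    define h where "h = min (d / 2) (e / 2)"
    have h: "0 < h" "h < d" "h < e" using d e by (auto simp: h_def)
    show ?thesis
    proof (rule that[OF t1(1) _ _ t1(3), of "t1 - h"])
      show "t1 - h \<in> J" using e h by (auto simp: dist_real_def subset_iff)
      fix t assume "t1 - h \<le> t" "t < t1"
      then show "0 < c t" using d(2)[of "t1 - t"] h t1(3) by simp
    qed (use h in auto)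
  qed
qed

lemma J_UNIV: assumes "C \<noteq> 0" shows "J = UNIV"
proof (rule maximal_trajectory_UNIV[OF M])
  have p: "0 < 1 + \<bar>\<kappa>\<bar>" by simp
  then show "0 < \<bar>C\<bar> / (1 + \<bar>\<kappa>\<bar>)" using assms by simp
  show "\<bar>C\<bar> / (1 + \<bar>\<kappa>\<bar>) \<le> b t" if "t \<in> J" for t
    using b_lower[OF that] p by (simp add: divide_le_eq mult.commute)
qed

end

section \<open>Reflections and the extended curve\<close>

text \<open>On the compact time interval both solutions keep a common positive distance from b = 0,
  so one Lipschitz constant serves for both.\<close>

lemma trajectory_unique_forward:
  assumes T1: "trajectory n \<kappa> J1 g1 v1" and T2: "trajectory n \<kappa> J2 g2 v2"
    and e: "e \<in> J1" "e \<in> J2" and t: "t \<in> J1" "t \<in> J2" "e \<le> t"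
    and eq: "g1 e = g2 e" "v1 e = v2 e"
  shows "g1 t = g2 t \<and> v1 t = v2 t"
proof -
  have lower: "\<exists>m>0. \<forall>s\<in>{e..t}. s \<in> J \<and> m \<le> snd (g s) \<and> norm (g s, v s) \<le> 2"
    if T: "trajectory n \<kappa> J g v" and J: "e \<in> J" "t \<in> J" for J g v
  proof -
    have int: "s \<in> J" if "s \<in> {e..t}" for s
      using mem_is_interval_1_I[of J e t s] T J that by (auto simp: trajectory_def)
    have "continuous_on {e..t} g"
      using int by (intro continuous_at_imp_continuous_on ballI
          has_vector_derivative_continuous[OF trajectoryD(1)[OF T]])
    then have "continuous_on {e..t} (\<lambda>s. snd (g s))" by (intro continuous_intros)
    then obtain s0 where s0: "s0 \<in> {e..t}" "\<And>s. s \<in> {e..t} \<Longrightarrow> snd (g s0) \<le> snd (g s)"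
      using continuous_attains_inf[of "{e..t}" "\<lambda>s. snd (g s)"] t(3) by auto
    have "norm (g s, v s) \<le> 2" if "s \<in> J" for s
      using norm_Pair_le[of "g s" "v s"] trajectoryD(4,5)[OF T that] by (simp add: norm_eq_sqrt_inner)
    then show ?thesis
      using s0 int trajectoryD(3)[OF T int[OF s0(1)]] by blast
  qed
  obtain m1 where m1: "0 < m1" "\<forall>s\<in>{e..t}. s \<in> J1 \<and> m1 \<le> snd (g1 s) \<and> norm (g1 s, v1 s) \<le> 2"
    using lower[OF T1 e(1) t(1)] by blast
  obtain m2 where m2: "0 < m2" "\<forall>s\<in>{e..t}. s \<in> J2 \<and> m2 \<le> snd (g2 s) \<and> norm (g2 s, v2 s) \<le> 2"
    using lower[OF T2 e(2) t(2)] by blast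
  define m where "m = min m1 m2"
  obtain L where L: "L-lipschitz_on {y. m \<le> snd (fst y) \<and> norm y \<le> 2} (profile_field n \<kappa>)"
    using profile_field_lipschitz[of m 2 n \<kappa>] m1 m2 by (auto simp: m_def)
  have "(g1 t, v1 t) = (g2 t, v2 t)"
  proof (rule ode_unique_forward[OF L, of e t "\<lambda>t. (g1 t, v1 t)" "\<lambda>t. (g2 t, v2 t)"])
    fix s assume s: "s \<in> {e..t}"
    show "((\<lambda>t. (g1 t, v1 t)) has_vector_derivative profile_field n \<kappa> (g1 s, v1 s)) (at s) \<and>
        (g1 s, v1 s) \<in> {y. m \<le> snd (fst y) \<and> norm y \<le> 2}"
      using T1 m1 s by (auto simp: trajectory_def m_def min_le_iff_disj)
    show "((\<lambda>t. (g2 t, v2 t)) has_vector_derivative profile_field n \<kappa> (g2 s, v2 s)) (at s) \<and>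
        (g2 s, v2 s) \<in> {y. m \<le> snd (fst y) \<and> norm y \<le> 2}"
      using T2 m2 s by (auto simp: trajectory_def m_def min_le_iff_disj)
  qed (use eq t in auto)
  then show ?thesis by simp
qed

lemma trajectory_unique:
  assumes T: "trajectory n \<kappa> J1 g1 v1" "trajectory n \<kappa> J2 g2 v2"
    and e: "e \<in> J1" "e \<in> J2" and t: "t \<in> J1" "t \<in> J2"
    and eq: "g1 e = g2 e" "v1 e = v2 e"
  shows "g1 t = g2 t \<and> v1 t = v2 t"
proof (cases "e \<le> t")
  case True
  then show ?thesis by (rule trajectory_unique_forward[OF T e t _ eq])
next
  case False
  have "g1 (0 - (- t)) = g2 (0 - (- t)) \<and> - v1 (0 - (- t)) = - v2 (0 - (- t))"
    by (rule trajectory_unique_forward[OF trajectory_reflect[OF T(1)] trajectory_reflect[OF T(2)], of "- e"])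
      (use e t eq False in auto)
  then show ?thesis by simp
qed

lemma bounded_linear_reflect_phase: "bounded_linear (reflect_phase \<zeta>)"
  unfolding reflect_phase_def
  by (intro bounded_linear_Pair bounded_linear_const_mult bounded_linear_compose[OF bounded_linear_cnj]
      bounded_linear_fst bounded_linear_snd)

lemma inner_reflect_phase:
  assumes "norm \<zeta> = 1" shows "reflect_phase \<zeta> p \<bullet> reflect_phase \<zeta> w = p \<bullet> w"
proof -
  have "\<zeta> * cnj \<zeta> = 1" using assms by (simp add: complex_norm_square[symmetric])
  have ic: "x \<bullet> y = Re (x * cnj y)" for x y :: complex by (simp add: inner_complex_def)
  have "(\<zeta> * cnj (fst p)) * cnj (\<zeta> * cnj (fst w)) = (\<zeta> * cnj \<zeta>) * cnj (fst p * cnj (fst w))"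
    by (simp only: complex_cnj_mult complex_cnj_cnj mult_ac)
  also have "\<dots> = cnj (fst p * cnj (fst w))"
    unfolding \<open>\<zeta> * cnj \<zeta> = 1\<close> by (rule mult_1)
  finally have "Re ((\<zeta> * cnj (fst p)) * cnj (\<zeta> * cnj (fst w))) = Re (fst p * cnj (fst w))"
    by (metis cnj.sel(1))
  then show ?thesis
    unfolding reflect_phase_def inner_prod_def ic fst_conv snd_conv by (rule arg_cong)
qed

text \<open>The reflection reverses the orientation of \<complex> \<oplus> \<real>, hence the
  sign.\<close>

lemma vprod_reflect_phase:
  assumes "norm \<zeta> = 1" shows "vprod (reflect_phase \<zeta> p) (reflect_phase \<zeta> w) = - reflect_phase \<zeta> (vprod p w)"
proof -
  have z: "\<zeta> * cnj \<zeta> = 1" using assms by (simp add: complex_norm_square[symmetric])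
  have "cnj (\<zeta> * cnj (fst p)) * (\<zeta> * cnj (fst w)) = (\<zeta> * cnj \<zeta>) * cnj (cnj (fst p) * fst w)"
    by (simp only: complex_cnj_mult complex_cnj_cnj mult_ac)
  also have "\<dots> = cnj (cnj (fst p) * fst w)" unfolding z by (rule mult_1)
  finally have "Im (cnj (\<zeta> * cnj (fst p)) * (\<zeta> * cnj (fst w))) = - Im (cnj (fst p) * fst w)"
    by (metis cnj.sel(2))
  moreover have "\<i> * (of_real (snd p) * (\<zeta> * cnj (fst w)) - of_real (snd w) * (\<zeta> * cnj (fst p))) =
      - (\<zeta> * cnj (\<i> * (of_real (snd p) * fst w - of_real (snd w) * fst p)))"
    by (simp add: algebra_simps)
  ultimately show ?thesis
    unfolding vprod_def reflect_phase_def fst_conv snd_conv by simp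
qed

lemma trajectory_reflect_phase:
  assumes T: "trajectory n \<kappa> J g v" and \<zeta>: "norm \<zeta> = 1"
  shows "trajectory n (- \<kappa>) J (\<lambda>t. reflect_phase \<zeta> (g t)) (\<lambda>t. reflect_phase \<zeta> (v t))"
proof (rule trajectoryI)
  interpret R: bounded_linear "reflect_phase \<zeta>" by (rule bounded_linear_reflect_phase)
  fix t assume t: "t \<in> J"
  note D = trajectoryD[OF T t]
  show "((\<lambda>t. reflect_phase \<zeta> (g t)) has_vector_derivative reflect_phase \<zeta> (v t)) (at t)"
    by (rule R.has_vector_derivative[OF D(1)])
  define a where "a = (real n - 2) * snd (vprod (g t) (v t)) / snd (g t)"
  have s: "snd (reflect_phase \<zeta> p) = snd p" for p by (simp add: reflect_phase_def)
  have "((\<lambda>t. reflect_phase \<zeta> (v t)) has_vector_derivative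
      reflect_phase \<zeta> ((a - \<kappa>) *\<^sub>R vprod (g t) (v t) - g t)) (at t)"
    unfolding a_def by (rule R.has_vector_derivative[OF D(2)])
  also have "reflect_phase \<zeta> ((a - \<kappa>) *\<^sub>R vprod (g t) (v t) - g t) =
      (- a - (- \<kappa>)) *\<^sub>R (- reflect_phase \<zeta> (vprod (g t) (v t))) - reflect_phase \<zeta> (g t)"
    by (simp add: R.diff R.add R.scaleR algebra_simps)
  finally show "((\<lambda>t. reflect_phase \<zeta> (v t)) has_vector_derivative
      ((real n - 2) * snd (vprod (reflect_phase \<zeta> (g t)) (reflect_phase \<zeta> (v t)))
        / snd (reflect_phase \<zeta> (g t)) - (- \<kappa>)) *\<^sub>R vprod (reflect_phase \<zeta> (g t)) (reflect_phase \<zeta> (v t))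
        - reflect_phase \<zeta> (g t)) (at t)"
    unfolding vprod_reflect_phase[OF \<zeta>] s by (simp add: a_def s)
  show "0 < snd (reflect_phase \<zeta> (g t)) \<and> reflect_phase \<zeta> (g t) \<bullet> reflect_phase \<zeta> (g t) = 1 \<and>
      reflect_phase \<zeta> (v t) \<bullet> reflect_phase \<zeta> (v t) = 1 \<and> reflect_phase \<zeta> (g t) \<bullet> reflect_phase \<zeta> (v t) = 0"
    using D(3-6) by (simp add: inner_reflect_phase[OF \<zeta>] s)
qed (use T in \<open>auto simp: trajectory_def\<close>)

text \<open>Used at the point (0, 1), where z vanishes: its direction nearby is read off from its
  derivative.\<close>

lemma has_vector_derivative_quotient:
  fixes f :: "real \<Rightarrow> complex"
  assumes "(f has_vector_derivative d) (at e)" "f e = 0"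
  shows "((\<lambda>x. f x / of_real (x - e)) \<longlongrightarrow> d) (at e)"
proof -
  have "((\<lambda>x. Re (f x) / (x - e)) \<longlongrightarrow> Re d) (at e)" "((\<lambda>x. Im (f x) / (x - e)) \<longlongrightarrow> Im d) (at e)"
    using bounded_linear.has_vector_derivative[OF bounded_linear_Re assms(1)]
      bounded_linear.has_vector_derivative[OF bounded_linear_Im assms(1)] assms(2)
    by (auto simp: has_real_derivative_iff_has_vector_derivative[symmetric] has_field_derivative_iff)
  then have "((\<lambda>x. Complex (Re (f x) / (x - e)) (Im (f x) / (x - e))) \<longlongrightarrow> Complex (Re d) (Im d)) (at e)"
    by (rule tendsto_Complex)
  moreover have "Complex (Re (f x) / (x - e)) (Im (f x) / (x - e)) = f x / of_real (x - e)" for x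
    by (simp add: complex_eq_iff Re_divide_of_real Im_divide_of_real)
  ultimately show ?thesis by simp
qed

section \<open>Symmetry about turning points and behaviour at the point (0, 1)\<close>

context profile_curve
begin

text \<open>The factor \<zeta> for which \<open>reflect_phase \<zeta>\<close> fixes the turning
  point and reverses the velocity there. Off (0, 1) the reflection fixes the line of z; at (0, 1) it
  has to reverse the horizontal unit velocity V, and indeed - V^2 times the conjugate of V is -
  V.\<close>

definition mirror :: "real \<Rightarrow> complex" where
  "mirror e = (if z e = 0 then - (fst (v e))\<^sup>2 else (sgn (z e))\<^sup>2)"

lemma norm_z: assumes "t \<in> J" shows "(norm (z t))\<^sup>2 = 1 - (b t)\<^sup>2"
  using unit(1)[OF assms] by (simp add: inner_prod_def dot_square_norm power2_eq_square)

lemma z_inner: assumes "t \<in> J" shows "Re (cnj (z t) * fst (v t)) = - b t * c t"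
  using unit(3)[OF assms] by (simp add: inner_prod_def inner_complex_def)

lemma \<omega>_Im: "\<omega> t = Im (cnj (z t) * fst (v t))"
  by (simp add: \<omega>_def vprod_def)

lemma mirror:
  assumes e: "e \<in> J" "c e = 0"
  shows "norm (mirror e) = 1" "reflect_phase (mirror e) (g e) = g e" "reflect_phase (mirror e) (v e) = - v e"
proof -
  have v1: "norm (fst (v e)) = 1"
    using unit(2)[OF e(1)] e(2) by (simp add: inner_prod_def dot_square_norm power2_eq_1_iff)
      (metis abs_norm_cancel abs_minus_cancel abs_one)
  show "norm (mirror e) = 1"
    by (simp add: mirror_def norm_power v1 norm_sgn)
  have zz: "mirror e * cnj (z e) = z e"
  proof (cases "z e = 0")
    case False
    have "(sgn (z e))\<^sup>2 * cnj (z e) = (sgn (z e) * sgn (z e)) * cnj (z e)" by (simp add: power2_eq_square)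
    also have "\<dots> = z e * (z e * cnj (z e)) / (of_real (norm (z e)))\<^sup>2"
      by (simp add: sgn_eq power2_eq_square)
    also have "\<dots> = z e"
      unfolding of_real_power[symmetric] complex_norm_square using False by simp
    finally show ?thesis using False by (simp add: mirror_def)
  qed simp
  then show "reflect_phase (mirror e) (g e) = g e"
    by (simp add: reflect_phase_def prod_eq_iff)
  have "mirror e * cnj (fst (v e)) = - fst (v e)"
  proof (cases "z e = 0")
    case True
    have "fst (v e) * cnj (fst (v e)) = 1" using v1 by (simp add: complex_norm_square[symmetric])
    then have "(fst (v e))\<^sup>2 * cnj (fst (v e)) = fst (v e)" by (simp add: power2_eq_square mult.assoc)
    then show ?thesis using True by (simp add: mirror_def)
  next
    case False
    \<comment> \<open>At a turning point the horizontal velocity is perpendicular to z, so the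
      reflection that fixes z reverses it.\<close>
    have "Re (cnj (z e) * fst (v e)) = 0" using z_inner[OF e(1)] e(2) by simp
    then have "cnj (z e) * fst (v e) = - cnj (cnj (z e) * fst (v e))" by (simp add: complex_eq_iff)
    then have i: "z e * cnj (fst (v e)) = - (cnj (z e) * fst (v e))" by simp
    have "cnj (z e) * (mirror e * cnj (fst (v e))) = (mirror e * cnj (z e)) * cnj (fst (v e))" by simp
    also have "\<dots> = cnj (z e) * - fst (v e)" unfolding zz i by simp
    finally show ?thesis using False by (metis complex_cnj_zero_iff mult_cancel_left)
  qed
  then show "reflect_phase (mirror e) (v e) = - v e"
    using e(2) by (simp add: reflect_phase_def prod_eq_iff)
qed

lemma mirror_symmetry:
  assumes e: "e \<in> J" "c e = 0" and t: "t \<in> J" "2 * e - t \<in> J"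
  shows "g (2 * e - t) = reflect_phase (mirror e) (g t)" "v (2 * e - t) = - reflect_phase (mirror e) (v t)"
proof -
  let ?R = "reflect_phase (mirror e)"
  interpret R: bounded_linear ?R by (rule bounded_linear_reflect_phase)
  note m = mirror[OF e]
  \<comment> \<open>Reversal of time and reflection each change the sign of \<kappa>, so the
    composite solves the original equation, with the same data at e.\<close>
  have "trajectory n (- (- \<kappa>)) ((\<lambda>t. 2 * e - t) ` J) (\<lambda>t. ?R (g (2 * e - t))) (\<lambda>t. ?R (- v (2 * e - t)))"
    by (rule trajectory_reflect_phase[OF trajectory_reflect[OF T] m(1)])
  then have "?R (g (2 * e - (2 * e - t))) = g (2 * e - t) \<and> ?R (- v (2 * e - (2 * e - t))) = v (2 * e - t)"
    using trajectory_unique[OF _ T, of "(\<lambda>t. 2 * e - t) ` J" "\<lambda>t. ?R (g (2 * e - t))" "\<lambda>t. ?R (- v (2 * e - t))" e "2 * e - t"]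
      e t m by (force simp: linear_neg[OF R.linear] image_iff)
  then show "g (2 * e - t) = ?R (g t)" "v (2 * e - t) = - ?R (v t)" by (auto simp: linear_neg[OF R.linear])
qed

lemma mirror_components:
  assumes e: "e \<in> J" "c e = 0" and t: "t \<in> J" "2 * e - t \<in> J"
  shows "b (2 * e - t) = b t" "c (2 * e - t) = - c t" "\<omega> (2 * e - t) = \<omega> t"
proof -
  note s = mirror_symmetry[OF e t]
  show "b (2 * e - t) = b t" "c (2 * e - t) = - c t" by (simp_all add: s reflect_phase_def)
  show "\<omega> (2 * e - t) = \<omega> t"
    unfolding \<omega>_def s by (simp add: vprod_reflect_phase[OF mirror(1)[OF e]]) (simp add: reflect_phase_def)
qed

text \<open>The absolute speed of the latitude s = arcsin b, equal to \<bar>c\<bar> / sqrt (1 - b^2)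
  for b < 1. The latter quotient would evaluate to 0 at (0, 1), where the true limit is 1; the form
  with \<omega> is also visibly invariant under the mirror symmetry.\<close>

definition "speed t = sqrt (1 - (\<omega> t)\<^sup>2 / (1 - (b t)\<^sup>2))"

lemma one_minus_b: assumes "t \<in> J" "b t < 1" shows "0 < 1 - (b t)\<^sup>2"
  using b_pos[OF assms(1)] assms(2) by (simp add: power_less_one_iff abs_square_less_1)

lemma b_less_1: assumes "t \<in> J" "c t \<noteq> 0" shows "b t < 1"
proof (rule ccontr)
  assume "\<not> b t < 1"
  then have "b t = 1" using b_le_1[OF assms(1)] by simp
  then have "(c t)\<^sup>2 + (\<omega> t)\<^sup>2 = 0" using energy[OF assms(1)] by simp
  then show False using assms(2) by (simp add: add_nonneg_eq_0_iff)
qed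

lemma speed_eq: assumes t: "t \<in> J" "b t < 1" shows "speed t = \<bar>c t\<bar> / sqrt (1 - (b t)\<^sup>2)"
proof -
  have "1 - (\<omega> t)\<^sup>2 / (1 - (b t)\<^sup>2) = (c t)\<^sup>2 / (1 - (b t)\<^sup>2)"
    using energy[OF t(1)] one_minus_b[OF t] by (simp add: field_simps)
  then show ?thesis by (simp add: speed_def real_sqrt_divide)
qed

lemma speed_nonneg: assumes t: "t \<in> J" shows "0 \<le> speed t"
proof (cases "b t < 1")
  case True
  then show ?thesis using speed_eq[OF t] one_minus_b[OF t] by (simp add: less_imp_le)
next
  case False
  then have "b t = 1" using b_le_1[OF t] by simp
  then show ?thesis by (simp add: speed_def)
qed

text \<open>At the point \<open>(0, 1)\<close> the quotient in \<open>speed\<close> has the junk value \<open>0 / 0 = 0\<close>, which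
  happens to be its limit.\<close>

lemma speed_isCont: assumes e: "e \<in> J" shows "isCont speed e"
proof (cases "b e < 1")
  case True
  have "isCont g e" "isCont \<omega> e"
    using has_vector_derivative_continuous[OF dg[OF e]] DERIV_isCont[OF d\<omega>[OF e]] by auto
  then show ?thesis
    unfolding speed_def[abs_def] using one_minus_b[OF e True] by (intro continuous_intros) auto
next
  case False
  then have b1: "b e = 1" using b_le_1[OF e] by simp
  then have z0: "z e = 0" using norm_z[OF e] by simp
  have c0: "c e = 0" using b_less_1[OF e] False by blast
  define V where "V = fst (v e)"
  have V: "norm V = 1"
    using unit(2)[OF e] c0 by (simp add: V_def inner_prod_def dot_square_norm power2_eq_1_iff)
      (metis abs_norm_cancel abs_minus_cancel abs_one)
  \<comment> \<open>z has a simple zero with derivative V; dividing it by x - e makes numerator and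
    denominator converge. The limit of the numerator is 0, because the product of V with its
    conjugate is real.\<close>
  define u where "u x = z x / of_real (x - e)" for x
  have "(z has_vector_derivative V) (at e)"
    unfolding V_def by (rule has_vector_derivative_fst[OF dg[OF e]])
  then have u: "(u \<longlongrightarrow> V) (at e)"
    unfolding u_def[abs_def] using z0 by (rule has_vector_derivative_quotient)
  have "((\<lambda>x. fst (v x)) \<longlongrightarrow> V) (at e)"
    using has_vector_derivative_continuous[OF dv[OF e]] unfolding V_def isCont_def by (intro tendsto_intros)
  then have "((\<lambda>x. (Im (cnj (u x) * fst (v x)))\<^sup>2 / (norm (u x))\<^sup>2) \<longlongrightarrow> (Im (cnj V * V))\<^sup>2 / (norm V)\<^sup>2) (at e)"
    using V by (intro tendsto_intros u) auto
  moreover have "\<forall>\<^sub>F x in at e. (Im (cnj (u x) * fst (v x)))\<^sup>2 / (norm (u x))\<^sup>2 = (\<omega> x)\<^sup>2 / (1 - (b x)\<^sup>2)"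
    unfolding eventually_at_topological
  proof (intro exI conjI ballI impI)
    fix x assume x: "x \<in> J" "x \<noteq> e"
    have "cnj (u x) * fst (v x) = (cnj (z x) * fst (v x)) / of_real (x - e)"
      by (simp add: u_def del: of_real_diff)
    then have "Im (cnj (u x) * fst (v x)) = \<omega> x / (x - e)"
      by (simp only: \<omega>_Im Im_divide_of_real)
    moreover have "norm (u x) = norm (z x) / \<bar>x - e\<bar>"
      by (simp only: u_def norm_divide norm_of_real)
    ultimately show "(Im (cnj (u x) * fst (v x)))\<^sup>2 / (norm (u x))\<^sup>2 = (\<omega> x)\<^sup>2 / (1 - (b x)\<^sup>2)"
      unfolding norm_z[OF x(1), symmetric] using x(2) by (simp only: power_divide power2_abs) simp
  qed (use J e in auto)
  ultimately have "((\<lambda>x. (\<omega> x)\<^sup>2 / (1 - (b x)\<^sup>2)) \<longlongrightarrow> (Im (cnj V * V))\<^sup>2 / (norm V)\<^sup>2) (at e)"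
    by (rule Lim_transform_eventually)
  then have "((\<lambda>x. (\<omega> x)\<^sup>2 / (1 - (b x)\<^sup>2)) \<longlongrightarrow> 0) (at e)" by simp
  then have "((\<lambda>x. sqrt (1 - (\<omega> x)\<^sup>2 / (1 - (b x)\<^sup>2))) \<longlongrightarrow> sqrt (1 - 0)) (at e)"
    by (intro tendsto_intros)
  then show ?thesis by (simp add: isCont_def speed_def[abs_def] b1)
qed

text \<open>Off (0, 1) the phase is continuous. At (0, 1) z is close to (t - e) V, so from the left
  its phase tends to that of - V, and \<open>mirror e\<close> = - V^2 accounts for the extra minus
  sign.\<close>

lemma sgn_limit:
  assumes e: "e \<in> J" "c e = 0"
  obtains \<theta> where "((\<lambda>t. sgn (z t)) \<longlongrightarrow> cis \<theta>) (at_left e)"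
    "mirror e = (if g e = (0, 1) then - cis (2 * \<theta>) else cis (2 * \<theta>))"
proof (cases "z e = 0")
  case False
  have "norm (sgn (z e)) = 1" using False by (simp add: norm_sgn)
  then obtain \<theta> where \<theta>: "sgn (z e) = cis \<theta>" by (metis cis_Arg norm_eq_zero sgn_eq sgn_sgn zero_neq_one)
  have "isCont z e"
    using has_vector_derivative_continuous[OF has_vector_derivative_fst[OF dg[OF e(1)]]] .
  then have "((\<lambda>t. sgn (z t)) \<longlongrightarrow> cis \<theta>) (at e)"
    unfolding \<theta>[symmetric] isCont_def using False by (intro tendsto_sgn)
  then have "((\<lambda>t. sgn (z t)) \<longlongrightarrow> cis \<theta>) (at_left e)"
    by (rule tendsto_mono[OF at_le[OF subset_UNIV]])
  moreover have "g e \<noteq> (0, 1)" using False by auto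
  ultimately show ?thesis
    using that[of \<theta>] False by (simp add: mirror_def \<theta> Complex.DeMoivre)
next
  case True
  then have b1: "b e = 1" using norm_z[OF e(1)] b_pos[OF e(1)] by (simp add: power2_eq_1_iff)
  define V where "V = fst (v e)"
  have V: "norm V = 1"
    using unit(2)[OF e(1)] e(2) by (simp add: V_def inner_prod_def dot_square_norm power2_eq_1_iff)
      (metis abs_norm_cancel abs_minus_cancel abs_one)
  then have "norm (- V) = 1" by simp
  then obtain \<theta> where \<theta>: "- V = cis \<theta>" by (metis cis_Arg norm_eq_zero sgn_eq div_by_1 of_real_1 zero_neq_one)
  have "((\<lambda>x. z x / of_real (x - e)) \<longlongrightarrow> V) (at e)"
    unfolding V_def using True by (intro has_vector_derivative_quotient has_vector_derivative_fst[OF dg[OF e(1)]])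
  then have lim: "((\<lambda>x. - sgn (z x / of_real (x - e))) \<longlongrightarrow> - sgn V) (at e)"
    using V by (intro tendsto_minus tendsto_sgn) auto
  have "- sgn V = cis \<theta>" using V \<theta> by (simp add: sgn_eq)
  then have "((\<lambda>x. - sgn (z x / of_real (x - e))) \<longlongrightarrow> cis \<theta>) (at_left e)"
    using tendsto_mono[OF at_le[OF subset_UNIV] lim] by simp
  moreover have "\<forall>\<^sub>F x in at_left e. - sgn (z x / of_real (x - e)) = sgn (z x)"
    unfolding eventually_at_filter
  proof (intro always_eventually allI impI)
    fix x assume "x \<noteq> e" "x \<in> {..<e}"
    then have "sgn (complex_of_real (x - e)) = -1" by (simp add: sgn_of_real del: of_real_diff)
    then have "sgn (z x / of_real (x - e)) = sgn (z x) / -1" by (metis sgn_divide)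
    then show "- sgn (z x / of_real (x - e)) = sgn (z x)" by simp
  qed
  ultimately have "((\<lambda>t. sgn (z t)) \<longlongrightarrow> cis \<theta>) (at_left e)"
    by (rule Lim_transform_eventually)
  moreover have "g e = (0, 1)" using True b1 by (simp add: prod_eq_iff)
  moreover have "(fst (v e))\<^sup>2 = cis (2 * \<theta>)"
    using \<theta> by (metis Complex.DeMoivre V_def of_nat_numeral power2_minus)
  ultimately show ?thesis using that[of \<theta>] True by (simp add: mirror_def)
qed

lemma arcsin_b: assumes "t \<in> J"
  shows "sin (arcsin (b t)) = b t" "cos (arcsin (b t)) = sqrt (1 - (b t)\<^sup>2)" "0 < arcsin (b t)" "arcsin (b t) \<le> pi / 2"
  using b_pos[OF assms] b_le_1[OF assms] arcsin_less_arcsin[of 0 "b t"] arcsin_bounded[of "b t"]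
  by (auto intro: cos_arcsin)

lemma R_fun_arcsin: assumes "t \<in> J"
  shows "R_fun n (arcsin (b t)) C \<kappa> = b t ^ (n - 2) * \<omega> t"
  using first_integral[OF assms] by (simp add: R_fun_def arcsin_b[OF assms] \<omega>_def)

end

text \<open>\<phi> accumulates \<bar>ds\<bar> along the curve. The normalization at the maximum
  \<open>t1\<close> of b makes it agree with s on the rising piece before \<open>t1\<close>, which
  is where the model carries the local curve.\<close>

locale angle_profile = maximal_profile +
  fixes \<phi> :: "real \<Rightarrow> real" and t1 :: real
  assumes d\<phi>: "\<And>t. t \<in> J \<Longrightarrow> (\<phi> has_real_derivative speed t) (at t)"
    and t1: "t1 \<in> J" "c t1 = 0" and \<phi>1: "\<phi> t1 = arcsin (b t1)"
    and rising: "\<exists>\<tau>\<in>J. \<tau> < t1 \<and> (\<forall>t. \<tau> \<le> t \<longrightarrow> t < t1 \<longrightarrow> 0 < c t)"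

lemma (in maximal_profile) angle_exists:
  obtains \<phi> t1 where "angle_profile n \<kappa> J g v C \<phi> t1"
proof -
  obtain t1 \<tau> where t1: "t1 \<in> J" "\<tau> \<in> J" "\<tau> < t1" "c t1 = 0" "\<And>t. \<tau> \<le> t \<Longrightarrow> t < t1 \<Longrightarrow> 0 < c t"
    using crest by blast
  have "continuous_on J speed" by (intro continuous_at_imp_continuous_on ballI speed_isCont)
  then obtain F where F: "\<And>t. t \<in> J \<Longrightarrow> (F has_real_derivative speed t) (at t)"
    using open_interval_antiderivative[OF J(1,2)] by blast
  have "angle_profile n \<kappa> J g v C (\<lambda>t. F t - F t1 + arcsin (b t1)) t1"
  proof unfold_locales
    show "((\<lambda>t. F t - F t1 + arcsin (b t1)) has_real_derivative speed t) (at t)" if "t \<in> J" for t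
      using F[OF that] by (auto intro!: derivative_eq_intros)
    show "\<exists>\<tau>\<in>J. \<tau> < t1 \<and> (\<forall>t. \<tau> \<le> t \<longrightarrow> t < t1 \<longrightarrow> 0 < c t)"
      using t1 by blast
  qed (use t1 in auto)
  then show ?thesis by (rule that)
qed

section \<open>The accumulated latitude as parameter of the model curve\<close>

context angle_profile
begin

text \<open>If \<phi> were constant on an interval, then c would vanish there, and with it c'; this
  contradicts the simplicity of turning points.\<close>

lemma \<phi>_less: assumes xy: "x \<in> J" "y \<in> J" "x < y" shows "\<phi> x < \<phi> y"
proof -
  have int: "t \<in> J" if "x \<le> t" "t \<le> y" for t using in_J[OF xy(1,2) that] .
  have mono: "\<phi> s \<le> \<phi> t" if st: "x \<le> s" "s \<le> t" "t \<le> y" for s t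
  proof (rule DERIV_nonneg_imp_nondecreasing[OF st(2)])
    fix r assume "s \<le> r" "r \<le> t"
    then have "r \<in> J" using int st by auto
    then show "\<exists>d. (\<phi> has_real_derivative d) (at r) \<and> 0 \<le> d" using d\<phi> speed_nonneg by blast
  qed
  have "\<phi> x \<noteq> \<phi> y"
  proof
    assume eq: "\<phi> x = \<phi> y"
    have const: "\<phi> s = \<phi> x" if "s \<in> {x<..<y}" for s
      using mono[of x s] mono[of s y] that eq by auto
    have c0: "c t = 0" if t: "t \<in> {x<..<y}" for t
    proof (rule ccontr)
      assume "c t \<noteq> 0"
      have tJ: "t \<in> J" using int t by auto
      have "(\<phi> has_real_derivative 0) (at t)"
      proof (rule has_field_derivative_transform_within_open[OF DERIV_const])
        show "\<phi> x = \<phi> s" if "s \<in> {x<..<y}" for s by (rule const[OF that, symmetric])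
      qed (use t in auto)
      then have "speed t = 0" using DERIV_unique[OF d\<phi>[OF tJ]] by simp
      moreover have "b t < 1" by (rule b_less_1[OF tJ \<open>c t \<noteq> 0\<close>])
      ultimately show False
        using speed_eq[OF tJ] one_minus_b[OF tJ] \<open>c t \<noteq> 0\<close> by simp
    qed
    define t where "t = (x + y) / 2"
    have t: "t \<in> {x<..<y}" using xy(3) by (auto simp: t_def field_simps)
    then have tJ: "t \<in> J" using int by auto
    have "(c has_real_derivative 0) (at t)"
    proof (rule has_field_derivative_transform_within_open[OF DERIV_const])
      show "0 = c s" if "s \<in> {x<..<y}" for s by (rule c0[OF that, symmetric])
    qed (use t in auto)
    then show False
      using DERIV_unique[OF dc[OF tJ]] turning_nonzero[OF tJ c0[OF t]] by simp
  qed
  then show ?thesis using mono[of x y] xy by auto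
qed

lemma \<phi>_less_iff: assumes "x \<in> J" "y \<in> J" shows "\<phi> x < \<phi> y \<longleftrightarrow> x < y"
  using \<phi>_less[OF assms] \<phi>_less[OF assms(2,1)] by (cases x y rule: linorder_cases) auto

lemma continuous_\<phi>: "continuous_on J \<phi>"
  by (intro continuous_at_imp_continuous_on ballI DERIV_isCont[OF d\<phi>])

lemma \<phi>_arcsin:
  assumes t: "t \<in> J" "t \<le> t1" and pos: "\<And>s. t < s \<Longrightarrow> s < t1 \<Longrightarrow> 0 < c s"
  shows "\<phi> t = arcsin (b t)"
proof (cases "t = t1")
  case False
  then have lt: "t < t1" using t by simp
  have int: "s \<in> J" if "t \<le> s" "s \<le> t1" for s using in_J[OF t(1) t1(1) that] .
  have bb: "-1 \<le> b s \<and> b s \<le> 1" if "s \<in> J" for s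
    using b_pos[OF that] b_le_1[OF that] by auto
  have "\<phi> t1 - arcsin (b t1) = \<phi> t - arcsin (b t)"
  proof (rule DERIV_isconst_end[OF lt])
    show "continuous_on {t..t1} (\<lambda>s. \<phi> s - arcsin (b s))"
      using int bb
      by (intro continuous_intros continuous_on_subset[OF continuous_\<phi>] continuous_on_subset[OF cont(1)]) auto
    fix s assume s: "t < s" "s < t1"
    then have sJ: "s \<in> J" using int by auto
    have cs: "0 < c s" by (rule pos[OF s])
    then have b1: "b s < 1" using b_less_1[OF sJ] by simp
    have "((\<lambda>s. arcsin (b s)) has_real_derivative inverse (sqrt (1 - (b s)\<^sup>2)) * c s) (at s)"
      using b_pos[OF sJ] b1 by (intro DERIV_chain2[OF DERIV_arcsin db[OF sJ]]) auto
    moreover have "speed s = inverse (sqrt (1 - (b s)\<^sup>2)) * c s"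
      using speed_eq[OF sJ b1] cs by (simp add: divide_inverse)
    ultimately show "((\<lambda>s. \<phi> s - arcsin (b s)) has_real_derivative 0) (at s)"
      using DERIV_diff[OF d\<phi>[OF sJ]] by force
  qed
  then show ?thesis using \<phi>1 by simp
qed (use \<phi>1 in simp)

text \<open>The speed depends on b and \<omega> alone, which are symmetric about e, so the sum of
  the two values has derivative 0 on a symmetric interval.\<close>

lemma \<phi>_mirror:
  assumes e: "e \<in> J" "c e = 0" and t: "t \<in> J" "2 * e - t \<in> J"
  shows "\<phi> (2 * e - t) = 2 * \<phi> e - \<phi> t"
proof -
  define S where "S = {x \<in> J. 2 * e - x \<in> J}"
  have S: "convex S"
  proof -
    have "is_interval S"
      unfolding is_interval_1 S_def
    proof (intro ballI allI impI CollectI conjI)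
      fix x y r assume xy: "x \<in> {x \<in> J. 2 * e - x \<in> J}" "y \<in> {x \<in> J. 2 * e - x \<in> J}" "x \<le> r \<and> r \<le> y"
      show "r \<in> J" using in_J[of x y r] xy by auto
      show "2 * e - r \<in> J" using in_J[of "2 * e - y" "2 * e - x" "2 * e - r"] xy by auto
    qed
    then show ?thesis by (simp add: is_interval_convex)
  qed
  have "((\<lambda>x. \<phi> (2 * e - x) + \<phi> x) has_real_derivative 0) (at x within S)" if "x \<in> S" for x
  proof -
    have x: "x \<in> J" "2 * e - x \<in> J" using that by (auto simp: S_def)
    have "speed (2 * e - x) = speed x"
      by (simp add: speed_def mirror_components[OF e x])
    moreover have "((\<lambda>x. \<phi> (2 * e - x)) has_real_derivative speed (2 * e - x) * - 1) (at x)"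
      by (rule DERIV_chain2[where g = "\<lambda>x. 2 * e - x", OF d\<phi>[OF x(2)]]) (auto intro!: derivative_eq_intros)
    ultimately have "((\<lambda>x. \<phi> (2 * e - x) + \<phi> x) has_real_derivative 0) (at x)"
      using DERIV_add[OF _ d\<phi>[OF x(1)]] by force
    then show ?thesis by (rule has_field_derivative_at_within)
  qed
  then obtain d where d: "\<forall>x\<in>S. \<phi> (2 * e - x) + \<phi> x = d"
    using has_field_derivative_zero_constant[OF S, of "\<lambda>x. \<phi> (2 * e - x) + \<phi> x"] by blast
  have "t \<in> S" "e \<in> S" using e t by (auto simp: S_def)
  with d have "\<phi> (2 * e - t) + \<phi> t = d" "\<phi> (2 * e - e) + \<phi> e = d" by blast+
  then show ?thesis by simp
qed

lemma \<phi>_homeomorphism: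
  obtains \<psi> where "homeomorphism J (\<phi> ` J) \<phi> \<psi>"
proof -
  have inj: "inj_on \<phi> J" using \<phi>_less by (metis inj_onI less_irrefl linorder_neqE_linordered_idom)
  then show ?thesis
    using invariance_of_domain_homeomorphism[OF J(1) continuous_\<phi> _ inj] that by auto
qed

text \<open>Dividing \<bar>R\<bar> < L by b^(n-2) leaves \<bar>\<omega>\<bar> < cos s, which by the
  energy identity says c^2 > 0.\<close>

lemma arcsin_in_J_set: assumes t: "t \<in> J"
  shows "arcsin (b t) \<in> J_set n C \<kappa> \<longleftrightarrow> c t \<noteq> 0"
proof -
  have bp: "0 < b t ^ (n - 2)" using b_pos[OF t] by simp
  have "\<bar>R_fun n (arcsin (b t)) C \<kappa>\<bar> < L_fun n (arcsin (b t)) \<longleftrightarrow> \<bar>\<omega> t\<bar> < sqrt (1 - (b t)\<^sup>2)"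
    unfolding R_fun_arcsin[OF t] L_fun_def arcsin_b[OF t] abs_mult abs_of_pos[OF bp]
    using bp by (simp add: mult.commute)
  also have "\<dots> \<longleftrightarrow> (\<omega> t)\<^sup>2 < 1 - (b t)\<^sup>2"
    by (metis real_sqrt_abs real_sqrt_less_iff)
  also have "\<dots> \<longleftrightarrow> 0 < (c t)\<^sup>2"
    using energy[OF t] by linarith
  also have "\<dots> \<longleftrightarrow> c t \<noteq> 0" by simp
  finally have eq: "\<bar>R_fun n (arcsin (b t)) C \<kappa>\<bar> < L_fun n (arcsin (b t)) \<longleftrightarrow> c t \<noteq> 0" .
  have "arcsin (b t) < pi / 2" if "c t \<noteq> 0"
    using b_less_1[OF t that] b_pos[OF t] arcsin_less_arcsin[of "b t" 1] by simp
  then show ?thesis using eq arcsin_b(3)[OF t] by (auto simp: J_set_def)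
qed

text \<open>Both ends are outside \<open>J_set\<close> and everything between them is inside; as
  \<open>J_set\<close> is an interval, it has no further points.\<close>

lemma J_set_eq:
  assumes A: "A \<notin> J_set n C \<kappa>" "A < \<phi> t1" "\<And>s. A < s \<Longrightarrow> s < \<phi> t1 \<Longrightarrow> s \<in> J_set n C \<kappa>"
  shows "J_set n C \<kappa> = {A<..<\<phi> t1}"
proof -
  have t1': "\<phi> t1 \<notin> J_set n C \<kappa>" using arcsin_in_J_set[OF t1(1)] t1(2) \<phi>1 by simp
  define mid where "mid = (A + \<phi> t1) / 2"
  have mid: "mid \<in> J_set n C \<kappa>" "A < mid" "mid < \<phi> t1"
    using A(3)[of mid] A(2) by (auto simp: mid_def field_simps)
  have "A < s \<and> s < \<phi> t1" if s: "s \<in> J_set n C \<kappa>" for s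
  proof (intro conjI; rule ccontr)
    assume "\<not> A < s"
    then show False using J_set_between[OF n s mid(1), of A] mid A(1) by simp
  next
    assume "\<not> s < \<phi> t1"
    then show False using J_set_between[OF n mid(1) s, of "\<phi> t1"] mid t1' by simp
  qed
  then show ?thesis using A(3) by auto
qed

text \<open>No argument of z is ever differentiated. An antiderivative \<open>s1\<close> of the
  prescribed phase rate is taken instead, and z is shown to be cos s times \<open>cis (s1 s)\<close>
  up to a constant rotation.\<close>

lemma local_curve:
  assumes hom: "homeomorphism J D \<phi> \<psi>"
    and P: "\<And>t. t \<in> P \<Longrightarrow> t \<in> J \<and> 0 < c t \<and> \<phi> t = arcsin (b t)" and img: "\<phi> ` P = J_set n C \<kappa>"
    and JS: "J_set n C \<kappa> = {A<..<B}" "A < B"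
  shows "local_curve n \<kappa> C (\<lambda>s. g (\<psi> s))"
proof -
  let ?S = "{A<..<B}"
  define f where "f s = R_fun n s C \<kappa> / (cos s * sqrt ((L_fun n s)\<^sup>2 - (R_fun n s C \<kappa>)\<^sup>2))" for s
  have \<psi>: "\<psi> s \<in> P" "\<phi> (\<psi> s) = s" if s: "s \<in> ?S" for s
  proof -
    have "s \<in> \<phi> ` P" using s img JS by simp
    then obtain t where t: "t \<in> P" "s = \<phi> t" by auto
    have "\<psi> (\<phi> t) = t" using hom P[OF t(1)] unfolding homeomorphism_def by blast
    then have "\<psi> s = t" unfolding t(2) .
    then show "\<psi> s \<in> P" "\<phi> (\<psi> s) = s" using t by auto
  qed
  have F: "\<psi> s \<in> J" "0 < c (\<psi> s)" "b (\<psi> s) < 1" "sin s = b (\<psi> s)" "cos s = sqrt (1 - (b (\<psi> s))\<^sup>2)" "0 < cos s"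
    "s = arcsin (b (\<psi> s))"
    if s: "s \<in> ?S" for s
  proof -
    show J: "\<psi> s \<in> J" and c: "0 < c (\<psi> s)" and e: "s = arcsin (b (\<psi> s))" using P[OF \<psi>(1)[OF s]] \<psi>(2)[OF s] by auto
    show b1: "b (\<psi> s) < 1" using b_less_1[OF J] c by simp
    show "sin s = b (\<psi> s)" "cos s = sqrt (1 - (b (\<psi> s))\<^sup>2)"
      using arcsin_b(1,2)[OF J] unfolding e[symmetric] by auto
    then show "0 < cos s" using one_minus_b[OF J b1] by simp
  qed
  have "\<phi> ` P \<subseteq> \<phi> ` J" using P by (intro image_mono) auto
  then have sub: "?S \<subseteq> D" using hom unfolding img JS by (simp add: homeomorphism_def)
  have cont\<psi>: "continuous_on ?S \<psi>"
    using hom sub by (auto simp: homeomorphism_def intro: continuous_on_subset)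
  have \<psi>J: "\<psi> ` ?S \<subseteq> J" using F(1) by blast
  have f: "f s = \<omega> (\<psi> s) / (cos s * c (\<psi> s))" if s: "s \<in> ?S" for s
  proof -
    note Fs = F[OF s]
    define w where "w = b (\<psi> s) ^ (n - 2)"
    have w: "0 < w" using b_pos[OF Fs(1)] by (simp add: w_def)
    have R: "R_fun n s C \<kappa> = w * \<omega> (\<psi> s)"
      using R_fun_arcsin[OF Fs(1)] unfolding Fs(7)[symmetric] by (simp add: w_def)
    have L: "L_fun n s = cos s * w" by (simp add: L_fun_def Fs(4) w_def)
    \<comment> \<open>By the energy identity L^2 - R^2 is the square of b^(n-2) c, and c > 0 on this
      piece decides the sign of the root.\<close>
    have "(cos s)\<^sup>2 - (\<omega> (\<psi> s))\<^sup>2 = (c (\<psi> s))\<^sup>2"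
      using one_minus_b[OF Fs(1,3)] energy[OF Fs(1)] by (simp add: Fs(5))
    then have "(L_fun n s)\<^sup>2 - (R_fun n s C \<kappa>)\<^sup>2 = (w * c (\<psi> s))\<^sup>2"
      unfolding L R power_mult_distrib by (metis left_diff_distrib mult.commute)
    then have "sqrt ((L_fun n s)\<^sup>2 - (R_fun n s C \<kappa>)\<^sup>2) = w * c (\<psi> s)"
      using w Fs(2) by (simp add: abs_mult)
    then show ?thesis using w by (simp add: f_def R)
  qed
  have "continuous_on ?S (\<lambda>s. \<omega> (\<psi> s) / (cos s * c (\<psi> s)))"
  proof (intro continuous_intros ballI)
    show "continuous_on ?S (\<lambda>s. \<omega> (\<psi> s))" by (rule continuous_on_compose2[OF cont(5) cont\<psi> \<psi>J])
    show "continuous_on ?S (\<lambda>s. v (\<psi> s))" by (rule continuous_on_compose2[OF cont(2) cont\<psi> \<psi>J])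
    show "cos s * c (\<psi> s) \<noteq> 0" if "s \<in> ?S" for s using F(2,6)[OF that] by simp
  qed
  then have "continuous_on ?S f" by (rule continuous_on_eq) (simp add: f)
  then obtain s1 where s1: "\<And>s. s \<in> ?S \<Longrightarrow> (s1 has_real_derivative f s) (at s)"
    using open_interval_antiderivative[of ?S f] by auto
  \<comment> \<open>The quotient of z and the candidate; it has derivative 0 and modulus 1, and its
    argument \<theta> is the missing constant of the phase.\<close>
  define h where "h s = ((1 / cos s) *\<^sub>R z (\<psi> s)) * cis (- s1 s)" for s
  have dh: "(h has_vector_derivative 0) (at s)" if s: "s \<in> ?S" for s
  proof -
    note Fs = F[OF s]
    define t where "t = \<psi> s"
    define co where "co = cos s"
    have tJ: "t \<in> J" and ct: "0 < c t" and bt: "sin s = b t" and co: "0 < co" "co\<^sup>2 = 1 - (b t)\<^sup>2"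
      using Fs one_minus_b[OF Fs(1,3)] by (auto simp: t_def co_def)
    have sp: "speed t = c t / co"
      using speed_eq[OF Fs(1,3)] Fs(2) by (simp add: t_def co_def Fs(5))
    have "(\<psi> has_real_derivative inverse (speed (\<psi> s))) (at s)"
    proof (rule has_field_derivative_inverse_basic[where g = \<psi> and t = ?S, OF d\<phi>[OF Fs(1)]])
      show "speed (\<psi> s) \<noteq> 0" using sp ct co by (simp add: t_def)
      show "isCont \<psi> s" using cont\<psi> s by (simp add: continuous_on_eq_continuous_at)
    qed (use s \<psi> in auto)
    then have d\<psi>: "(\<psi> has_vector_derivative co / c t) (at s)"
      using sp by (simp add: t_def has_real_derivative_iff_has_vector_derivative)
    have dz: "((\<lambda>s. z (\<psi> s)) has_vector_derivative (co / c t) *\<^sub>R fst (v t)) (at s)"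
      using vector_diff_chain_at[OF d\<psi> has_vector_derivative_fst[OF dg[OF Fs(1)]]]
      by (simp add: o_def t_def)
    have dco: "((\<lambda>s. 1 / cos s) has_real_derivative b t / co\<^sup>2) (at s)"
      using co by (auto intro!: derivative_eq_intros simp: co_def bt power2_eq_square)
    have "((\<lambda>s. cis (- s1 s)) has_derivative (\<lambda>x. (- f s * x) *\<^sub>R (\<i> * cis (- s1 s)))) (at s)"
      by (rule has_derivative_cis[OF DERIV_minus[OF s1[OF s], unfolded has_field_derivative_def]])
    then have dcis: "((\<lambda>s. cis (- s1 s)) has_vector_derivative (- f s) *\<^sub>R (\<i> * cis (- s1 s))) (at s)"
      unfolding has_vector_derivative_def by (simp add: mult.commute)
    \<comment> \<open>The derivative of \<open>h\<close> without its factor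
      \<open>cis (- s1 s)\<close>. It is seen to vanish after multiplication by the conjugate of z,
      which reduces everything to \<bar>z\<bar>, b, c and \<omega>.\<close>
    define K where "K = - (of_real (f s / co) * \<i> * z t) + of_real (1 / c t) * fst (v t) + of_real (b t / co\<^sup>2) * z t"
    have "cnj (z t) * K = 0"
    proof -
      have zz: "cnj (z t) * z t = of_real (co\<^sup>2)"
        using norm_z[OF tJ] co(2) complex_norm_square[of "z t"] by (simp add: mult.commute)
      have zv: "cnj (z t) * fst (v t) = Complex (- b t * c t) (\<omega> t)"
        using z_inner[OF tJ] by (simp add: complex_eq_iff \<omega>_Im)
      have "cnj (z t) * K = - (of_real (f s / co) * \<i> * (cnj (z t) * z t))
          + of_real (1 / c t) * (cnj (z t) * fst (v t)) + of_real (b t / co\<^sup>2) * (cnj (z t) * z t)"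
        by (simp add: K_def algebra_simps)
      also have "\<dots> = 0"
        unfolding zz zv f[OF s] t_def[symmetric] co_def[symmetric]
        using co(1) ct by (simp add: complex_eq_iff power2_eq_square)
      finally show ?thesis .
    qed
    moreover have "z t \<noteq> 0" using norm_z[OF tJ] co by auto
    ultimately have K: "K = 0" by simp
    have "(h has_vector_derivative
        ((1 / co) *\<^sub>R z t) * ((- f s) *\<^sub>R (\<i> * cis (- s1 s))) +
        ((1 / co) *\<^sub>R (co / c t) *\<^sub>R fst (v t) + (b t / co\<^sup>2) *\<^sub>R z t) * cis (- s1 s)) (at s)"
      unfolding h_def[abs_def]
      using has_vector_derivative_mult[OF has_vector_derivative_scaleR[OF dco dz] dcis]
      by (simp add: t_def co_def)
    also have "((1 / co) *\<^sub>R z t) * ((- f s) *\<^sub>R (\<i> * cis (- s1 s))) +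
        ((1 / co) *\<^sub>R (co / c t) *\<^sub>R fst (v t) + (b t / co\<^sup>2) *\<^sub>R z t) * cis (- s1 s) = K * cis (- s1 s)"
      using co(1) by (simp add: K_def scaleR_conv_of_real algebra_simps)
    finally show ?thesis by (simp add: K)
  qed
  have "(h has_vector_derivative 0) (at s within ?S)" if "s \<in> ?S" for s
    using dh[OF that] by (rule has_vector_derivative_at_within)
  then obtain k where k: "\<And>s. s \<in> ?S \<Longrightarrow> h s = k"
    by (rule has_vector_derivative_zero_constant[OF convex_real_interval(8)]) blast+
  have "norm k = 1"
  proof -
    define s where "s = (A + B) / 2"
    have s: "s \<in> ?S" using JS(2) by (auto simp: s_def field_simps)
    have "(norm (z (\<psi> s)))\<^sup>2 = (cos s)\<^sup>2"
      using norm_z[OF F(1)[OF s]] one_minus_b[OF F(1)[OF s] F(3)[OF s]] by (simp add: F(5)[OF s])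
    then have "norm (z (\<psi> s)) = cos s"
      using F(6)[OF s] by (metis norm_ge_zero less_imp_le power2_eq_imp_eq)
    then have "norm (h s) = 1" using F(6)[OF s] by (simp add: h_def norm_mult)
    then show ?thesis using k[OF s] by simp
  qed
  then obtain \<theta> where \<theta>: "k = cis \<theta>" by (metis cis_Arg norm_eq_zero sgn_eq div_by_1 of_real_1 zero_neq_one)
  show ?thesis
    unfolding local_curve_def JS(1)
  proof (intro exI[of _ "\<lambda>s. s1 s + \<theta>"] conjI ballI)
    fix s assume s: "s \<in> ?S"
    show "((\<lambda>s. s1 s + \<theta>) has_real_derivative
        R_fun n s C \<kappa> / (cos s * sqrt ((L_fun n s)\<^sup>2 - (R_fun n s C \<kappa>)\<^sup>2))) (at s)"
      using s1[OF s] unfolding f_def by (auto intro!: derivative_eq_intros)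
    have "z (\<psi> s) = of_real (cos s) * (h s * cis (s1 s))"
      using F(6)[OF s] by (simp add: h_def scaleR_conv_of_real cis_mult mult.assoc)
    then have "z (\<psi> s) = of_real (cos s) * cis (s1 s + \<theta>)"
      unfolding k[OF s] \<theta> by (simp add: cis_mult add.commute)
    then show "g (\<psi> s) = sph_point s (s1 s + \<theta>)"
      using F(4)[OF s] by (simp add: sph_point_def prod_eq_iff)
  qed
qed

end

section \<open>Assembling the complete extended curve for C \<noteq> 0\<close>

context angle_profile
begin

text \<open>The symmetry about the turning point E, transported from arc length to the parameter
  \<phi>. As \<phi> is increasing, left-hand limits correspond to left-hand limits.\<close>

lemma reflection_at:
  assumes hom: "homeomorphism J D \<phi> \<psi>" and D: "open D" and E: "E \<in> J" "c E = 0"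
    and sub: "\<And>t. t \<in> {\<phi> E - w<..<\<phi> E} \<Longrightarrow> t \<in> D \<and> 2 * E - \<psi> t \<in> J"
  shows "\<exists>\<theta>. ((\<lambda>t. sgn (fst (g (\<psi> t)))) \<longlongrightarrow> cis \<theta>) (at_left (\<phi> E)) \<and>
    (\<forall>t\<in>{\<phi> E - w<..<\<phi> E}. g (\<psi> (2 * \<phi> E - t)) =
       reflect_phase (if g (\<psi> (\<phi> E)) = (0, 1) then - cis (2 * \<theta>) else cis (2 * \<theta>)) (g (\<psi> t)))"
proof -
  have \<psi>\<phi>: "\<psi> (\<phi> t) = t" "\<phi> t \<in> D" if "t \<in> J" for t using hom that by (auto simp: homeomorphism_def)
  have \<phi>\<psi>: "\<phi> (\<psi> t) = t" "\<psi> t \<in> J" if "t \<in> D" for t using hom that by (auto simp: homeomorphism_def)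
  obtain \<theta> where \<theta>: "((\<lambda>t. sgn (z t)) \<longlongrightarrow> cis \<theta>) (at_left E)"
    "mirror E = (if g E = (0, 1) then - cis (2 * \<theta>) else cis (2 * \<theta>))"
    by (rule sgn_limit[OF E])
  have "filterlim \<psi> (at_left E) (at_left (\<phi> E))"
    unfolding filterlim_at
  proof
    have "isCont \<psi> (\<phi> E)"
      using hom D \<psi>\<phi>(2)[OF E(1)] by (auto simp: homeomorphism_def continuous_on_eq_continuous_at)
    then have "(\<psi> \<longlongrightarrow> E) (at (\<phi> E))" using \<psi>\<phi>(1)[OF E(1)] by (simp add: isCont_def)
    then show "(\<psi> \<longlongrightarrow> E) (at_left (\<phi> E))"
      by (rule tendsto_mono[OF at_le[OF subset_UNIV]])
    have "\<forall>\<^sub>F t in at_left (\<phi> E). t \<in> D"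
      using eventually_nhds_in_open[OF D \<psi>\<phi>(2)[OF E(1)]]
      unfolding eventually_at_filter by (rule eventually_mono) simp
    moreover have "\<forall>\<^sub>F t in at_left (\<phi> E). t < \<phi> E" by (simp add: eventually_at_filter)
    ultimately show "\<forall>\<^sub>F t in at_left (\<phi> E). \<psi> t \<in> {..<E} \<and> \<psi> t \<noteq> E"
    proof eventually_elim
      case (elim t)
      then have "\<psi> t < E" using \<phi>_less_iff[of "\<psi> t" E] \<phi>\<psi> E by simp
      then show ?case by simp
    qed
  qed
  then have "((\<lambda>t. sgn (z (\<psi> t))) \<longlongrightarrow> cis \<theta>) (at_left (\<phi> E))"
    by (rule filterlim_compose[OF \<theta>(1)])
  moreover have "g (\<psi> (2 * \<phi> E - t)) =
      reflect_phase (if g (\<psi> (\<phi> E)) = (0, 1) then - cis (2 * \<theta>) else cis (2 * \<theta>)) (g (\<psi> t))"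
    if t: "t \<in> {\<phi> E - w<..<\<phi> E}" for t
  proof -
    have tD: "t \<in> D" and EJ: "2 * E - \<psi> t \<in> J" using sub[OF t] by auto
    have "\<phi> (2 * E - \<psi> t) = 2 * \<phi> E - t"
      using \<phi>_mirror[OF E \<phi>\<psi>(2)[OF tD] EJ] \<phi>\<psi>(1)[OF tD] by simp
    then have "\<psi> (2 * \<phi> E - t) = 2 * E - \<psi> t" using \<psi>\<phi>(1)[OF EJ] by simp
    then show ?thesis
      using mirror_symmetry(1)[OF E \<phi>\<psi>(2)[OF tD] EJ] \<psi>\<phi>(1)[OF E(1)] \<theta>(2) by simp
  qed
  ultimately show ?thesis by blast
qed

lemma extended_curve_nonzero:
  assumes C: "C \<noteq> 0"
  obtains \<delta> \<psi> where "extended_curve n \<kappa> C UNIV \<delta>" "homeomorphism J UNIV \<phi> \<psi>" "\<And>t. t \<in> J \<Longrightarrow> g t = \<delta> (\<phi> t)"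
proof -
  have JU: "J = UNIV" by (rule J_UNIV[OF C])
  have mem: "t \<in> J" for t by (simp add: JU)
  obtain \<tau> where \<tau>: "\<tau> < t1" "\<And>t. \<tau> \<le> t \<Longrightarrow> t < t1 \<Longrightarrow> 0 < c t" using rising by blast
  \<comment> \<open>Going back in time b falls until it reaches a minimum \<open>t0\<close>; this is
    where C \<noteq> 0 is indispensable.\<close>
  have "-1 * c \<tau> < 0" using \<tau>(2)[OF order_refl \<tau>(1)] by simp
  then obtain t0 where t0: "t0 < \<tau>" "c t0 = 0" "\<And>t. t0 < t \<Longrightarrow> t \<le> \<tau> \<Longrightarrow> -1 * c t < 0"
    by (rule turning_left[OF mem disjI2[OF conjI[OF refl C]]]) blast
  have pos: "0 < c t" if "t0 < t" "t < t1" for t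
    using t0(3)[of t] \<tau>(2)[of t] that by (cases "t \<le> \<tau>") auto
  have t01: "t0 < t1" using t0 \<tau> by simp
  define A where "A = \<phi> t0"
  define w where "w = \<phi> t1 - A"
  have w: "0 < w" using \<phi>_less[OF mem mem t01] by (simp add: w_def A_def)
  have A_arcsin: "A = arcsin (b t0)" unfolding A_def by (rule \<phi>_arcsin[OF mem]) (use t01 pos in auto)
  have cont\<phi>: "continuous_on S \<phi>" for S using continuous_\<phi> by (rule continuous_on_subset) (simp add: JU)
  have between: "\<exists>t. t0 < t \<and> t < t1 \<and> \<phi> t = s" if s: "A < s" "s < \<phi> t1" for s
  proof -
    have "\<exists>t\<ge>t0. t \<le> t1 \<and> \<phi> t = s"
      using s t01 by (intro IVT') (auto simp: A_def cont\<phi>)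
    then obtain t where t: "t0 \<le> t" "t \<le> t1" "\<phi> t = s" by blast
    then have "t \<noteq> t0" "t \<noteq> t1" using s by (auto simp: A_def)
    then show ?thesis using t by (intro exI[of _ t]) auto
  qed
  have ph: "\<phi> t = arcsin (b t)" if "t0 < t" "t < t1" for t
    by (rule \<phi>_arcsin[OF mem]) (use that pos in auto)
  have JS: "J_set n C \<kappa> = {A<..<\<phi> t1}"
  proof (rule J_set_eq)
    show "A \<notin> J_set n C \<kappa>" using arcsin_in_J_set[OF mem, of t0] t0(2) by (simp add: A_arcsin)
    show "A < \<phi> t1" using w by (simp add: w_def)
    fix s assume "A < s" "s < \<phi> t1"
    then obtain t where t: "t0 < t" "t < t1" "\<phi> t = s" using between by blast
    then show "s \<in> J_set n C \<kappa>" using arcsin_in_J_set[OF mem, of t] pos[OF t(1,2)] ph[OF t(1,2)] by simp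
  qed
  \<comment> \<open>The points obtained from \<open>t0\<close> and \<open>t1\<close> by repeated
    reflection; they are equally spaced in arc length as well as in \<phi>.\<close>
  define e where "e m = t0 + of_int m * (t1 - t0)" for m :: int
  have step: "c (2 * y - x) = 0 \<and> \<phi> (2 * y - x) = 2 * \<phi> y - \<phi> x" if "c x = 0" "c y = 0" for x y
    using mirror_components(2)[OF mem that(2) mem mem, of x] \<phi>_mirror[OF mem that(2) mem mem, of x] that by simp
  define Q where "Q m \<longleftrightarrow> c (e m) = 0 \<and> \<phi> (e m) = A + of_int m * w" for m
  \<comment> \<open>Two neighbours are carried along, since the next point arises by reflecting one
    of them at the other.\<close>
  have "Q m \<and> Q (m + 1)" for m
  proof (induction m rule: int_induct[where k = 0])
    case base
    show ?case using t0(2) t1(2) by (simp add: Q_def e_def A_def w_def)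
  next
    case (step1 i)
    have "2 * e (i + 1) - e i = e (i + 1 + 1)" by (simp add: e_def algebra_simps)
    then have "Q (i + 1 + 1)"
      using step[of "e i" "e (i + 1)"] step1(2) by (simp add: Q_def algebra_simps)
    then show ?case using step1(2) by simp
  next
    case (step2 i)
    have "2 * e i - e (i + 1) = e (i - 1)" by (simp add: e_def algebra_simps)
    then have "Q (i - 1)"
      using step[of "e (i + 1)" "e i"] step2(2) by (simp add: Q_def algebra_simps)
    then show ?case using step2(2) by simp
  qed
  then have nodes: "c (e m) = 0" "\<phi> (e m) = A + of_int m * w" for m by (auto simp: Q_def)
  \<comment> \<open>The values A + m w of \<phi> at the turning points are unbounded in both
    directions, so \<phi> is onto by the intermediate value theorem.\<close>
  have "s \<in> \<phi> ` J" for s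
  proof -
    obtain m :: nat where m: "\<bar>s - A\<bar> / w < real m" using reals_Archimedean2 by blast
    have "\<bar>s - A\<bar> < real m * w" using m w by (simp add: divide_less_eq)
    then have "\<phi> (e (- int m)) \<le> s" "s \<le> \<phi> (e (int m))" by (auto simp: nodes abs_less_iff)
    moreover have "e (- int m) \<le> e (int m)" using t01 by (simp add: e_def)
    ultimately have "\<exists>t\<ge>e (- int m). t \<le> e (int m) \<and> \<phi> t = s"
      using cont\<phi> by (intro IVT')
    then show ?thesis using mem by auto
  qed
  then have "\<phi> ` J = UNIV" by auto
  then obtain \<psi> where hom: "homeomorphism J UNIV \<phi> \<psi>" using \<phi>_homeomorphism by metis
  have \<psi>\<phi>: "\<psi> (\<phi> t) = t" for t using hom mem by (auto simp: homeomorphism_def)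
  have "extended_curve n \<kappa> C UNIV (\<lambda>s. g (\<psi> s))"
  proof -
    have Inf: "Inf (J_set n C \<kappa>) = A" "Sup (J_set n C \<kappa>) = \<phi> t1"
      unfolding JS using w by (auto simp: w_def)
    have lc: "local_curve n \<kappa> C (\<lambda>s. g (\<psi> s))"
    proof (rule local_curve[OF hom, of "{t0<..<t1}"])
      show "t \<in> J \<and> 0 < c t \<and> \<phi> t = arcsin (b t)" if "t \<in> {t0<..<t1}" for t
        using that pos ph mem by auto
      show "\<phi> ` {t0<..<t1} = J_set n C \<kappa>"
      proof
        show "\<phi> ` {t0<..<t1} \<subseteq> J_set n C \<kappa>"
          unfolding JS A_def using \<phi>_less[OF mem mem] by auto
        show "J_set n C \<kappa> \<subseteq> \<phi> ` {t0<..<t1}"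
        proof
          fix s assume "s \<in> J_set n C \<kappa>"
          then obtain t where "t0 < t" "t < t1" "\<phi> t = s" using between unfolding JS by auto
          then show "s \<in> \<phi> ` {t0<..<t1}" by auto
        qed
      qed
      show "J_set n C \<kappa> = {A<..<\<phi> t1}" "A < \<phi> t1" using JS w by (auto simp: w_def)
    qed
    \<comment> \<open>The minimum of b is positive, which selects the branch of the definition with
      the whole line as domain.\<close>
    have A0: "A \<noteq> 0" using arcsin_b(3)[OF mem, of t0] by (simp add: A_arcsin)
    have cont\<delta>: "continuous_on UNIV (\<lambda>s. g (\<psi> s))"
      using hom by (intro continuous_on_compose2[OF cont(1)]) (auto simp: homeomorphism_def mem)
    have refl: "\<exists>\<theta>. ((\<lambda>t. sgn (fst (g (\<psi> t)))) \<longlongrightarrow> cis \<theta>) (at_left d) \<and>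
        (\<forall>t\<in>{d - w<..<d}. g (\<psi> (2 * d - t)) =
          reflect_phase (if g (\<psi> d) = (0, 1) then - cis (2 * \<theta>) else cis (2 * \<theta>)) (g (\<psi> t)))"
      if "d = A + of_int m * w" for m :: int and d
    proof -
      have d: "d = \<phi> (e m)" using that nodes by simp
      show ?thesis unfolding d
        by (rule reflection_at[OF hom open_UNIV mem nodes(1)]) (simp add: mem)
    qed
    show ?thesis
      unfolding extended_curve_def Let_def Inf w_def[symmetric]
      using lc A0 cont\<delta> refl by simp
  qed
  then show ?thesis using that hom \<psi>\<phi> by simp
qed

end

section \<open>The spherical case\<close>

locale sphere_profile = angle_profile +
  assumes C0: "C = 0" and \<kappa>_pos: "0 < \<kappa>"
begin

text \<open>\<mu> is the constant ratio \<omega> / b along the curve, 1 / \<nu> the radius of the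
  circle on which it lies, r a quarter of the period and half the length of the open arc, and u the
  phase at the maximum of b.\<close>

definition "\<mu> = \<kappa> / (real n - 1)"
definition "\<nu> = sqrt (1 + \<mu>\<^sup>2)"
definition "r = pi / (2 * \<nu>)"
definition "u = sgn (z t1)"

text \<open>The unit speed circle cut out of the 2-sphere by the plane at distance \<mu> / \<nu>
  from the origin with normal (u, 0), at its highest point for t = \<open>t1\<close>.\<close>

definition arc :: "real \<Rightarrow> complex \<times> real" where
  "arc t = (u * Complex (\<mu> / \<nu>) (sin (\<nu> * (t - t1)) / \<nu>), cos (\<nu> * (t - t1)) / \<nu>)"

definition arc_velocity :: "real \<Rightarrow> complex \<times> real" where
  "arc_velocity t = (u * Complex 0 (cos (\<nu> * (t - t1))), - sin (\<nu> * (t - t1)))"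

lemma constants: "0 < \<mu>" "0 < \<nu>" "\<nu>\<^sup>2 = 1 + \<mu>\<^sup>2" "0 < r" "1 < \<nu>"
proof -
  show mu: "0 < \<mu>" using \<kappa>_pos n by (simp add: \<mu>_def)
  then show "0 < \<nu>" "\<nu>\<^sup>2 = 1 + \<mu>\<^sup>2" "1 < \<nu>" by (auto simp: \<nu>_def add_pos_nonneg)
  then show "0 < r" by (simp add: r_def)
qed

lemma \<kappa>_eq: "\<kappa> = (real n - 1) * \<mu>" using n by (simp add: \<mu>_def)

lemma \<omega>_b: assumes "t \<in> J" shows "\<omega> t = \<mu> * b t"
proof -
  have e: "n - 1 = Suc (n - 2)" using n by simp
  have "b t ^ (n - 2) * \<omega> t = b t ^ (n - 2) * (\<mu> * b t)"
    using first_integral[OF assms] unfolding C0 e by (simp add: \<omega>_def \<mu>_def)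
  then show ?thesis using b_pos[OF assms] by simp
qed

lemma b_t1: "b t1 = 1 / \<nu>"
proof -
  have "(\<nu> * b t1)\<^sup>2 = 1\<^sup>2"
    using energy[OF t1(1)] t1(2) \<omega>_b[OF t1(1)] constants(3) by (simp add: power_mult_distrib algebra_simps)
  then have "\<nu> * b t1 = 1"
    by (rule power2_eq_imp_eq) (use b_pos[OF t1(1)] constants(2) in simp_all)
  then show ?thesis using constants(2) by (simp add: field_simps)
qed

lemma norm_z_t1: "norm (z t1) = \<mu> / \<nu>"
proof -
  have "(norm (z t1))\<^sup>2 = (\<mu> / \<nu>)\<^sup>2"
  proof -
    have "1 - (1 / \<nu>)\<^sup>2 = (\<nu>\<^sup>2 - 1) / \<nu>\<^sup>2"
      using constants(2) by (simp add: power_divide diff_divide_distrib)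
    then show ?thesis
      using norm_z[OF t1(1)] constants(3) by (simp add: b_t1 power_divide)
  qed
  then show ?thesis by (rule power2_eq_imp_eq) (use constants in simp_all)
qed

lemma norm_u: "norm u = 1" "cnj u * u = 1" "u * cnj u = 1"
proof -
  have "z t1 \<noteq> 0" using norm_z_t1 constants by auto
  then show "norm u = 1" by (simp add: u_def norm_sgn)
  then show "cnj u * u = 1" "u * cnj u = 1" by (simp_all add: complex_norm_square[symmetric] mult.commute)
qed

lemma inner_mult_u: "(u * x) \<bullet> (u * y) = x \<bullet> y"
proof -
  have ic: "p \<bullet> w = Re (p * cnj w)" for p w :: complex by (simp add: inner_complex_def)
  have "(u * x) * cnj (u * y) = (u * cnj u) * (x * cnj y)" by (simp only: complex_cnj_mult mult_ac)
  also have "\<dots> = x * cnj y" unfolding norm_u(3) by (rule mult_1)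
  finally show ?thesis unfolding ic by (rule arg_cong)
qed

lemma arc_t1: "arc t1 = g t1" "arc_velocity t1 = v t1"
proof -
  have z: "z t1 = of_real (\<mu> / \<nu>) * u"
    using norm_z_t1 constants by (simp add: u_def sgn_eq)
  then show "arc t1 = g t1"
    by (simp add: arc_def prod_eq_iff b_t1 complex_eq_iff mult.commute)
  have "cnj (z t1) * fst (v t1) = Complex 0 (\<mu> / \<nu>)"
    using z_inner[OF t1(1)] t1(2) \<omega>_b[OF t1(1)] by (simp add: complex_eq_iff \<omega>_Im b_t1)
  moreover have "cnj (z t1) * fst (v t1) = of_real (\<mu> / \<nu>) * (cnj u * fst (v t1))"
    unfolding z by (simp only: complex_cnj_mult complex_cnj_complex_of_real mult.assoc)
  moreover have "Complex 0 (\<mu> / \<nu>) = of_real (\<mu> / \<nu>) * \<i>" by (simp add: complex_eq_iff)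
  ultimately have "of_real (\<mu> / \<nu>) * (cnj u * fst (v t1)) = of_real (\<mu> / \<nu>) * \<i>" by simp
  then have "cnj u * fst (v t1) = \<i>" using constants by simp
  then have "(u * cnj u) * fst (v t1) = u * \<i>" by (simp add: mult.assoc)
  then show "arc_velocity t1 = v t1"
    using norm_u(3) t1(2) by (simp add: arc_velocity_def prod_eq_iff Complex_eq)
qed

lemma vprod_arc: "vprod (arc t) (arc_velocity t) =
    (u * Complex (- 1 / \<nu>) (\<mu> * sin (\<nu> * (t - t1)) / \<nu>), \<mu> * snd (arc t))"
proof -
  define S where "S = sin (\<nu> * (t - t1))"
  define K where "K = cos (\<nu> * (t - t1))"
  have SK: "S * S + K * K = 1"
    using sin_cos_squared_add[of "\<nu> * (t - t1)"] by (simp add: S_def K_def power2_eq_square)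
  have "\<i> * (of_real (K / \<nu>) * (u * Complex 0 K) - of_real (- S) * (u * Complex (\<mu> / \<nu>) (S / \<nu>)))
      = u * (\<i> * (of_real (K / \<nu>) * Complex 0 K - of_real (- S) * Complex (\<mu> / \<nu>) (S / \<nu>)))"
    by (simp add: algebra_simps)
  also have "\<i> * (of_real (K / \<nu>) * Complex 0 K - of_real (- S) * Complex (\<mu> / \<nu>) (S / \<nu>))
      = Complex (- 1 / \<nu>) (\<mu> * S / \<nu>)"
  proof -
    have "K / \<nu> * K + S * (S / \<nu>) = (S * S + K * K) / \<nu>" by (simp add: add_divide_distrib)
    then have "K / \<nu> * K + S * (S / \<nu>) = 1 / \<nu>" unfolding SK .
    then show ?thesis by (simp add: complex_eq_iff mult.commute)
  qed
  finally have 1: "fst (vprod (arc t) (arc_velocity t)) = u * Complex (- 1 / \<nu>) (\<mu> * S / \<nu>)"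
    by (simp add: vprod_def arc_def arc_velocity_def S_def K_def)
  have "cnj (u * Complex (\<mu> / \<nu>) (S / \<nu>)) * (u * Complex 0 K) =
      (cnj u * u) * (cnj (Complex (\<mu> / \<nu>) (S / \<nu>)) * Complex 0 K)"
    by (simp only: complex_cnj_mult mult_ac)
  also have "\<dots> = cnj (Complex (\<mu> / \<nu>) (S / \<nu>)) * Complex 0 K" unfolding norm_u(2) by (rule mult_1)
  finally have "Im (cnj (u * Complex (\<mu> / \<nu>) (S / \<nu>)) * (u * Complex 0 K)) = \<mu> * (K / \<nu>)"
    by (simp only:) simp
  then have "snd (vprod (arc t) (arc_velocity t)) = \<mu> * (K / \<nu>)"
    unfolding vprod_def arc_def arc_velocity_def S_def K_def fst_conv snd_conv .
  then show ?thesis using 1 by (simp add: prod_eq_iff arc_def S_def K_def)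
qed

lemma arc_pos: assumes "t \<in> {t1 - r<..<t1 + r}" shows "0 < snd (arc t)"
proof -
  have "\<bar>t - t1\<bar> < r" using assms by auto
  then have "\<nu> * \<bar>t - t1\<bar> < pi / 2" using constants by (simp add: r_def field_simps)
  then have "\<bar>\<nu> * (t - t1)\<bar> < pi / 2" using constants by (simp add: abs_mult)
  then show ?thesis using constants by (simp add: arc_def cos_gt_zero_pi abs_less_iff)
qed

text \<open>For \<omega> = \<mu> b the geodesic curvature (n - 2) \<mu> - (n - 1) \<mu> is the
  constant - \<mu>, and the equation becomes that of a circle.\<close>

lemma arc_trajectory: "trajectory n \<kappa> {t1 - r<..<t1 + r} arc arc_velocity"
proof (rule trajectoryI)
  fix t assume t: "t \<in> {t1 - r<..<t1 + r}"
  define S where "S = sin (\<nu> * (t - t1))"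
  define K where "K = cos (\<nu> * (t - t1))"
  have SK: "S * S + K * K = 1"
    using sin_cos_squared_add[of "\<nu> * (t - t1)"] by (simp add: S_def K_def power2_eq_square)
  have dC: "((\<lambda>t. u * Complex (f t) (h t)) has_vector_derivative u * Complex f' h') (at t)"
    if "(f has_real_derivative f') (at t)" "(h has_real_derivative h') (at t)" for f h f' h'
    using that
    by (intro has_vector_derivative_mult_right)
      (auto simp: has_vector_derivative_complex_iff has_real_derivative_iff_has_vector_derivative)
  have dS: "((\<lambda>t. sin (\<nu> * (t - t1))) has_real_derivative \<nu> * K) (at t)"
    and dK: "((\<lambda>t. cos (\<nu> * (t - t1))) has_real_derivative - \<nu> * S) (at t)"
    by (auto intro!: derivative_eq_intros simp: S_def K_def)
  have dS': "((\<lambda>t. sin (\<nu> * (t - t1)) / \<nu>) has_real_derivative K) (at t)"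
    and dK': "((\<lambda>t. cos (\<nu> * (t - t1)) / \<nu>) has_real_derivative - S) (at t)"
    using DERIV_cdivide[OF dS, of \<nu>] DERIV_cdivide[OF dK, of \<nu>] constants(2) by simp_all
  show "(arc has_vector_derivative arc_velocity t) (at t)"
    unfolding arc_def[abs_def] arc_velocity_def S_def[symmetric] K_def[symmetric]
    by (intro has_vector_derivative_Pair dC DERIV_const dS' dK'[unfolded has_real_derivative_iff_has_vector_derivative])
  have dv': "(arc_velocity has_vector_derivative (u * Complex 0 (- \<nu> * S), - (\<nu> * K))) (at t)"
    unfolding arc_velocity_def[abs_def]
    by (intro has_vector_derivative_Pair dC DERIV_const dK
        DERIV_minus[OF dS, unfolded has_real_derivative_iff_has_vector_derivative])
  have p: "0 < snd (arc t)" by (rule arc_pos[OF t])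
  have q: "(real n - 2) * snd (vprod (arc t) (arc_velocity t)) / snd (arc t) - \<kappa> = - \<mu>"
  proof -
    have "(real n - 2) * (\<mu> * snd (arc t)) / snd (arc t) = (real n - 2) * \<mu>" using p by simp
    moreover have "(real n - 2) * \<mu> - (real n - 1) * \<mu> = - \<mu>" by (simp add: algebra_simps)
    ultimately show ?thesis unfolding vprod_arc snd_conv using \<kappa>_eq by linarith
  qed
  have l2: "\<nu> * \<nu> = 1 + \<mu> * \<mu>" using constants(3) by (simp add: power2_eq_square)
  have "- \<mu> *\<^sub>R vprod (arc t) (arc_velocity t) - arc t = (u * Complex 0 (- \<nu> * S), - (\<nu> * K))"
  proof (rule prod_eqI)
    have fa: "fst (arc t) = u * Complex (\<mu> / \<nu>) (S / \<nu>)" by (simp add: arc_def S_def)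
    have X: "Complex 0 (- \<nu> * S) = of_real (- \<mu>) * Complex (- 1 / \<nu>) (\<mu> * S / \<nu>) - Complex (\<mu> / \<nu>) (S / \<nu>)"
    proof -
      have "\<mu> * (\<mu> * S / \<nu>) + S / \<nu> = (1 + \<mu> * \<mu>) * S / \<nu>" by (simp add: algebra_simps add_divide_distrib)
      also have "\<dots> = \<nu> * S" unfolding l2[symmetric] using constants(2) by simp
      finally show ?thesis by (simp add: complex_eq_iff)
    qed
    show "fst (- \<mu> *\<^sub>R vprod (arc t) (arc_velocity t) - arc t) = fst (u * Complex 0 (- \<nu> * S), - (\<nu> * K))"
      unfolding fst_diff fst_scaleR vprod_arc fst_conv S_def[symmetric] fa X
      by (simp only: scaleR_conv_of_real right_diff_distrib mult.left_commute)
    have "- \<mu> * (\<mu> * (K / \<nu>)) - K / \<nu> = - ((1 + \<mu> * \<mu>) * K / \<nu>)" by (simp add: algebra_simps add_divide_distrib)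
    also have "\<dots> = - (\<nu> * K)" unfolding l2[symmetric] using constants(2) by simp
    finally show "snd (- \<mu> *\<^sub>R vprod (arc t) (arc_velocity t) - arc t) = snd (u * Complex 0 (- \<nu> * S), - (\<nu> * K))"
      unfolding snd_diff snd_scaleR vprod_arc snd_conv real_scaleR_def
      by (simp add: arc_def K_def[symmetric])
  qed
  then show "(arc_velocity has_vector_derivative
      ((real n - 2) * snd (vprod (arc t) (arc_velocity t)) / snd (arc t) - \<kappa>) *\<^sub>R vprod (arc t) (arc_velocity t) - arc t) (at t)"
    unfolding q using dv' by simp
  note ui = inner_mult_u
  have l3: "\<nu> * \<nu> = S * S + K * K + \<mu> * \<mu>" using l2 SK by simp
  have "\<mu> / \<nu> * (\<mu> / \<nu>) + S / \<nu> * (S / \<nu>) + K / \<nu> * (K / \<nu>) = (S * S + K * K + \<mu> * \<mu>) / (\<nu> * \<nu>)"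
    by (simp add: add_divide_distrib)
  then have "\<mu> / \<nu> * (\<mu> / \<nu>) + S / \<nu> * (S / \<nu>) + K / \<nu> * (K / \<nu>) = 1"
    unfolding l3[symmetric] using constants(2) by simp
  then have "arc t \<bullet> arc t = 1"
    unfolding arc_def inner_Pair ui S_def[symmetric] K_def[symmetric]
    by (simp add: inner_complex_def)
  moreover have "arc_velocity t \<bullet> arc_velocity t = 1"
    unfolding arc_velocity_def inner_Pair ui S_def[symmetric] K_def[symmetric]
    using SK by (simp add: inner_complex_def)
  moreover have "arc t \<bullet> arc_velocity t = 0"
    unfolding arc_def arc_velocity_def inner_Pair ui S_def[symmetric] K_def[symmetric]
    by (simp add: inner_complex_def)
  ultimately show "0 < snd (arc t) \<and> arc t \<bullet> arc t = 1 \<and> arc_velocity t \<bullet> arc_velocity t = 1 \<and> arc t \<bullet> arc_velocity t = 0"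
    using p by blast
qed (use constants in \<open>auto simp: is_interval_oo\<close>)

lemma g_arc: assumes "t \<in> J" "t \<in> {t1 - r<..<t1 + r}" shows "g t = arc t" "v t = arc_velocity t"
  using trajectory_unique[OF T arc_trajectory t1(1) _ assms] arc_t1 constants by auto

lemma arc_end: "snd (arc (t1 + r)) = 0" "snd (arc (t1 - r)) = 0"
proof -
  have "\<nu> * r = pi / 2" using constants by (simp add: r_def)
  then have "cos (\<nu> * r) = 0" by (simp only: cos_pi_half)
  then show "snd (arc (t1 + r)) = 0" "snd (arc (t1 - r)) = 0" by (simp_all add: arc_def)
qed

lemma continuous_arc: "continuous_on S arc"
  unfolding arc_def Complex_eq by (intro continuous_intros) (use constants in auto)

text \<open>If J contained an end of the interval, b would vanish there by continuity. So J lies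
  inside the interval, and maximality gives equality.\<close>

lemma J_arc: "J = {t1 - r<..<t1 + r}"
proof -
  have end_notin: "t1 + \<sigma> * r \<notin> J" if \<sigma>: "\<sigma> = 1 \<or> \<sigma> = -1" for \<sigma>
  proof
    define E where "E = t1 + \<sigma> * r"
    assume "t1 + \<sigma> * r \<in> J"
    then have E: "E \<in> J" by (simp add: E_def)
    define S where "S = {min t1 E<..<max t1 E}"
    have lt: "min t1 E < max t1 E" using \<sigma> constants by (auto simp: E_def)
    have cl: "closure S = {min t1 E..max t1 E}" unfolding S_def using lt by simp
    have SJ: "{min t1 E..max t1 E} \<subseteq> J" using in_J[of "min t1 E" "max t1 E"] E t1(1) by (auto simp: min_def max_def)
    have "b x - snd (arc x) = 0" if "x \<in> closure S" for x
    proof (rule continuous_constant_on_closure[OF _ _ that])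
      show "continuous_on (closure S) (\<lambda>x. b x - snd (arc x))"
        unfolding cl by (intro continuous_intros continuous_on_subset[OF cont(1) SJ] continuous_arc)
      fix x assume x: "x \<in> S"
      then have "x \<in> J" using SJ by (auto simp: S_def)
      moreover have "x \<in> {t1 - r<..<t1 + r}" using x \<sigma> constants by (auto simp: S_def E_def)
      ultimately show "b x - snd (arc x) = 0" using g_arc by simp
    qed
    then have "b E = 0" using arc_end \<sigma> unfolding cl by (auto simp: E_def)
    then show False using b_pos[OF E] by simp
  qed
  have "J \<subseteq> {t1 - r<..<t1 + r}"
  proof
    fix t assume t: "t \<in> J"
    have "t < t1 + r" using end_notin[of 1] in_J[OF t1(1) t, of "t1 + r"] constants by force
    moreover have "t1 - r < t" using end_notin[of "-1"] in_J[OF t t1(1), of "t1 - r"] constants by force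
    ultimately show "t \<in> {t1 - r<..<t1 + r}" by simp
  qed
  then show ?thesis
    using M arc_trajectory g_arc unfolding maximal_trajectory_def by (metis subsetD)
qed

end

section \<open>The extended curve for C = 0 and its round hypersphere\<close>

context sphere_profile
begin

lemma J_symmetric: "t \<in> J \<Longrightarrow> 2 * t1 - t \<in> J"
  unfolding J_arc by auto

lemma c_pos_left: assumes t: "t \<in> J" "t < t1" shows "0 < c t"
proof -
  have tr: "t \<in> {t1 - r<..<t1 + r}" using t(1) J_arc by simp
  have "\<nu> * (t1 - t) < pi / 2" using tr constants by (simp add: r_def field_simps)
  moreover have "0 < \<nu> * (t1 - t)" using t(2) constants by simp
  ultimately have "0 < sin (\<nu> * (t1 - t))" by (intro sin_gt_zero) linarith+
  moreover have "c t = sin (\<nu> * (t1 - t))"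
    unfolding g_arc(2)[OF t(1) tr] arc_velocity_def
    by (simp add: sin_minus[symmetric] algebra_simps del: sin_minus)
  ultimately show ?thesis by simp
qed

lemma \<phi>_left: assumes "t \<in> J" "t \<le> t1" shows "\<phi> t = arcsin (b t)"
  by (rule \<phi>_arcsin[OF assms]) (use in_J[OF assms(1) t1(1)] in \<open>auto intro: c_pos_left\<close>)

lemma \<phi>_left_surj:
  assumes s: "0 < s" "s \<le> \<phi> t1"
  obtains t where "t \<in> J" "t \<le> t1" "\<phi> t = s"
proof -
  have p: "\<phi> t1 \<le> pi / 2" using arcsin_b(4)[OF t1(1)] \<phi>1 by simp
  have ss: "0 < sin s" using s p by (intro sin_gt_zero) auto
  have "sin s \<le> sin (\<phi> t1)" using s p by (intro sin_monotone_2pi_le) auto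
  also have "\<dots> = 1 / \<nu>" unfolding \<phi>1 arcsin_b(1)[OF t1(1)] by (rule b_t1)
  finally have le: "\<nu> * sin s \<le> 1" using constants by (simp add: field_simps)
  \<comment> \<open>Solves cos (\<nu> (t1 - t)) = \<nu> sin s, that is, b t = sin s on the rising
    half of the arc.\<close>
  define a where "a = arccos (\<nu> * sin s)"
  have pos: "0 < \<nu> * sin s" using ss constants by simp
  then have a: "0 \<le> a" "a < pi / 2" "cos a = \<nu> * sin s"
    using le arccos_lbound[of "\<nu> * sin s"] arccos_less_arccos[of 0 "\<nu> * sin s"] by (auto simp: a_def)
  define t where "t = t1 - a / \<nu>"
  have "a / \<nu> < r" using a constants by (simp add: r_def field_simps)
  moreover have "0 \<le> a / \<nu>" using a constants by simp
  ultimately have tr: "t \<in> {t1 - r<..<t1 + r}"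
    unfolding t_def greaterThanLessThan_iff using constants(4) by linarith
  then have tJ: "t \<in> J" using J_arc by simp
  have tl: "t \<le> t1" using a constants by (simp add: t_def)
  have "b t = sin s"
    unfolding g_arc(1)[OF tJ tr] arc_def using a constants by (simp add: t_def)
  then have "\<phi> t = s"
    using \<phi>_left[OF tJ tl] s p by (simp add: arcsin_sin)
  then show ?thesis using that tJ tl by blast
qed

text \<open>On the rising half \<phi> = arcsin b starts from 0, the value at the axis; reflection at
  \<open>t1\<close> contributes the other half.\<close>

lemma \<phi>_image: "\<phi> ` J = {0<..<2 * \<phi> t1}"
proof
  have pos: "0 < \<phi> t" if "t \<in> J" "t \<le> t1" for t
    using \<phi>_left[OF that] arcsin_b(3)[OF that(1)] by simp
  show "\<phi> ` J \<subseteq> {0<..<2 * \<phi> t1}"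
  proof
    fix s assume "s \<in> \<phi> ` J"
    then obtain t where t: "t \<in> J" "s = \<phi> t" by auto
    show "s \<in> {0<..<2 * \<phi> t1}"
    proof (cases "t \<le> t1")
      case True
      then have "\<phi> t \<le> \<phi> t1" using \<phi>_less[OF t(1) t1(1)] by (cases "t = t1") auto
      then show ?thesis using pos[OF t(1) True] t(2) by simp
    next
      case False
      then have "0 < \<phi> (2 * t1 - t)" "\<phi> t1 < \<phi> t"
        using pos[OF J_symmetric[OF t(1)]] \<phi>_less[OF t1(1) t(1)] by auto
      then show ?thesis
        using \<phi>_mirror[OF t1 t(1) J_symmetric[OF t(1)]] pos[OF t1(1)] t(2) by simp
    qed
  qed
  show "{0<..<2 * \<phi> t1} \<subseteq> \<phi> ` J"
  proof
    fix s assume s: "s \<in> {0<..<2 * \<phi> t1}"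
    show "s \<in> \<phi> ` J"
    proof (cases "s \<le> \<phi> t1")
      case True
      then obtain t where "t \<in> J" "\<phi> t = s" using \<phi>_left_surj[of s] s by auto
      then show ?thesis by blast
    next
      case False
      then obtain t where t: "t \<in> J" "\<phi> t = 2 * \<phi> t1 - s"
        using \<phi>_left_surj[of "2 * \<phi> t1 - s"] s by auto
      have "\<phi> (2 * t1 - t) = s" using \<phi>_mirror[OF t1 t(1) J_symmetric[OF t(1)]] t(2) by simp
      then show ?thesis using J_symmetric[OF t(1)] by blast
    qed
  qed
qed

lemma extended_curve_zero:
  obtains D \<delta> \<psi> where "extended_curve n \<kappa> C D \<delta>" "homeomorphism J D \<phi> \<psi>" "\<And>t. t \<in> J \<Longrightarrow> g t = \<delta> (\<phi> t)"
proof -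
  define B where "B = \<phi> t1"
  define D where "D = {0<..<2 * B}"
  have B: "0 < B" using arcsin_b(3)[OF t1(1)] \<phi>1 by (simp add: B_def)
  obtain \<psi> where hom: "homeomorphism J D \<phi> \<psi>"
    using \<phi>_homeomorphism \<phi>_image by (auto simp: D_def B_def)
  have \<psi>\<phi>: "\<psi> (\<phi> t) = t" if "t \<in> J" for t using hom that by (auto simp: homeomorphism_def)
  have \<psi>J: "\<psi> t \<in> J" if "t \<in> D" for t using hom that by (auto simp: homeomorphism_def)
  have inJ: "s \<in> J_set n C \<kappa> \<and> (\<exists>t. t \<in> J \<and> t < t1 \<and> \<phi> t = s)" if s: "0 < s" "s < B" for s
  proof -
    obtain t where t: "t \<in> J" "t \<le> t1" "\<phi> t = s" using \<phi>_left_surj[of s] s by (auto simp: B_def)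
    have lt: "t < t1" using t s by (cases "t = t1") (auto simp: B_def)
    have "c t \<noteq> 0" using c_pos_left[OF t(1) lt] by simp
    then have "s \<in> J_set n C \<kappa>" using arcsin_in_J_set[OF t(1)] \<phi>_left[OF t(1,2)] t(3) by simp
    then show ?thesis using t lt by blast
  qed
  have JS: "J_set n C \<kappa> = {0<..<B}"
    unfolding B_def by (rule J_set_eq) (use inJ B in \<open>auto simp: B_def J_set_def\<close>)
  have Inf: "Inf (J_set n C \<kappa>) = 0" "Sup (J_set n C \<kappa>) = B" unfolding JS using B by auto
  have lc: "local_curve n \<kappa> C (\<lambda>s. g (\<psi> s))"
  proof (rule local_curve[OF hom, of "J \<inter> {..<t1}"])
    show "t \<in> J \<and> 0 < c t \<and> \<phi> t = arcsin (b t)" if "t \<in> J \<inter> {..<t1}" for t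
      using that c_pos_left \<phi>_left by auto
    show "\<phi> ` (J \<inter> {..<t1}) = J_set n C \<kappa>"
    proof
      show "\<phi> ` (J \<inter> {..<t1}) \<subseteq> J_set n C \<kappa>"
      proof
        fix s assume "s \<in> \<phi> ` (J \<inter> {..<t1})"
        then obtain t where t: "t \<in> J" "t < t1" "s = \<phi> t" by auto
        then have "s < B" using \<phi>_less[OF t(1) t1(1)] by (simp add: B_def)
        moreover have "0 < s" using \<phi>_left[OF t(1)] arcsin_b(3)[OF t(1)] t by simp
        ultimately show "s \<in> J_set n C \<kappa>" using JS by simp
      qed
      show "J_set n C \<kappa> \<subseteq> \<phi> ` (J \<inter> {..<t1})"
      proof
        fix s assume "s \<in> J_set n C \<kappa>"
        then obtain t where "t \<in> J" "t < t1" "\<phi> t = s" using inJ[of s] JS by auto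
        then show "s \<in> \<phi> ` (J \<inter> {..<t1})" by auto
      qed
    qed
    show "J_set n C \<kappa> = {0<..<B}" "0 < B" using JS B by auto
  qed
  have cont\<delta>: "continuous_on D (\<lambda>s. g (\<psi> s))"
    using hom by (intro continuous_on_compose2[OF cont(1)]) (auto simp: homeomorphism_def)
  have refl: "\<exists>\<theta>. ((\<lambda>t. sgn (fst (g (\<psi> t)))) \<longlongrightarrow> cis \<theta>) (at_left d) \<and>
      (\<forall>t\<in>{d - B<..<d}. g (\<psi> (2 * d - t)) =
        reflect_phase (if g (\<psi> d) = (0, 1) then - cis (2 * \<theta>) else cis (2 * \<theta>)) (g (\<psi> t)))"
    if d: "d = of_int m * B" "d \<in> D" for m :: int and d
  proof -
    \<comment> \<open>Among the multiples of B only B itself lies in the domain (0, 2 B), so the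
      maximum of b is the single point of reflection.\<close>
    have "0 < of_int m * B" "of_int m * B < 2 * B" using d by (auto simp: D_def)
    then have "0 < m" "m < 2" using B by (auto simp: zero_less_mult_iff mult_less_cancel_right)
    then have "m = 1" by simp
    then have d': "d = \<phi> t1" using d by (simp add: B_def)
    show ?thesis unfolding d'
    proof (rule reflection_at[OF hom _ t1])
      show "open D" by (simp add: D_def)
      fix t assume "t \<in> {\<phi> t1 - B<..<\<phi> t1}"
      then have "t \<in> D" by (auto simp: D_def B_def)
      then show "t \<in> D \<and> 2 * t1 - \<psi> t \<in> J" using J_symmetric \<psi>J by blast
    qed
  qed
  have "extended_curve n \<kappa> C D (\<lambda>s. g (\<psi> s))"
    unfolding extended_curve_def Let_def Inf
    using lc cont\<delta> refl by (simp add: D_def)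
  then show ?thesis using that[OF _ hom] \<psi>\<phi> by simp
qed

lemma arc_inner: "fst (arc t) \<bullet> u = \<mu> / \<nu>"
  using inner_mult_u[of "Complex (\<mu> / \<nu>) (sin (\<nu> * (t - t1)) / \<nu>)" 1]
  by (simp add: arc_def inner_complex_def)

text \<open>Supplies the inclusion of the whole geodesic sphere, apart from its points on b = 0, in
  the rotated arc. The parameter is read off from the angle whose sine and cosine are \<nu> Y and
  \<nu> y.\<close>

lemma arc_surj:
  fixes \<zeta> :: complex and y :: real
  assumes y: "0 < y" and \<zeta>: "\<zeta> \<bullet> \<zeta> + y * y = 1" "\<zeta> \<bullet> u = \<mu> / \<nu>"
  obtains t where "t \<in> J" "arc t = (\<zeta>, y)"
proof -
  define X where "X = cnj u * \<zeta>"
  have \<zeta>X: "\<zeta> = u * X" using norm_u(3) by (simp add: X_def mult.assoc[symmetric])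
  have Re: "Re X = \<mu> / \<nu>" using \<zeta>(2) inner_mult_u[of X 1] unfolding \<zeta>X by (simp add: inner_complex_def)
  define Y where "Y = Im X"
  have "\<zeta> \<bullet> \<zeta> = X \<bullet> X" unfolding \<zeta>X by (rule inner_mult_u)
  then have "(\<mu> / \<nu>)\<^sup>2 + Y\<^sup>2 + y\<^sup>2 = 1" using \<zeta>(1) Re by (simp add: inner_complex_def Y_def power2_eq_square)
  then have "\<nu>\<^sup>2 * ((\<mu> / \<nu>)\<^sup>2 + Y\<^sup>2 + y\<^sup>2) = \<nu>\<^sup>2" by simp
  moreover have "\<nu>\<^sup>2 * ((\<mu> / \<nu>)\<^sup>2 + Y\<^sup>2 + y\<^sup>2) = \<mu>\<^sup>2 + (\<nu> * Y)\<^sup>2 + (\<nu> * y)\<^sup>2"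
    using constants(2) by (simp add: distrib_left power_mult_distrib power_divide)
  ultimately have Yy: "(\<nu> * Y)\<^sup>2 + (\<nu> * y)\<^sup>2 = 1"
    using constants(3) by linarith
  have "0 < (\<nu> * y)\<^sup>2" using y constants by simp
  then have "(\<nu> * Y)\<^sup>2 < 1" using Yy by linarith
  then have lt: "\<bar>\<nu> * Y\<bar> < 1" by (simp only: abs_square_less_1)
  define a where "a = arcsin (\<nu> * Y)"
  have a: "- (pi / 2) < a" "a < pi / 2" "sin a = \<nu> * Y"
    using arcsin_lt_bounded[of "\<nu> * Y"] lt by (auto simp: a_def abs_less_iff)
  have "cos a = sqrt (1 - (\<nu> * Y)\<^sup>2)" using lt by (simp add: a_def cos_arcsin abs_less_iff)
  also have "1 - (\<nu> * Y)\<^sup>2 = (\<nu> * y)\<^sup>2" using Yy by simp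
  finally have ca: "cos a = \<nu> * y" using y constants by simp
  define t where "t = t1 + a / \<nu>"
  have "a / \<nu> < r" "- r < a / \<nu>" using a constants by (auto simp: r_def field_simps)
  then have "t \<in> J" by (simp add: J_arc t_def)
  moreover have "arc t = (\<zeta>, y)"
    using a(3) ca constants Re by (simp add: arc_def t_def \<zeta>X complex_eq_iff Y_def)
  ultimately show ?thesis by (rule that)
qed

text \<open>The arc lies in a plane with normal (u, 0), so its rotation lies in a hyperplane section
  of the sphere: the geodesic sphere with centre (u, 0) and radius arccos (\<mu> / \<nu>).\<close>

lemma generates_round_sphere:
  fixes N :: "real \<times> (real ^ 'm::finite) \<Rightarrow> complex \<times> (real ^ 'm)"
  assumes hom: "homeomorphism I J \<sigma> \<tau>" and \<gamma>: "\<And>t. t \<in> I \<Longrightarrow> \<gamma> t = g (\<sigma> t)"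
    and N: "cmc_with_normal I \<gamma> N \<kappa>"
    and Nt: "\<And>t x. t \<in> I \<Longrightarrow> N (t, x) =
       (- fst (vprod (g (\<sigma> t)) (v (\<sigma> t))), (- snd (vprod (g (\<sigma> t)) (v (\<sigma> t)))) *\<^sub>R x)"
  shows "generates_round_sphere TYPE('m) \<kappa> I \<gamma>"
proof -
  have ga: "g t = arc t" "v t = arc_velocity t" if "t \<in> J" for t using g_arc[OF that] that J_arc by auto
  have \<sigma>: "\<sigma> t \<in> J" if "t \<in> I" for t using hom that by (auto simp: homeomorphism_def)
  have \<tau>: "\<tau> t \<in> I" "\<sigma> (\<tau> t) = t" if "t \<in> J" for t using hom that by (auto simp: homeomorphism_def)
  have img: "\<gamma> ` I = arc ` J"
  proof
    show "\<gamma> ` I \<subseteq> arc ` J" using \<gamma> \<sigma> ga by auto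
    show "arc ` J \<subseteq> \<gamma> ` I"
    proof
      fix p assume "p \<in> arc ` J"
      then obtain t where t: "t \<in> J" "p = arc t" by auto
      then have "p = \<gamma> (\<tau> t)" using \<gamma>[OF \<tau>(1)] \<tau> ga by simp
      then show "p \<in> \<gamma> ` I" using \<tau>(1)[OF t(1)] by auto
    qed
  qed
  have arc1: "fst (arc t) \<bullet> fst (arc t) + snd (arc t) * snd (arc t) = 1" if "t \<in> J" for t
    using unit(1)[OF that] unfolding ga(1)[OF that] by (simp add: inner_prod_def)
  define c0 where "c0 = (u, 0 :: real ^ 'm)"
  define \<rho> where "\<rho> = arccos (\<mu> / \<nu>)"
  have "\<mu>\<^sup>2 < \<nu>\<^sup>2" using constants(3) by simp
  then have "\<mu> < \<nu>" using constants(2) by (auto intro: power2_less_imp_less)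
  then have q: "0 < \<mu> / \<nu>" "\<mu> / \<nu> < 1" using constants by auto
  have \<rho>: "0 < \<rho>" "\<rho> < pi" "cos \<rho> = \<mu> / \<nu>"
    using q arccos_lt_bounded[of "\<mu> / \<nu>"] by (auto simp: \<rho>_def)
  have uu: "u \<bullet> u = 1" using norm_u(1) by (simp add: dot_square_norm)
  then have c0: "c0 \<in> sphere 0 1" by (simp add: c0_def norm_eq_sqrt_inner)
  have c_in: "y \<bullet> c0 = fst y \<bullet> u" for y by (simp add: c0_def inner_prod_def)
  have "rot_hyp \<gamma> ` rot_dom I \<union> {(e, 0) | e. (e, 0) \<in> closure (\<gamma> ` I)} = geodesic_sphere c0 \<rho>"
  proof
    show "rot_hyp \<gamma> ` rot_dom I \<union> {(e, 0) | e. (e, 0) \<in> closure (\<gamma> ` I)} \<subseteq> geodesic_sphere c0 \<rho>"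
    proof (rule Un_least)
      show "rot_hyp \<gamma> ` rot_dom I \<subseteq> geodesic_sphere c0 \<rho>"
      proof
        fix y :: "complex \<times> (real ^ 'm)" assume "y \<in> rot_hyp \<gamma> ` rot_dom I"
        then obtain t and x :: "real ^ 'm" where t: "t \<in> I" and x: "norm x = 1"
          and y: "y = (fst (\<gamma> t), snd (\<gamma> t) *\<^sub>R x)" by (auto simp: rot_hyp_def)
        have g: "\<gamma> t = arc (\<sigma> t)" using \<gamma>[OF t] ga(1)[OF \<sigma>[OF t]] by simp
        have "x \<bullet> x = 1" using x by (simp add: dot_square_norm)
        then have "y \<bullet> y = 1" using arc1[OF \<sigma>[OF t]] by (simp add: y g)
        moreover have "y \<bullet> c0 = cos \<rho>" unfolding c_in \<rho> by (simp add: y g arc_inner)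
        ultimately show "y \<in> geodesic_sphere c0 \<rho>"
          by (simp add: geodesic_sphere_def norm_eq_sqrt_inner)
      qed
      define F where "F = {p :: complex \<times> real. p \<bullet> p = 1 \<and> fst p \<bullet> u = \<mu> / \<nu>}"
      have "closed F"
        unfolding F_def by (intro closed_Collect_conj closed_Collect_eq continuous_intros)
      moreover have "\<gamma> ` I \<subseteq> F"
        unfolding img F_def using arc1 arc_inner by (auto simp: inner_prod_def)
      ultimately have "closure (\<gamma> ` I) \<subseteq> F" by (rule closure_minimal[rotated])
      then show "{(e, 0) | e. (e, 0) \<in> closure (\<gamma> ` I)} \<subseteq> geodesic_sphere c0 \<rho>"
        by (auto simp: F_def geodesic_sphere_def norm_eq_sqrt_inner c_in \<rho>)
    qed
    show "geodesic_sphere c0 \<rho> \<subseteq> rot_hyp \<gamma> ` rot_dom I \<union> {(e, 0) | e. (e, 0) \<in> closure (\<gamma> ` I)}"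
    proof
      fix y assume "y \<in> geodesic_sphere c0 \<rho>"
      then have y1: "y \<bullet> y = 1" and y2: "fst y \<bullet> u = \<mu> / \<nu>"
        by (auto simp: geodesic_sphere_def dot_square_norm c_in[symmetric] \<rho>(3)[symmetric])
      define \<zeta> where "\<zeta> = fst y"
      define w where "w = snd y"
      have zw: "\<zeta> \<bullet> \<zeta> + norm w * norm w = 1"
        using y1 by (simp add: inner_prod_def \<zeta>_def w_def dot_square_norm power2_eq_square)
      show "y \<in> rot_hyp \<gamma> ` rot_dom I \<union> {(e, 0) | e. (e, 0) \<in> closure (\<gamma> ` I)}"
      proof (cases "w = 0")
        case False
        obtain t where t: "t \<in> J" "arc t = (\<zeta>, norm w)"
          by (rule arc_surj[OF _ zw]) (use False y2 in \<open>auto simp: \<zeta>_def\<close>)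
        have "\<gamma> (\<tau> t) = (\<zeta>, norm w)" using \<gamma>[OF \<tau>(1)] \<tau>(2) ga t by simp
        then have "y = rot_hyp \<gamma> (\<tau> t, w /\<^sub>R norm w)"
          using False by (simp add: rot_hyp_def prod_eq_iff \<zeta>_def w_def)
        moreover have "(\<tau> t, w /\<^sub>R norm w) \<in> rot_dom I" using \<tau>(1)[OF t(1)] False by simp
        ultimately show ?thesis by blast
      next
        case True
        \<comment> \<open>Points with vanishing second component are limits at the two ends of the
          arc; \<epsilon> tells at which one.\<close>
        define X where "X = cnj u * \<zeta>"
        have \<zeta>X: "\<zeta> = u * X" using norm_u(3) by (simp add: X_def mult.assoc[symmetric])
        have Re: "Re X = \<mu> / \<nu>"
          using y2 inner_mult_u[of X 1] unfolding \<zeta>_def[symmetric] \<zeta>X by (simp add: inner_complex_def)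
        have "\<zeta> \<bullet> \<zeta> = X \<bullet> X" unfolding \<zeta>X by (rule inner_mult_u)
        then have "(\<mu> / \<nu>)\<^sup>2 + (Im X)\<^sup>2 = 1" using zw True Re by (simp add: inner_complex_def power2_eq_square)
        then have "\<nu>\<^sup>2 * ((\<mu> / \<nu>)\<^sup>2 + (Im X)\<^sup>2) = \<nu>\<^sup>2" by simp
        moreover have "\<nu>\<^sup>2 * ((\<mu> / \<nu>)\<^sup>2 + (Im X)\<^sup>2) = \<mu>\<^sup>2 + (\<nu> * Im X)\<^sup>2"
          using constants(2) by (simp add: distrib_left power_mult_distrib power_divide)
        ultimately have "(\<nu> * Im X)\<^sup>2 = 1" using constants(3) by linarith
        then obtain \<epsilon> where \<epsilon>: "\<epsilon> = 1 \<or> \<epsilon> = -1" "\<nu> * Im X = \<epsilon>" by (auto simp: power2_eq_1_iff)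
        have nr: "\<nu> * r = pi / 2" using constants by (simp add: r_def)
        have "sin (\<nu> * r) = 1" unfolding nr by simp
        then have "sin (\<nu> * (\<epsilon> * r)) = \<epsilon>" using \<epsilon>(1) by auto
        moreover have "Im X = \<epsilon> / \<nu>" using \<epsilon>(2) constants(2) by (simp add: field_simps)
        ultimately have "fst (arc (t1 + \<epsilon> * r)) = \<zeta>"
          unfolding arc_def \<zeta>X using Re by (simp add: complex_eq_iff)
        moreover have "snd (arc (t1 + \<epsilon> * r)) = 0" using \<epsilon>(1) arc_end by auto
        ultimately have "arc (t1 + \<epsilon> * r) = (\<zeta>, 0)" by (simp add: prod_eq_iff)
        moreover have "arc ` closure J \<subseteq> closure (arc ` J)"
          by (rule image_closure_subset) (auto intro: continuous_arc closure_subset[THEN subsetD])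
        moreover have "t1 + \<epsilon> * r \<in> closure J"
          unfolding J_arc using \<epsilon>(1) constants(4) by auto
        ultimately have "(\<zeta>, 0) \<in> closure (\<gamma> ` I)" unfolding img by force
        then show ?thesis using True by (auto simp: \<zeta>_def w_def prod_eq_iff)
      qed
    qed
  qed
  moreover have "N q \<bullet> c0 > 0" if "q \<in> rot_dom I" for q
  proof -
    obtain t x where q: "q = (t, x)" by (cases q)
    then have t: "t \<in> I" using that by simp
    \<comment> \<open>The normal is the negative of the cross product, whose component along u is -
      1 / \<nu>; so it points towards the centre.\<close>
    have "N q \<bullet> c0 = - (fst (vprod (arc (\<sigma> t)) (arc_velocity (\<sigma> t))) \<bullet> u)"
      unfolding c_in q Nt[OF t] ga[OF \<sigma>[OF t]] by simp
    also have "\<dots> = 1 / \<nu>"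
      using inner_mult_u[of "Complex (- 1 / \<nu>) (\<mu> * sin (\<nu> * (\<sigma> t - t1)) / \<nu>)" 1]
      by (simp add: vprod_arc inner_complex_def)
    finally show ?thesis using constants by simp
  qed
  ultimately show ?thesis
    unfolding generates_round_sphere_def using c0 \<rho> N by blast
qed

end

section \<open>The classification\<close>

context profile_curve
begin

text \<open>The energy identity bounds \<bar>\<omega>\<bar> by cos s; inserted in the first integral
  this is \<bar>R\<bar> \<le> L, with equality allowed at turning points.\<close>

lemma barrier_bounds:
  assumes t: "t \<in> J"
  shows "C \<le> barrier n \<kappa> (arcsin (b t))" "- C \<le> barrier n (- \<kappa>) (arcsin (b t))"
proof -
  have e: "n - 1 = Suc (n - 2)" using n by simp
  have bp: "0 < b t ^ (n - 2)" using b_pos[OF t] by simp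
  have "(\<omega> t)\<^sup>2 \<le> 1 - (b t)\<^sup>2" using energy[OF t] zero_le_power2[of "c t"] by linarith
  then have "\<bar>\<omega> t\<bar> \<le> sqrt (1 - (b t)\<^sup>2)" by (rule real_le_rsqrt[of "\<bar>\<omega> t\<bar>", unfolded power2_abs])
  then have "b t ^ (n - 2) * \<bar>\<omega> t\<bar> \<le> b t ^ (n - 2) * sqrt (1 - (b t)\<^sup>2)" using bp by simp
  moreover have "C = b t ^ (n - 2) * \<omega> t - \<kappa> / (real n - 1) * b t ^ (n - 1)"
    using first_integral[OF t] by (simp add: \<omega>_def)
  moreover have "b t ^ (n - 2) * \<omega> t \<le> b t ^ (n - 2) * \<bar>\<omega> t\<bar>" "- (b t ^ (n - 2) * \<omega> t) \<le> b t ^ (n - 2) * \<bar>\<omega> t\<bar>"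
    using bp by (auto simp: abs_real_def)
  ultimately show "C \<le> barrier n \<kappa> (arcsin (b t))" "- C \<le> barrier n (- \<kappa>) (arcsin (b t))"
    unfolding barrier_def L_fun_def arcsin_b[OF t] by (auto simp: mult.commute)
qed

lemma C_bounds: "C \<le> C_stat n \<kappa>" "- C \<le> C_stat n (- \<kappa>)"
proof -
  obtain t where t: "t \<in> J" using J by auto
  have "0 \<le> arcsin (b t)" "arcsin (b t) \<le> pi / 2" using arcsin_b[OF t] by auto
  then show "C \<le> C_stat n \<kappa>" "- C \<le> C_stat n (- \<kappa>)"
    using barrier_bounds[OF t] barrier_le_C_stat[OF n] by (meson order_trans)+
qed

text \<open>An extremal C is attained by the barrier at a single latitude, so b is constant. The
  equation for z then is that of uniform rotation.\<close>

lemma static: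
  assumes M: "maximal_trajectory n \<kappa> J g v" and C: "C = C_stat n \<kappa>"
    and hom: "homeomorphism I J \<sigma> \<tau>" and \<gamma>: "\<And>t. t \<in> I \<Longrightarrow> \<gamma> t = g (\<sigma> t)"
  shows "is_static_type n \<kappa> I \<gamma>"
proof -
  define s where "s = s_stat n \<kappa>"
  have s: "0 < s" "s < pi / 2" using s_stat[OF n] by (auto simp: s_def)
  have cs: "0 < cos s" "0 < sin s" using s by (auto intro: cos_gt_zero sin_gt_zero)
  have arcs: "arcsin (b t) = s" if t: "t \<in> J" for t
  proof (rule ccontr)
    assume "arcsin (b t) \<noteq> s"
    then have "barrier n \<kappa> (arcsin (b t)) < C_stat n \<kappa>"
      using barrier_less_C_stat[OF n, of "arcsin (b t)" \<kappa>] arcsin_b[OF t] by (simp add: s_def)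
    then show False using barrier_bounds(1)[OF t] C by simp
  qed
  have b: "b t = sin s" if "t \<in> J" for t using arcsin_b(1)[OF that] arcs[OF that] by simp
  have c: "c t = 0" if t: "t \<in> J" for t
  proof -
    have "(b has_real_derivative 0) (at t)"
      by (rule has_field_derivative_transform_within_open[OF DERIV_const[of "sin s"] J(1) t]) (simp add: b)
    then show ?thesis by (rule DERIV_unique[OF db[OF t]])
  qed
  have \<omega>: "\<omega> t = cos s" if t: "t \<in> J" for t
  proof -
    have "sin s ^ (n - 2) * \<omega> t = C + \<kappa> / (real n - 1) * sin s ^ (n - 1)"
      using first_integral[OF t] by (simp add: \<omega>_def b[OF t])
    also have "\<dots> = sin s ^ (n - 2) * cos s" by (simp add: C C_stat_def L_fun_def s_def)
    finally show ?thesis using cs by simp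
  qed
  have JU: "J = UNIV"
    by (rule maximal_trajectory_UNIV[OF M cs(2)]) (simp add: b)
  \<comment> \<open>The angular velocity: unit speed on a circle of radius cos s.\<close>
  define \<alpha> where "\<alpha> = 1 / cos s"
  have dz: "(z has_vector_derivative of_real \<alpha> * \<i> * z t) (at t)" for t
  proof -
    have t: "t \<in> J" by (simp add: JU)
    have zz: "cnj (z t) * z t = of_real ((cos s)\<^sup>2)"
      using norm_z[OF t] complex_norm_square[of "z t"] b[OF t] by (simp add: cos_squared_eq mult.commute)
    have "cnj (z t) * fst (v t) = of_real (cos s) * \<i>"
      using z_inner[OF t] \<omega>[OF t] c[OF t] by (simp add: complex_eq_iff \<omega>_Im)
    also have "\<dots> = of_real \<alpha> * \<i> * (cnj (z t) * z t)"
      unfolding zz using cs by (simp add: \<alpha>_def power2_eq_square)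
    finally have "cnj (z t) * fst (v t) = cnj (z t) * (of_real \<alpha> * \<i> * z t)" by (simp add: mult_ac)
    moreover have "cnj (z t) \<noteq> 0" using zz cs by auto
    ultimately have "fst (v t) = of_real \<alpha> * \<i> * z t" by simp
    then show ?thesis using has_vector_derivative_fst[OF dg[OF t]] by simp
  qed
  have "((\<lambda>t. z t * cis (- (\<alpha> * t))) has_vector_derivative 0) (at t within UNIV)" if "t \<in> UNIV" for t
  proof -
    have "((\<lambda>t. cis (- (\<alpha> * t))) has_derivative (\<lambda>x. (- \<alpha> * x) *\<^sub>R (\<i> * cis (- (\<alpha> * t))))) (at t)"
      by (rule has_derivative_cis) (auto intro!: derivative_eq_intros)
    then have dc: "((\<lambda>t. cis (- (\<alpha> * t))) has_vector_derivative (- \<alpha>) *\<^sub>R (\<i> * cis (- (\<alpha> * t)))) (at t)"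
      unfolding has_vector_derivative_def by (simp add: mult.commute)
    from has_vector_derivative_mult[OF dz dc] show ?thesis
      by (simp add: scaleR_conv_of_real mult_ac)
  qed
  then obtain k where k: "\<And>t. z t * cis (- (\<alpha> * t)) = k"
    by (rule has_vector_derivative_zero_constant[OF convex_UNIV]) blast+
  have zk: "z t = k * cis (\<alpha> * t)" for t
    using k[of t] by (metis (no_types) ab_group_add_class.ab_left_minus cis_mult cis_zero mult.assoc mult.right_neutral)
  have "norm (z 0) = cos s"
  proof -
    have "(norm (z 0))\<^sup>2 = (cos s)\<^sup>2" using norm_z[of 0] b[of 0] by (simp add: JU cos_squared_eq)
    then show ?thesis by (rule power2_eq_imp_eq) (use cs in simp_all)
  qed
  then have nk: "norm k = cos s" using zk[of 0] by simp
  define \<beta> where "\<beta> = Arg k"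
  have k\<beta>: "k = of_real (cos s) * cis \<beta>"
    using nk rcis_cmod_Arg[of k] by (simp add: \<beta>_def rcis_def)
  have g: "g t = sph_point s (\<alpha> * t + \<beta>)" for t
    using b[of t] by (simp add: JU sph_point_def prod_eq_iff zk k\<beta> cis_mult add.commute)
  have \<alpha>: "\<alpha> \<noteq> 0" using cs by (simp add: \<alpha>_def)
  have "surj (\<lambda>t. \<alpha> * t + \<beta>)" by (rule surjI[of _ "\<lambda>t. (t - \<beta>) / \<alpha>"]) (use \<alpha> in simp)
  moreover have "surj (\<lambda>t. (t - \<beta>) / \<alpha>)" by (rule surjI[of _ "\<lambda>t. \<alpha> * t + \<beta>"]) (use \<alpha> in simp)
  ultimately have h: "homeomorphism UNIV UNIV (\<lambda>t. \<alpha> * t + \<beta>) (\<lambda>t. (t - \<beta>) / \<alpha>)"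
    using \<alpha> by (auto simp: homeomorphism_def intro!: continuous_intros)
  have "homeomorphism I UNIV ((\<lambda>t. \<alpha> * t + \<beta>) \<circ> \<sigma>) (\<tau> \<circ> (\<lambda>t. (t - \<beta>) / \<alpha>))"
    using homeomorphism_compose[OF hom[unfolded JU] h] .
  moreover have "\<forall>t\<in>I. \<gamma> t = rotate_phase 0 (sph_point (s_stat n \<kappa>) (((\<lambda>t. \<alpha> * t + \<beta>) \<circ> \<sigma>) t))"
    using \<gamma> g by (simp add: rotate_phase_def s_def)
  ultimately show ?thesis
    unfolding is_static_type_def congruent_curve_def reparametrization_def by blast
qed

end

lemma is_extension_typeI:
  assumes \<delta>: "extended_curve n \<kappa> C D \<delta>" and h: "homeomorphism J D \<phi> \<psi>" "\<And>t. t \<in> J \<Longrightarrow> g t = \<delta> (\<phi> t)"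
    and hom: "homeomorphism I J \<sigma> \<tau>" and \<gamma>: "\<And>t. t \<in> I \<Longrightarrow> \<gamma> t = g (\<sigma> t)"
  shows "is_extension_type n \<kappa> C I \<gamma>"
proof -
  have "\<sigma> t \<in> J" if "t \<in> I" for t using hom that by (auto simp: homeomorphism_def)
  then have "\<forall>t\<in>I. \<gamma> t = rotate_phase 0 (\<delta> ((\<phi> \<circ> \<sigma>) t))"
    using \<gamma> h(2) by (simp add: rotate_phase_def)
  then show ?thesis
    unfolding is_extension_type_def congruent_curve_def reparametrization_def
    using \<delta> homeomorphism_compose[OF hom h(1)] by blast
qed

lemma (in maximal_profile) extension_type:
  assumes "C \<noteq> 0" and hom: "homeomorphism I J \<sigma> \<tau>" and \<gamma>: "\<And>t. t \<in> I \<Longrightarrow> \<gamma> t = g (\<sigma> t)"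
  shows "is_extension_type n \<kappa> C I \<gamma>"
proof -
  obtain \<phi> t1 where "angle_profile n \<kappa> J g v C \<phi> t1" by (rule angle_exists)
  then interpret angle_profile n \<kappa> J g v C \<phi> t1 .
  obtain \<delta> \<psi> where "extended_curve n \<kappa> C UNIV \<delta>" "homeomorphism J UNIV \<phi> \<psi>" "\<And>t. t \<in> J \<Longrightarrow> g t = \<delta> (\<phi> t)"
    using extended_curve_nonzero[OF assms(1)] by blast
  then show ?thesis
    by (rule is_extension_typeI[of n \<kappa> C UNIV \<delta> J \<phi> \<psi> g I \<sigma> \<tau> \<gamma>, OF _ _ _ hom \<gamma>])
qed

theorem corollary4p13:
  fixes n :: nat and h k :: real
    and I :: "real set" and \<gamma> :: "real \<Rightarrow> complex \<times> real"
  assumes "n \<ge> 3" and "CARD('m::finite) = n - 1"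
    and "h \<noteq> 0" and "k = \<bar>h\<bar>"
    and "maximal_delaunay_curve TYPE('m) h I \<gamma>"
  shows
    "is_static_type n k I \<gamma> \<or>
     (\<exists>C. 0 < C \<and> C < C_stat n k \<and> is_extension_type n k C I \<gamma>) \<or>
     (is_extension_type n k 0 I \<gamma> \<and> generates_round_sphere TYPE('m) k I \<gamma>) \<or>
     (\<exists>C. - k / (real n - 1) < C \<and> C < 0 \<and> is_extension_type n k C I \<gamma>) \<or>
     is_extension_type n (- k) (k / (real n - 1)) I \<gamma> \<or>
     (\<exists>C. k / (real n - 1) < C \<and> C < C_stat n (- k) \<and> is_extension_type n (- k) C I \<gamma>) \<or>
     is_static_type n (- k) I \<gamma>"
proof -
  have k: "0 < k" using assms(3,4) by simp
  obtain K g v \<sigma> \<tau> and N :: "real \<times> (real ^ 'm) \<Rightarrow> complex \<times> (real ^ 'm)"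
    where M: "maximal_trajectory n k K g v" and hom: "homeomorphism I K \<sigma> \<tau>"
      and \<gamma>: "\<And>t. t \<in> I \<Longrightarrow> \<gamma> t = g (\<sigma> t)" and N: "cmc_with_normal I \<gamma> N k"
      and Nt: "\<And>t x. t \<in> I \<Longrightarrow> N (t, x) =
       (- fst (vprod (g (\<sigma> t)) (v (\<sigma> t))), (- snd (vprod (g (\<sigma> t)) (v (\<sigma> t)))) *\<^sub>R x)"
    using maximal_delaunay_trajectory[OF assms(1,2,5,4)] by blast
  have "trajectory n k K g v" using M by (simp add: maximal_trajectory_def)
  then obtain C where "profile_curve n k K g v C"
    by (rule trajectory_first_integral[OF assms(1)])
  then interpret P: profile_curve n k K g v C .
  \<comment> \<open>Reversal of orientation is a change of parameter, so the curve may be described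
    by (k, C) or by (-k, -C).\<close>
  have "homeomorphism K ((\<lambda>t. - t) ` K) uminus uminus"
    by (auto simp: homeomorphism_def image_image intro!: continuous_intros)
  then have hom': "homeomorphism I ((\<lambda>t. - t) ` K) (uminus \<circ> \<sigma>) (\<tau> \<circ> uminus)"
    by (rule homeomorphism_compose[OF hom])
  have \<gamma>': "\<And>t. t \<in> I \<Longrightarrow> \<gamma> t = g (- (uminus \<circ> \<sigma>) t)" by (simp add: \<gamma>)
  interpret R: profile_curve n "- k" "(\<lambda>t. - t) ` K" "\<lambda>t. g (- t)" "\<lambda>t. - v (- t)" "- C"
    by (rule P.reverse_profile)
  show ?thesis
  proof (cases "C = C_stat n k")
    case True
    then show ?thesis using P.static[OF M True hom \<gamma>] by simp
  next
    case C1: False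
    show ?thesis
    proof (cases "- C = C_stat n (- k)")
      case True
      then show ?thesis
        using R.static[OF maximal_trajectory_reverse[OF M] True hom' \<gamma>'] by simp
    next
      case C2: False
      interpret MP: maximal_profile n k K g v C
        by unfold_locales (use M C1 C2 P.C_bounds in auto)
      \<comment> \<open>At C = -k/(n-1) the function R vanishes for s = \<pi>/2, so this is the
        curve through (0, 1). From there downwards the classification names the reversed pair (-k,
        -C).\<close>
      consider "C \<le> - k / (real n - 1)" | "- k / (real n - 1) < C" "C < 0" | "C = 0" | "0 < C" by linarith
      then show ?thesis
      proof cases
        case 1
        interpret MR: maximal_profile n "- k" "(\<lambda>t. - t) ` K" "\<lambda>t. g (- t)" "\<lambda>t. - v (- t)" "- C"
          by (rule MP.reverse)
        have "0 < k / (real n - 1)" using k assms(1) by simp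
        then have "- C \<noteq> 0" using 1 by auto
        then have E: "is_extension_type n (- k) (- C) I \<gamma>"
          by (rule MR.extension_type[OF _ hom' \<gamma>'])
        show ?thesis
        proof (cases "- C = k / (real n - 1)")
          case True
          then show ?thesis using E by simp
        next
          case False
          then have "k / (real n - 1) < - C" using 1 by simp
          then show ?thesis using E MR.nd(1) by blast
        qed
      next
        case 2
        then show ?thesis using MP.extension_type[OF _ hom \<gamma>] by blast
      next
        case 3
        obtain \<phi> t1 where "angle_profile n k K g v C \<phi> t1" by (rule MP.angle_exists)
        then interpret A: angle_profile n k K g v C \<phi> t1 .
        interpret S: sphere_profile n k K g v C \<phi> t1 by unfold_locales (use 3 k in auto)
        obtain D \<delta> \<psi> where "extended_curve n k C D \<delta>" "homeomorphism K D \<phi> \<psi>" "\<And>t. t \<in> K \<Longrightarrow> g t = \<delta> (\<phi> t)"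
          using S.extended_curve_zero by blast
        then have "is_extension_type n k C I \<gamma>" 
          by (rule is_extension_typeI[of n k C D \<delta> K \<phi> \<psi> g I \<sigma> \<tau> \<gamma>, OF _ _ _ hom \<gamma>])
        then show ?thesis using S.generates_round_sphere[OF hom \<gamma> N Nt] 3 by simp
      next
        case 4
        then show ?thesis using MP.extension_type[OF _ hom \<gamma>] MP.nd(1) by blast
      qed
    qed
  qed
qed

end
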